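(* Let $n\ge4$ and let $Q$ be a Dynkin quiver of type $D_n$. For a positive root $\gamma\in\Phi_n^+$: (i) the number of minimal pairs of $\gamma$ is $|\mathrm{Supp}_{\ge1}(\gamma)|-1$; (ii) the number of non-minimal pairs of $\gamma$ is $|\mathrm{Supp}_{\ge2}(\gamma)|$. Hence the number of pairs $(\alpha,\beta)$ of $\gamma=\alpha+\beta$ is $\mathrm{ht}(\gamma)-1$.
   Context: Type $D_n$ and the AR-quiver. $\Delta_n$ ($n\ge4$) is the Dynkin diagram of type $D_n$ with vertex set $I_0=\{1,\dots,n\}$ and edges $i - (i+1)$ for $1\le i\le n-2$ and $(n-2) - n$. With $\varepsilon_1,\dots,\varepsilon_n$ orthonormal, $\alpha_i=\varepsilon_i-\varepsilon_{i+1}$ ($i\le n-1$), $\alpha_n=\varepsilon_{n-1}+\varepsilon_n$, and $\Phi_n^+=\{\varepsilon_a\pm\varepsilon_b : 1\le a<b\le n\}$. For $\gamma=\sum_{i\in I_0}n_i\alpha_i\in\Phi_n^+$ and $k\ge1$, $\mathrm{Supp}_{\ge k}(\gamma)=\{i\in I_0: n_i\ge k\}$ and $\mathrm{ht}(\gamma)=\sum_{i\in I_0} n_i$. A Dynkin quiver $Q$ of type $D_n$ is an orientation of $\Delta_n$. Fix a height function $\xi:I_0\to\mathbb Z$, i.e. $\xi_j=\xi_i-1$ whenever $i\to j$ in $Q$. For $i\in I_0$ let $\eta_i=\sum_j\alpha_j$, the sum over all $j$ admitting a (possibly trivial) path from $j$ to $i$ in $Q$. Let $s_iQ$ be $Q$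 with all arrows at $i$ reversed, and let $\tau=s_{i_1}\cdots s_{i_n}$ be the Coxeter element adapted to $Q$: $\{i_1,\dots,i_n\}=I_0$ and $i_k$ is a source of $s_{i_{k-1}}\cdots s_{i_1}Q$ for all $k$. Put $m_i=\max\{k\ge 0:\tau^k(\eta_i)\in\Phi_n^+\}$. The Auslander-Reiten quiver $\Gamma_Q$ has vertices $(i,\xi_i-2k)$ with $i\in I_0$, $0\le k\le m_i$, and arrows $(i,p)\to(j,p+1)$ for $i,j$ adjacent in $\Delta_n$. Its vertices are identified with $\Phi_n^+$ by $(i,\xi_i-2k)\leftrightarrow\tau^k(\eta_i)$. Order and pairs. $\alpha\prec_Q\beta$ iff $\alpha\ne\beta$ and there is a path from $\beta$ to $\alpha$ in $\Gamma_Q$. A total order $<$ on $\Phi_n^+$ is compatible with $\prec_Q$ if $\alpha\prec_Q\beta$ implies $\alpha<\beta$. A pair of $\gamma\in\Phi_n^+$ is $(\alpha,\beta)$ with $\alpha,\beta\in\Phi_n^+$, $\alpha+\beta=\gamma$ and $\alpha\prec_Q\beta$ (two positive roots whose sum is a root are always comparable for $\prec_Q$). It is minimal with respect to $<$ if there is no pair $(\alpha',\beta')$ of $\gamma$ with $\alpha<\alpha'<\gamma<\beta'<\beta$. A pair is called minimal if it is minimal with respect to some total order compatible with $\prec_Q$, and non-minimal otherwise.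
   Formalization: The maximum defining m_i does not exist literally, because τ has finite order and η_i recurs; m_i is taken to be the largest m such that τ^k(η_i) is a positive root for all 0 ≤ k ≤ m. *)

theory Defs
  imports Main "HOL-Library.Function_Algebras"
begin

(* Vectors are given by their coordinates in the orthonormal basis eps 1, ..., eps n.  All vectors
   that occur lie in the root lattice, so integer coordinates suffice; addition and subtraction are
   pointwise. *)

type_synonym vec = "nat \<Rightarrow> int"

subsection \<open>The root system of type \<open>D\<^sub>n\<close>\<close>

definition I0 :: "nat \<Rightarrow> nat set" where
  "I0 n = {1..n}"

definition edges :: "nat \<Rightarrow> nat rel" where
  "edges n = {(i, i + 1) | i. 1 \<le> i \<and> i \<le> n - 2} \<union> {(n - 2, n)}"

definition adjacent :: "nat \<Rightarrow> nat \<Rightarrow> nat \<Rightarrow> bool" where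
  "adjacent n i j \<longleftrightarrow> (i, j) \<in> edges n \<or> (j, i) \<in> edges n"

definition eps :: "nat \<Rightarrow> vec" where
  "eps a = (\<lambda>k. if k = a then 1 else 0)"

definition inner :: "nat \<Rightarrow> vec \<Rightarrow> vec \<Rightarrow> int" where
  "inner n x y = (\<Sum>k\<in>{1..n}. x k * y k)"

definition simple_root :: "nat \<Rightarrow> nat \<Rightarrow> vec" where
  "simple_root n i = (if i = n then eps (n - 1) + eps n else eps i - eps (i + 1))"

definition pos_roots :: "nat \<Rightarrow> vec set" where
  "pos_roots n = {eps a - eps b | a b. 1 \<le> a \<and> a < b \<and> b \<le> n}
               \<union> {eps a + eps b | a b. 1 \<le> a \<and> a < b \<and> b \<le> n}"

(* No division by (alpha_i, alpha_i) / 2 is needed, since every root has square length 2. *)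
definition simple_refl :: "nat \<Rightarrow> nat \<Rightarrow> vec \<Rightarrow> vec" where
  "simple_refl n i x = (\<lambda>k. x k - inner n x (simple_root n i) * simple_root n i k)"

definition simple_coeff :: "nat \<Rightarrow> vec \<Rightarrow> nat \<Rightarrow> int" where
  "simple_coeff n \<gamma> =
     (THE c. (\<forall>i. i \<notin> I0 n \<longrightarrow> c i = 0) \<and> \<gamma> = (\<Sum>i\<in>I0 n. (\<lambda>k. c i * simple_root n i k)))"

definition Supp_ge :: "nat \<Rightarrow> int \<Rightarrow> vec \<Rightarrow> nat set" where
  "Supp_ge n k \<gamma> = {i \<in> I0 n. simple_coeff n \<gamma> i \<ge> k}"

definition ht :: "nat \<Rightarrow> vec \<Rightarrow> int" where
  "ht n \<gamma> = (\<Sum>i\<in>I0 n. simple_coeff n \<gamma> i)"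

subsection \<open>Dynkin quivers and adapted Coxeter elements\<close>

(* A quiver is given by its set of arrows; (i, j) is the arrow i --> j. *)
definition dynkin_quiver :: "nat \<Rightarrow> nat rel \<Rightarrow> bool" where
  "dynkin_quiver n Q \<longleftrightarrow> Q \<union> Q\<inverse> = {(i, j). adjacent n i j} \<and> Q \<inter> Q\<inverse> = {}"

definition height_function :: "nat rel \<Rightarrow> (nat \<Rightarrow> int) \<Rightarrow> bool" where
  "height_function Q \<xi> \<longleftrightarrow> (\<forall>(i, j)\<in>Q. \<xi> j = \<xi> i - 1)"

definition \<eta> :: "nat \<Rightarrow> nat rel \<Rightarrow> nat \<Rightarrow> vec" where
  "\<eta> n Q i = (\<Sum>j\<in>{j \<in> I0 n. (j, i) \<in> Q\<^sup>*}. simple_root n j)"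

definition reverse_at :: "nat \<Rightarrow> nat rel \<Rightarrow> nat rel" where
  "reverse_at i Q = {(a, b). if a = i \<or> b = i then (b, a) \<in> Q else (a, b) \<in> Q}"

definition is_source :: "nat \<Rightarrow> nat rel \<Rightarrow> bool" where
  "is_source i Q \<longleftrightarrow> (\<forall>j. (j, i) \<notin> Q)"

(* With w = [i_1, ..., i_n] and 0-based k, fold reverse_at (take k w) Q is s_{i_k} ... s_{i_1} Q. *)
definition adapted_word :: "nat \<Rightarrow> nat rel \<Rightarrow> nat list \<Rightarrow> bool" where
  "adapted_word n Q w \<longleftrightarrow> distinct w \<and> set w = I0 n \<and>
     (\<forall>k<length w. is_source (w ! k) (fold reverse_at (take k w) Q))"

(* foldr makes this s_{i_1} o ... o s_{i_n}, with s_{i_n} applied first. *)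
definition coxeter :: "nat \<Rightarrow> nat list \<Rightarrow> vec \<Rightarrow> vec" where
  "coxeter n w = foldr (simple_refl n) w"

subsection \<open>The Auslander-Reiten quiver\<close>

(* The Coxeter element has finite order, so a power of it maps eta_i back into the positive roots
   infinitely often; the maximum is over the initial run of positive values. *)
definition AR_max :: "nat \<Rightarrow> nat rel \<Rightarrow> nat list \<Rightarrow> nat \<Rightarrow> nat" where
  "AR_max n Q w i = (GREATEST m. \<forall>k\<le>m. (coxeter n w ^^ k) (\<eta> n Q i) \<in> pos_roots n)"

(* The identification of vertices with positive roots, as a relation. *)
definition AR_labels ::
  "nat \<Rightarrow> nat rel \<Rightarrow> (nat \<Rightarrow> int) \<Rightarrow> nat list \<Rightarrow> ((nat \<times> int) \<times> vec) set" where
  "AR_labels n Q \<xi> w =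
     {((i, \<xi> i - 2 * int k), (coxeter n w ^^ k) (\<eta> n Q i)) | i k. i \<in> I0 n \<and> k \<le> AR_max n Q w i}"

definition AR_vertices ::
  "nat \<Rightarrow> nat rel \<Rightarrow> (nat \<Rightarrow> int) \<Rightarrow> nat list \<Rightarrow> (nat \<times> int) set" where
  "AR_vertices n Q \<xi> w = {(i, \<xi> i - 2 * int k) | i k. i \<in> I0 n \<and> k \<le> AR_max n Q w i}"

definition AR_arrows ::
  "nat \<Rightarrow> nat rel \<Rightarrow> (nat \<Rightarrow> int) \<Rightarrow> nat list \<Rightarrow> (nat \<times> int) rel" where
  "AR_arrows n Q \<xi> w =
     {((i, p), (j, p + 1)) | i j p. (i, p) \<in> AR_vertices n Q \<xi> w \<and> (j, p + 1) \<in> AR_vertices n Q \<xi> w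
                                  \<and> adjacent n i j}"

definition AR_prec ::
  "nat \<Rightarrow> nat rel \<Rightarrow> (nat \<Rightarrow> int) \<Rightarrow> nat list \<Rightarrow> vec \<Rightarrow> vec \<Rightarrow> bool" where
  "AR_prec n Q \<xi> w \<alpha> \<beta> \<longleftrightarrow> \<alpha> \<noteq> \<beta> \<and>
     (\<exists>u v. (u, \<beta>) \<in> AR_labels n Q \<xi> w \<and> (v, \<alpha>) \<in> AR_labels n Q \<xi> w \<and> (u, v) \<in> (AR_arrows n Q \<xi> w)\<^sup>*)"

subsection \<open>Pairs\<close>

(* (x, y) \<in> L means that x is strictly smaller than y in the total order. *)
definition compatible_order ::
  "nat \<Rightarrow> nat rel \<Rightarrow> (nat \<Rightarrow> int) \<Rightarrow> nat list \<Rightarrow> vec rel \<Rightarrow> bool" where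
  "compatible_order n Q \<xi> w L \<longleftrightarrow>
     L \<subseteq> pos_roots n \<times> pos_roots n \<and> strict_linear_order_on (pos_roots n) L \<and>
     (\<forall>\<alpha>\<in>pos_roots n. \<forall>\<beta>\<in>pos_roots n. AR_prec n Q \<xi> w \<alpha> \<beta> \<longrightarrow> (\<alpha>, \<beta>) \<in> L)"

definition pairs ::
  "nat \<Rightarrow> nat rel \<Rightarrow> (nat \<Rightarrow> int) \<Rightarrow> nat list \<Rightarrow> vec \<Rightarrow> (vec \<times> vec) set" where
  "pairs n Q \<xi> w \<gamma> =
     {(\<alpha>, \<beta>). \<alpha> \<in> pos_roots n \<and> \<beta> \<in> pos_roots n \<and> \<alpha> + \<beta> = \<gamma> \<and> AR_prec n Q \<xi> w \<alpha> \<beta>}"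

definition minimal_wrt ::
  "nat \<Rightarrow> nat rel \<Rightarrow> (nat \<Rightarrow> int) \<Rightarrow> nat list \<Rightarrow> vec rel \<Rightarrow> vec \<Rightarrow> vec \<times> vec \<Rightarrow> bool" where
  "minimal_wrt n Q \<xi> w L \<gamma> = (\<lambda>(\<alpha>, \<beta>). \<not> (\<exists>(\<alpha>', \<beta>')\<in>pairs n Q \<xi> w \<gamma>.
     (\<alpha>, \<alpha>') \<in> L \<and> (\<alpha>', \<gamma>) \<in> L \<and> (\<gamma>, \<beta>') \<in> L \<and> (\<beta>', \<beta>) \<in> L))"

definition minimal_pairs ::
  "nat \<Rightarrow> nat rel \<Rightarrow> (nat \<Rightarrow> int) \<Rightarrow> nat list \<Rightarrow> vec \<Rightarrow> (vec \<times> vec) set" where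
  "minimal_pairs n Q \<xi> w \<gamma> =
     {p \<in> pairs n Q \<xi> w \<gamma>. \<exists>L. compatible_order n Q \<xi> w L \<and> minimal_wrt n Q \<xi> w L \<gamma> p}"

subsection \<open>Existence of height functions and adapted words\<close>

lemma height_function_exists:
  assumes "n \<ge> 4" "dynkin_quiver n Q"
  shows "\<exists>\<xi>. height_function Q \<xi>"
proof -
  define d :: "nat \<Rightarrow> nat \<Rightarrow> int" where "d i j = (if (i, j) \<in> Q then 1 else - 1)" for i j
  define f :: "nat \<Rightarrow> int" where "f i = - (\<Sum>k<i. d k (Suc k))" for i
  define \<xi> where "\<xi> i = (if i = n then f (n - 2) - d (n - 2) n else f i)" for i
  have f: "f (Suc i) = f i - d i (Suc i)" for i
    by (simp add: f_def)
  have step: "\<xi> j = \<xi> i - d i j" if "(i, j) \<in> edges n" for i j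
    using that assms(1) by (auto simp: edges_def \<xi>_def f)
  have anti: "(j, i) \<notin> Q" if "(i, j) \<in> Q" for i j
    using that assms(2) by (auto simp: dynkin_quiver_def)
  have "\<xi> j = \<xi> i - 1" if Q: "(i, j) \<in> Q" for i j
  proof -
    have "adjacent n i j"
      using Q assms(2) by (auto simp: dynkin_quiver_def)
    then show ?thesis
      using step[of i j] step[of j i] Q anti[OF Q] by (auto simp: adjacent_def d_def)
  qed
  then show ?thesis
    by (auto simp: height_function_def)
qed

lemma fold_reverse_at:
  "distinct us \<Longrightarrow> (a, b) \<in> fold reverse_at us Q \<longleftrightarrow>
     (if (a \<in> set us) = (b \<in> set us) then (a, b) \<in> Q else (b, a) \<in> Q)"
  by (induction us arbitrary: a b rule: rev_induct) (auto simp: reverse_at_def)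

lemma adapted_word_exists:
  assumes "n \<ge> 4" "dynkin_quiver n Q"
  shows "\<exists>w. adapted_word n Q w"
proof -
  obtain \<xi> where \<xi>: "height_function Q \<xi>"
    using height_function_exists[OF assms] by blast
  have \<xi>': "\<xi> j < \<xi> i" if "(i, j) \<in> Q" for i j
    using \<xi> that by (auto simp: height_function_def)
  define w where "w = sort_key (\<lambda>i. - \<xi> i) [1..<n + 1]"
  have dist: "distinct w" and set: "set w = I0 n"
    by (auto simp: w_def I0_def)
  have "sorted (map (\<lambda>i. - \<xi> i) w)"
    by (simp add: w_def)
  then have mono: "\<xi> (w ! l) \<le> \<xi> (w ! k)" if "k \<le> l" "l < length w" for k l
    using that by (auto simp: sorted_iff_nth_mono)
  have V: "i \<in> I0 n \<and> j \<in> I0 n" if "(i, j) \<in> Q" for i j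
  proof -
    have "adjacent n i j"
      using that assms(2) by (auto simp: dynkin_quiver_def)
    then show ?thesis
      using assms(1) by (auto simp: adjacent_def edges_def I0_def)
  qed
  have "is_source (w ! k) (fold reverse_at (take k w) Q)" if k: "k < length w" for k
    unfolding is_source_def
  proof (intro allI notI)
    fix j
    assume A: "(j, w ! k) \<in> fold reverse_at (take k w) Q"
    have nk: "w ! k \<notin> set (take k w)"
      using k dist by (auto simp: in_set_conv_nth nth_eq_iff_index_eq)
    have "(j, w ! k) \<in> Q \<and> j \<notin> set (take k w) \<or> (w ! k, j) \<in> Q \<and> j \<in> set (take k w)"
      using A nk dist \<xi>'[of "w ! k" "w ! k"] by (auto simp: fold_reverse_at split: if_splits)
    then show False
    proof
      assume B: "(j, w ! k) \<in> Q \<and> j \<notin> set (take k w)"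
      then have "j \<in> set w"
        using V set by blast
      then obtain l where l: "l < length w" "j = w ! l"
        by (auto simp: in_set_conv_nth)
      then have "k \<le> l"
        using B k by (metis in_set_conv_nth length_take min_less_iff_conj not_le nth_take)
      then show False
        using mono[of k l] \<xi>'[of j "w ! k"] l B by auto
    next
      assume B: "(w ! k, j) \<in> Q \<and> j \<in> set (take k w)"
      then obtain l where l: "l < k" "j = w ! l"
        by (auto simp: in_set_conv_nth)
      then show False
        using mono[of l k] \<xi>'[of "w ! k" j] k B by auto
    qed
  qed
  then show ?thesis
    using dist set by (auto simp: adapted_word_def)
qed

end

theory Submission
  imports Defs
begin

text \<open>
The Coxeter element permutes a basis up to signs, and this turns the Auslander-Reiten quiver into a
picture in the plane.  Put \<open>h = 2 (n - 1)\<close>, the Coxeter number.  All basis vectors but one, up to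
signs, are the members of a two-sided sequence \<open>X\<close>, indexed by the integers of one parity, with
\<open>X (q - h) = - X q\<close> and \<open>\<tau> (X q) = X (q - 2)\<close>; the remaining vector \<open>eps z\<close>, where \<open>z\<close> is \<open>n\<close> or
\<open>n - 1\<close>, satisfies \<open>\<tau> (eps z) = - eps z\<close>.  As \<open>\<eta>\<^sub>i = X (\<xi>\<^sub>i + i) - X (\<xi>\<^sub>i - i)\<close> for \<open>i \<le> n - 2\<close>, the
vertex \<open>(i, p)\<close> carries the root \<open>X (p + i) - X (p - i)\<close>, while the vertices \<open>(n - 1, p)\<close> and \<open>(n, p)\<close>
carry the two roots \<open>\<plusminus> eps z - X (p - (n - 1))\<close>.  Give a root the coordinates \<open>(p - i, p + i)\<close> of its
vertex, with \<open>n\<close> replaced by \<open>n - 1\<close>.  The quiver is convex, so there is a path from one root to a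
different one if and only if the coordinates of the first are at most those of the second in both components
and not equal to them (\<open>prec_iff\<close>).

Let \<open>\<gamma> = X q - X p\<close> with \<open>p < q < p + h\<close>.  A decomposition of \<open>\<gamma>\<close> inserts \<open>\<plusminus> X u\<close> or \<open>\<plusminus> eps z\<close>, and up
to periodicity it has one of five shapes.  Comparing coordinates shows that only one of
them, the crossing shape with summands at \<open>(q - h, u)\<close> and \<open>(u, p + h)\<close> for \<open>p < u < q\<close>, can enclose
another decomposition; it does so if the decomposition with summands at \<open>(p, u)\<close> and \<open>(u, q)\<close>, which
arises from it by changing the sign of the inserted vector, also consists of positive roots
(\<open>splits_nested\<close>, \<open>inside_cross\<close>).  A root at \<open>(p, p + h)\<close> has two further shapes of decomposition,
and none of them encloses another.

A pair is minimal for some compatible total order if and only if it encloses no pair for the partial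
order: there is a linear extension in which everything that follows the pair's smaller member is really
larger than it, and everything of this kind that precedes the larger member is really
smaller (\<open>linear_extension_tight\<close>).  So the non-minimal pairs are the crossing ones.
The places \<open>place c\<close> with \<open>X (place c) = \<plusminus> eps c\<close> form a valley: an index never exceeds both of two
indices on either side of it (\<open>place_valley\<close>).  Hence crossing decompositions only exist for
\<open>\<gamma> = y a + y b\<close>, where \<open>a < b\<close> and \<open>y c = \<plusminus> eps c\<close> has a sign chosen according to the orientation of the branch.
They need \<open>a\<close> and \<open>b\<close> to differ from \<open>z\<close>, and then for each \<open>c > b\<close> other than \<open>z\<close> exactly one of the two decompositions that insert \<open>\<plusminus> y c\<close> is crossing.  Their number is the
number of simple roots of multiplicity 2 in \<open>\<gamma>\<close>.  The total number of pairs is \<open>ht \<gamma> - 1\<close> by direct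
enumeration, and \<open>ht \<gamma> = card (Supp_ge n 1 \<gamma>) + card (Supp_ge n 2 \<gamma>)\<close> since all multiplicities are at most 2.
\<close>

section \<open>A linear extension of a finite order fitted to one pair\<close>

text \<open>Lay out first the elements that are not above \<open>a\<close>, then those between \<open>a\<close> and \<open>b\<close>, then the rest.  This is
compatible with \<open>r\<close> since being above \<open>a\<close> passes to larger elements and being below \<open>b\<close> to smaller ones.
Inside a block any linear extension will do; here it is the number of predecessors, with ties broken by
an enumeration.  The outcome is that a chain \<open>a < x < y < b\<close> in the total order with \<open>r x y\<close> is already a chain
for \<open>r\<close>.\<close>

lemma linear_extension_tight:
  fixes r :: "'a \<Rightarrow> 'a \<Rightarrow> bool"
  assumes fin: "finite A" and ab: "a \<in> A" "b \<in> A" "r a b"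
    and trans: "\<And>x y z. x \<in> A \<Longrightarrow> y \<in> A \<Longrightarrow> z \<in> A \<Longrightarrow> r x y \<Longrightarrow> r y z \<Longrightarrow> r x z"
    and irrefl: "\<And>x. x \<in> A \<Longrightarrow> \<not> r x x"
  obtains L where "L \<subseteq> A \<times> A" "strict_linear_order_on A L"
    "\<And>x y. x \<in> A \<Longrightarrow> y \<in> A \<Longrightarrow> r x y \<Longrightarrow> (x, y) \<in> L"
    "\<And>x y. (a, x) \<in> L \<Longrightarrow> r x y \<Longrightarrow> (y, b) \<in> L \<Longrightarrow> r a x \<and> r y b"
proof -
  obtain f :: "'a \<Rightarrow> nat" where f: "inj_on f A"
    using finite_imp_inj_to_nat_seg[OF fin] by blast
  define block :: "'a \<Rightarrow> nat" where
    "block x = (if \<not> (x = a \<or> r a x) then 0 else if x = b \<or> r x b then 1 else 2)" for x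
  define level :: "'a \<Rightarrow> nat" where "level x = card {y \<in> A. r y x}" for x
  have level: "level x < level y" if "x \<in> A" "y \<in> A" "r x y" for x y
  proof -
    have "{z \<in> A. r z x} \<subseteq> {z \<in> A. r z y}"
      using trans that by blast
    moreover have "x \<in> {z \<in> A. r z y}" "x \<notin> {z \<in> A. r z x}"
      using that irrefl by auto
    ultimately have "{z \<in> A. r z x} \<subset> {z \<in> A. r z y}"
      by blast
    then show ?thesis
      using fin by (simp add: level_def psubset_card_mono)
  qed
  have block: "block x \<le> block y" if "x \<in> A" "y \<in> A" "r x y" for x y
  proof -
    have "x = a \<or> r a x \<Longrightarrow> r a y" "r y b \<or> y = b \<Longrightarrow> r x b"
      using trans[OF ab(1) that(1,2)] trans[OF that(1,2) ab(2)] that(3) by blast+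
    then show ?thesis
      by (auto simp: block_def)
  qed
  define K where "K x = (block x, level x, f x)" for x
  define M where "M = inv_image (less_than <*lex*> less_than <*lex*> less_than) K"
  define L where "L = M \<inter> A \<times> A"
  have inM: "(x, y) \<in> M \<longleftrightarrow> block x < block y \<or> block x = block y \<and>
      (level x < level y \<or> level x = level y \<and> f x < f y)" for x y
    by (auto simp: M_def K_def)
  show thesis
  proof
    show "L \<subseteq> A \<times> A" by (simp add: L_def)
    have "trans M"
      unfolding M_def by (intro trans_inv_image trans_lex_prod trans_less_than)
    then have "trans L"
      unfolding L_def by (auto intro!: transI dest: transD)
    moreover have "irrefl L"
      by (auto simp: L_def irrefl_def inM)
    moreover have "total_on A L"
      unfolding total_on_def
    proof (intro ballI impI)
      fix x y
      assume xy: "x \<in> A" "y \<in> A" "x \<noteq> y"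
      then have "f x \<noteq> f y"
        using f by (auto dest: inj_onD)
      then show "(x, y) \<in> L \<or> (y, x) \<in> L"
        using xy by (simp add: L_def inM) linarith
    qed
    ultimately show "strict_linear_order_on A L"
      by (simp add: strict_linear_order_on_def)
    show "(x, y) \<in> L" if "x \<in> A" "y \<in> A" "r x y" for x y
      using level[OF that] block[OF that] that by (auto simp: L_def inM)
    show "r a x \<and> r y b" if ax: "(a, x) \<in> L" and xy: "r x y" and yb: "(y, b) \<in> L" for x y
    proof -
      have A: "x \<in> A" "y \<in> A" using ax yb by (auto simp: L_def)
      have "block a = 1" "block b = 1"
        using ab by (auto simp: block_def)
      then have "1 \<le> block x" "block y \<le> 1"
        using ax yb by (auto simp: L_def inM)
      have "x \<noteq> a" "y \<noteq> b"
        using ax yb by (auto simp: L_def inM)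
      then have ax': "r a x"
        using \<open>1 \<le> block x\<close> by (auto simp: block_def split: if_splits)
      then have "r a y"
        using trans[OF ab(1) A] xy by blast
      then show ?thesis
        using ax' \<open>block y \<le> 1\<close> \<open>y \<noteq> b\<close> by (auto simp: block_def split: if_splits)
    qed
  qed
qed

section \<open>Coefficients in the basis of simple roots\<close>

lemma sum_vec_apply: "(\<Sum>i\<in>A. (f i :: vec)) k = (\<Sum>i\<in>A. f i k)"
  by (induction A rule: infinite_finite_induct) auto

lemma simple_root_combination:
  assumes n: "n \<ge> 4"
  shows "(\<Sum>i\<in>I0 n. (\<lambda>k. c i * simple_root n i k)) k =
    (if k = 0 \<or> k > n then 0
     else if k = n then c n - c (n - 1)
     else c k - (if k = 1 then 0 else c (k - 1)) + (if k = n - 1 then c n else 0))"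
proof -
  have "(\<Sum>i\<in>I0 n. (\<lambda>k. c i * simple_root n i k)) k = (\<Sum>i\<in>I0 n. c i * simple_root n i k)"
    by (simp add: sum_vec_apply)
  also have "\<dots> = (\<Sum>i\<in>I0 n. (if i = k then if k < n then c i else 0 else 0)
      + (if i = k - 1 then if k \<noteq> 0 \<and> k \<le> n then - c i else 0 else 0)
      + (if i = n then if k = n - 1 \<or> k = n then c i else 0 else 0))"
    by (rule sum.cong) (use n in \<open>auto simp: simple_root_def eps_def I0_def\<close>)
  also have "\<dots> = (if k = 0 \<or> k > n then 0
     else if k = n then c n - c (n - 1)
     else c k - (if k = 1 then 0 else c (k - 1)) + (if k = n - 1 then c n else 0))"
    using n by (auto simp: sum.distrib I0_def)
  finally show ?thesis .
qed

text \<open>The coordinates at \<open>1, \<dots>, n - 2\<close> determine the coefficients one after the other; the last two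
coordinates give the sum and the difference of the coefficients at \<open>n - 1\<close> and \<open>n\<close>.\<close>

lemma simple_coeff_eqI:
  assumes n: "n \<ge> 4" and c: "\<And>i. i \<notin> I0 n \<Longrightarrow> c i = 0"
    and \<gamma>: "\<gamma> = (\<Sum>i\<in>I0 n. (\<lambda>k. c i * simple_root n i k))"
  shows "simple_coeff n \<gamma> = c"
  unfolding simple_coeff_def
proof (rule the_equality)
  show "(\<forall>i. i \<notin> I0 n \<longrightarrow> c i = 0) \<and> \<gamma> = (\<Sum>i\<in>I0 n. (\<lambda>k. c i * simple_root n i k))"
    using c \<gamma> by blast
  fix d
  assume d: "(\<forall>i. i \<notin> I0 n \<longrightarrow> d i = 0) \<and> \<gamma> = (\<Sum>i\<in>I0 n. (\<lambda>k. d i * simple_root n i k))"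
  have eq: "(\<Sum>i\<in>I0 n. (\<lambda>k. d i * simple_root n i k)) k = (\<Sum>i\<in>I0 n. (\<lambda>k. c i * simple_root n i k)) k" for k
    using d \<gamma> by simp
  have low: "d k = c k" if "k \<le> n - 2" for k
    using that
  proof (induction k)
    case 0
    then show ?case using d c by (simp add: I0_def)
  next
    case (Suc k)
    then show ?case
      using eq[of "Suc k"] n by (simp add: simple_root_combination split: if_splits)
  qed
  have last: "d (n - 1) + d n = c (n - 1) + c n" "d n - d (n - 1) = c n - c (n - 1)"
  proof -
    have "n - 1 \<noteq> 0" "n - 1 \<noteq> n" "\<not> n < n - 1" "n - 1 \<noteq> 1" "n - 1 - 1 = n - 2" "n \<noteq> 0"
      using n by auto
    then show "d (n - 1) + d n = c (n - 1) + c n" "d n - d (n - 1) = c n - c (n - 1)"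
      using eq[of "n - 1"] eq[of n] low[of "n - 2"] unfolding simple_root_combination[OF n] by simp_all
  qed
  show "d = c"
  proof
    fix k
    consider "k \<le> n - 2" | "k = n - 1" | "k = n" | "k > n" by linarith
    then show "d k = c k"
      using low last d c by cases (auto simp: I0_def)
  qed
qed

text \<open>Setting \<open>c 0 = 0\<close> makes the equation for the first coordinate an instance of the general one.\<close>

lemma simple_root_combinationI:
  assumes n: "n \<ge> 4" and "c 0 = 0"
    and "\<gamma> 0 = 0" "\<And>k. k > n \<Longrightarrow> \<gamma> k = 0" "\<And>k. Suc k \<le> n - 2 \<Longrightarrow> \<gamma> (Suc k) = c (Suc k) - c k"
    and "\<gamma> (n - 1) = c (n - 1) - c (n - 2) + c n" "\<gamma> n = c n - c (n - 1)"
  shows "\<gamma> = (\<Sum>i\<in>I0 n. (\<lambda>k. c i * simple_root n i k))"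
proof
  fix k
  have "k = 0 \<or> k > n \<or> k = n \<or> k = n - 1 \<or> k = Suc (k - 1) \<and> Suc (k - 1) \<le> n - 2"
    by linarith
  then consider "k = 0" | "k > n" | "k = n" | "k = n - 1" | l where "k = Suc l" "Suc l \<le> n - 2"
    by blast
  then show "\<gamma> k = (\<Sum>i\<in>I0 n. (\<lambda>k. c i * simple_root n i k)) k"
  proof cases
    case 4
    moreover have "n - 1 \<noteq> 0" "n - 1 \<noteq> n" "\<not> n < n - 1" "n - 1 \<noteq> 1" "n - 1 - 1 = n - 2"
      using n by auto
    ultimately show ?thesis
      using assms unfolding simple_root_combination[OF n] by simp
  next
    case 5
    then have "Suc l \<noteq> n" "\<not> n < Suc l" "Suc l \<noteq> n - 1" "Suc l - 1 = l" "Suc l = 1 \<longrightarrow> l = 0"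
      using n by auto
    then show ?thesis
      using assms(2) assms(5)[OF 5(2)] 5(1) unfolding simple_root_combination[OF n] by (auto simp del: One_nat_def)
  qed (use assms in \<open>auto simp: simple_root_combination[OF n]\<close>)
qed

lemma simple_coeff_diff:
  assumes n: "n \<ge> 4" and ab: "1 \<le> a" "a < b" "b \<le> n"
  shows "simple_coeff n (eps a - eps b) = (\<lambda>i. if a \<le> i \<and> i < b then 1 else 0)"
    (is "_ = ?c")
proof (rule simple_coeff_eqI[OF n])
  show "eps a - eps b = (\<Sum>i\<in>I0 n. (\<lambda>k. ?c i * simple_root n i k))"
    by (rule simple_root_combinationI[OF n]) (use ab n in \<open>auto simp: eps_def\<close>)
qed (use ab in \<open>auto simp: I0_def\<close>)

lemma simple_coeff_sum:
  assumes n: "n \<ge> 4" and ab: "1 \<le> a" "a < b" "b \<le> n"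
  shows "simple_coeff n (eps a + eps b) =
    (\<lambda>i. if i = n then 1 else if i = n - 1 then if b = n then 0 else 1 else if i > n then 0
         else (if a \<le> i then 1 else 0) + (if b \<le> i then 1 else 0))"
    (is "_ = ?c")
proof (rule simple_coeff_eqI[OF n])
  show "eps a + eps b = (\<Sum>i\<in>I0 n. (\<lambda>k. ?c i * simple_root n i k))"
    by (rule simple_root_combinationI[OF n]) (use ab n in \<open>auto simp: eps_def\<close>)
qed (use ab in \<open>auto simp: I0_def\<close>)

lemma Supp_ge_2_diff:
  assumes "n \<ge> 4" "1 \<le> a" "a < b" "b \<le> n"
  shows "Supp_ge n 2 (eps a - eps b) = {}"
  by (auto simp: Supp_ge_def simple_coeff_diff[OF assms])

lemma Supp_ge_2_sum:
  assumes "n \<ge> 4" "1 \<le> a" "a < b" "b \<le> n"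
  shows "Supp_ge n 2 (eps a + eps b) = {b..n - 2}"
  using assms(2-) by (auto simp: Supp_ge_def simple_coeff_sum[OF assms] I0_def split: if_splits)

text \<open>All coefficients are 0, 1 or 2.\<close>

lemma ht_eq_card_Supp:
  assumes n: "n \<ge> 4" and "\<gamma> \<in> pos_roots n"
  shows "ht n \<gamma> = int (card (Supp_ge n 1 \<gamma>)) + int (card (Supp_ge n 2 \<gamma>))"
proof -
  obtain a b where ab: "1 \<le> a" "a < b" "b \<le> n" and \<gamma>: "\<gamma> = eps a - eps b \<or> \<gamma> = eps a + eps b"
    using assms(2) by (auto simp: pos_roots_def)
  have "simple_coeff n \<gamma> i \<in> {0, 1, 2}" for i
    using \<gamma> by (elim disjE) (simp_all add: simple_coeff_diff[OF n ab] simple_coeff_sum[OF n ab])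
  then have "simple_coeff n \<gamma> i = of_bool (1 \<le> simple_coeff n \<gamma> i) + of_bool (2 \<le> simple_coeff n \<gamma> i)" for i
    by (smt (verit, best) empty_iff insert_iff of_bool_eq(1,2))
  then have "ht n \<gamma> = (\<Sum>i\<in>I0 n. of_bool (1 \<le> simple_coeff n \<gamma> i) + of_bool (2 \<le> simple_coeff n \<gamma> i))"
    by (metis (no_types, lifting) ht_def sum.cong)
  then show ?thesis
    by (simp add: sum.distrib sum_of_bool_eq Supp_ge_def I0_def Int_def)
qed

lemma ht_diff:
  assumes n: "n \<ge> 4" and ab: "1 \<le> a" "a < b" "b \<le> n"
  shows "ht n (eps a - eps b) = int b - int a"
proof -
  have "I0 n \<inter> {i. a \<le> i \<and> i < b} = {a..<b}"
    using ab by (auto simp: I0_def)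
  then show ?thesis
    using ab by (simp add: ht_def simple_coeff_diff[OF n ab] sum.If_cases I0_def)
qed

lemma ht_sum:
  assumes n: "n \<ge> 4" and ab: "1 \<le> a" "a < b" "b \<le> n"
  shows "ht n (eps a + eps b) = 2 * int n - int a - int b"
proof -
  have "Supp_ge n 1 (eps a + eps b) = {a..n} - (if b = n then {n - 1} else {})"
    using ab n by (auto simp: Supp_ge_def simple_coeff_sum[OF n ab] I0_def split: if_splits)
  moreover have "eps a + eps b \<in> pos_roots n"
    using ab by (auto simp: pos_roots_def)
  ultimately show ?thesis
    using ab n by (simp add: ht_eq_card_Supp Supp_ge_2_sum[OF n ab] card_Diff_subset of_nat_diff)
qed

section \<open>Adapted Coxeter elements\<close>

(* Goals with a dozen disequations between indices are common below; with the default splitting limits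
   linear arithmetic spends its time on case distinctions that do not help. *)
declare [[linarith_neq_limit = 3, linarith_split_limit = 5]]

lemma inner_simple_root:
  assumes "n \<ge> 4" "i \<in> I0 n"
  shows "inner n x (simple_root n i) = (if i = n then x (n - 1) + x n else x i - x (i + 1))"
proof -
  have "inner n x (simple_root n i) =
    (\<Sum>k\<in>{1..n}. (if k = (if i = n then n - 1 else i) then x k else 0)
       + (if k = (if i = n then n else i + 1) then if i = n then x k else - x k else 0))"
    unfolding inner_def by (rule sum.cong) (use assms in \<open>auto simp: simple_root_def eps_def I0_def\<close>)
  then show ?thesis
    using assms by (auto simp: sum.distrib I0_def)
qed

lemma adjacent_iff:
  assumes "n \<ge> 4"
  shows "adjacent n i j \<longleftrightarrow> 1 \<le> i \<and> j = i + 1 \<and> j < n \<or> 1 \<le> j \<and> i = j + 1 \<and> i < n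
    \<or> i = n - 2 \<and> j = n \<or> j = n - 2 \<and> i = n"
proof -
  have "i \<le> n - 2 \<longleftrightarrow> i + 1 < n" for i
    using assms by linarith
  then show ?thesis
    unfolding adjacent_def edges_def by blast
qed

lemma inner_simple_roots:
  assumes n: "n \<ge> 4" and ij: "i \<in> I0 n" "j \<in> I0 n" "i \<noteq> j"
  shows "inner n (simple_root n i) (simple_root n j) = (if adjacent n i j then - 1 else 0)"
proof -
  consider "i = n" "j < n" | "i < n" "j = n" | "i < n" "j < n"
    using ij by (auto simp: I0_def nat_less_le)
  then show ?thesis
  proof cases
    case 1
    then have "adjacent n i j \<longleftrightarrow> j = n - 2"
      using n by (simp add: adjacent_iff)
    moreover have "j = n - 2 \<or> j = n - 1 \<or> j < n - 2" "n - 2 + 1 = n - 1" "n - 1 + 1 = n" "n - 1 \<noteq> n - 2"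
      using n 1 by auto
    ultimately show ?thesis
      using 1 unfolding inner_simple_root[OF n ij(2)] by (auto simp: simple_root_def eps_def)
  next
    case 2
    then have "adjacent n i j \<longleftrightarrow> i = n - 2"
      using n by (simp add: adjacent_iff)
    moreover have "i = n - 2 \<or> i = n - 1 \<or> i < n - 2" "n - 2 + 1 = n - 1" "n - 1 + 1 = n" "n - 1 \<noteq> n - 2"
      using n 2 by auto
    ultimately show ?thesis
      using 2 unfolding inner_simple_root[OF n ij(2)] by (auto simp: simple_root_def eps_def)
  next
    case 3
    then have "adjacent n i j \<longleftrightarrow> j = i + 1 \<or> i = j + 1"
      using n ij by (auto simp: adjacent_iff I0_def)
    then show ?thesis
      using 3 ij(3) unfolding inner_simple_root[OF n ij(2)] by (auto simp: simple_root_def eps_def)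
  qed
qed

lemma dynkin_quiver_arrowD:
  assumes "n \<ge> 4" "dynkin_quiver n Q" "(i, j) \<in> Q"
  shows "adjacent n i j" "(j, i) \<notin> Q" "i \<in> I0 n" "j \<in> I0 n"
proof -
  show "adjacent n i j" "(j, i) \<notin> Q"
    using assms(2,3) by (auto simp: dynkin_quiver_def)
  then show "i \<in> I0 n" "j \<in> I0 n"
    using assms(1) by (auto simp: adjacent_def edges_def I0_def)
qed

text \<open>Applying the reflections one after the other subtracts multiples of simple roots from \<open>x\<close>, and the multiple
\<open>c i\<close> is the inner product of \<open>\<alpha>\<^sub>i\<close> with the vector reached so far.  The reflections applied earlier that
matter for \<open>i\<close> are those at the neighbours that come later in the word, and in an adapted word these are the
targets of the arrows out of \<open>i\<close>.  The resulting recursion for \<open>c\<close> mentions the quiver only, so it suffices to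
guess its solution.\<close>

lemma coxeter_eq:
  assumes n: "n \<ge> 4" and Q: "dynkin_quiver n Q" and w: "adapted_word n Q w"
    and c: "\<And>i. i \<in> I0 n \<Longrightarrow> c i = inner n x (simple_root n i) + (\<Sum>j | (i, j) \<in> Q. c j)"
  shows "coxeter n w x = x - (\<Sum>i\<in>I0 n. (\<lambda>k. c i * simple_root n i k))"
proof -
  have dist: "distinct w" and set: "set w = I0 n"
    using w by (auto simp: adapted_word_def)
  have "w = us @ vs \<Longrightarrow>
      foldr (simple_refl n) vs x = x - (\<Sum>i\<in>set vs. (\<lambda>k. c i * simple_root n i k))" for us vs
  proof (induction vs arbitrary: us)
    case (Cons v vs)
    have v: "v \<in> I0 n" "v \<notin> set us" "v \<notin> set vs" and vs: "set vs \<subseteq> I0 n" and us: "distinct us"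
      using Cons.prems dist set by auto
    have src: "is_source v (fold reverse_at us Q)"
    proof -
      have "length us < length w" "w ! length us = v" "take (length us) w = us"
        using Cons.prems by auto
      then show ?thesis
        using w unfolding adapted_word_def by metis
    qed
    have out: "j \<in> set vs \<and> adjacent n v j \<longleftrightarrow> (v, j) \<in> Q" for j
    proof
      assume j: "j \<in> set vs \<and> adjacent n v j"
      then have "j \<notin> set us"
        using Cons.prems dist by auto
      then have "(j, v) \<notin> Q"
        using src v fold_reverse_at[OF us, of j v Q] by (auto simp: is_source_def)
      then show "(v, j) \<in> Q"
        using j Q by (auto simp: dynkin_quiver_def)
    next
      assume vj: "(v, j) \<in> Q"
      then have "j \<notin> set us"
        using src v fold_reverse_at[OF us, of j v Q] by (auto simp: is_source_def)
      moreover have "j \<noteq> v"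
        using dynkin_quiver_arrowD(2)[OF n Q vj] vj by auto
      moreover have "j \<in> set w"
        using dynkin_quiver_arrowD(4)[OF n Q vj] set by simp
      ultimately show "j \<in> set vs \<and> adjacent n v j"
        using Cons.prems dynkin_quiver_arrowD(1)[OF n Q vj] by auto
    qed
    define y where "y = x - (\<Sum>i\<in>set vs. (\<lambda>k. c i * simple_root n i k))"
    have "inner n y (simple_root n v) =
        inner n x (simple_root n v) - (\<Sum>j\<in>set vs. c j * inner n (simple_root n j) (simple_root n v))"
      unfolding inner_simple_root[OF n v(1)]
      by (simp add: y_def sum_vec_apply sum.distrib sum_subtractf algebra_simps)
    also have "(\<Sum>j\<in>set vs. c j * inner n (simple_root n j) (simple_root n v))
        = (\<Sum>j\<in>set vs. if adjacent n v j then - c j else 0)"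
    proof (rule sum.cong)
      fix j assume "j \<in> set vs"
      then have "j \<in> I0 n" "j \<noteq> v"
        using vs v by auto
      then show "c j * inner n (simple_root n j) (simple_root n v) = (if adjacent n v j then - c j else 0)"
        using inner_simple_roots[OF n _ v(1)] by (auto simp: adjacent_def)
    qed simp
    also have "\<dots> = - (\<Sum>j | (v, j) \<in> Q. c j)"
    proof -
      have "{j. (v, j) \<in> Q} = {j \<in> set vs. adjacent n v j}"
        using out by auto
      then show ?thesis
        by (simp add: sum.inter_filter[symmetric] sum_negf)
    qed
    finally have "inner n y (simple_root n v) = c v"
      using c[OF v(1)] by simp
    then have "simple_refl n v y = y - (\<lambda>k. c v * simple_root n v k)"
      by (auto simp: simple_refl_def)
    moreover have "foldr (simple_refl n) vs x = y"
      using Cons.IH[of "us @ [v]"] Cons.prems by (simp add: y_def fun_eq_iff)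
    ultimately have "foldr (simple_refl n) (v # vs) x = y - (\<lambda>k. c v * simple_root n v k)"
      by simp
    also have "\<dots> = x - (\<Sum>i\<in>set (v # vs). (\<lambda>k. c i * simple_root n i k))"
      using v(3) by (auto simp: y_def fun_eq_iff sum_vec_apply)
    finally show ?case .
  qed (simp add: fun_eq_iff)
  from this[of "[]" w] show ?thesis
    by (simp add: coxeter_def set)
qed

lemma simple_refl_diff: "simple_refl n i (x - y) = simple_refl n i x - simple_refl n i y"
  by (simp add: simple_refl_def inner_def fun_eq_iff sum_subtractf algebra_simps)

lemma coxeter_diff: "coxeter n w (x - y) = coxeter n w x - coxeter n w y"
  unfolding coxeter_def by (induction w) (simp_all only: foldr.simps id_apply comp_apply simple_refl_diff)

lemma coxeter_minus: "coxeter n w (- x) = - coxeter n w x"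
  using coxeter_diff[of n w x x] coxeter_diff[of n w "x - x" x] by simp

section \<open>Decompositions of a positive root\<close>

lemma eps_apply: "eps a k = (if k = a then 1 else 0)"
  by (simp add: eps_def)

text \<open>Comparing coordinates leaves only the decompositions in which one basis vector cancels.\<close>

lemma eps_decompose_diff:
  assumes "a < b" "\<alpha> \<in> pos_roots n" "\<beta> \<in> pos_roots n" and eq: "\<alpha> + \<beta> = eps a - eps b"
  obtains c where "a < c" "c < b"
    "\<alpha> = eps a - eps c \<and> \<beta> = eps c - eps b \<or> \<beta> = eps a - eps c \<and> \<alpha> = eps c - eps b"
proof -
  obtain p q where pq: "p < q" "\<alpha> = eps p - eps q \<or> \<alpha> = eps p + eps q"
    using assms(2) by (auto simp: pos_roots_def)
  obtain r s where rs: "r < s" "\<beta> = eps r - eps s \<or> \<beta> = eps r + eps s"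
    using assms(3) by (auto simp: pos_roots_def)
  have e: "\<alpha> k + \<beta> k = eps a k - eps b k" for k
    using fun_cong[OF eq, of k] by simp
  have neq: "p \<noteq> q" "r \<noteq> s" "a \<noteq> b" using pq rs assms by auto
  note inst = e[of p] e[of q] e[of r] e[of s] neq
  have "\<alpha> = eps p - eps q \<and> \<beta> = eps r - eps s \<and> (p = a \<and> q = r \<and> s = b \<or> r = a \<and> s = p \<and> q = b)"
    using pq(2) rs(2)
  proof (elim disjE)
    assume *: "\<alpha> = eps p - eps q" "\<beta> = eps r - eps s"
    show ?thesis
      using inst unfolding * by (simp add: eps_apply split: if_splits; use pq(1) rs(1) in auto)
  next
    assume *: "\<alpha> = eps p - eps q" "\<beta> = eps r + eps s"
    show ?thesis
      using inst unfolding * by (simp add: eps_apply split: if_splits; use pq(1) rs(1) in auto)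
  next
    assume *: "\<alpha> = eps p + eps q" "\<beta> = eps r - eps s"
    show ?thesis
      using inst unfolding * by (simp add: eps_apply split: if_splits; use pq(1) rs(1) in auto)
  next
    assume *: "\<alpha> = eps p + eps q" "\<beta> = eps r + eps s"
    show ?thesis
      using inst unfolding * by (simp add: eps_apply split: if_splits; use pq(1) rs(1) in auto)
  qed
  then show thesis
    using that pq(1) rs(1) by blast
qed
text \<open>Of the two summands the one that contains \<open>eps a\<close> is listed first; the sign of \<open>eps c\<close> in it distinguishes
the two cases, and positivity of both summands bounds \<open>c\<close> from below.\<close>

lemma eps_decompose_sum:
  assumes "a < b" "\<alpha> \<in> pos_roots n" "\<beta> \<in> pos_roots n" and eq: "\<alpha> + \<beta> = eps a + eps b"
  obtains c where "a < c" "c \<noteq> b" "c \<le> n"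
    "\<alpha> = eps a - eps c \<and> \<beta> = eps b + eps c \<or> \<beta> = eps a - eps c \<and> \<alpha> = eps b + eps c"
  | c where "b < c" "c \<le> n"
    "\<alpha> = eps a + eps c \<and> \<beta> = eps b - eps c \<or> \<beta> = eps a + eps c \<and> \<alpha> = eps b - eps c"
proof -
  obtain p q where pq: "p < q" "q \<le> n" "\<alpha> = eps p - eps q \<or> \<alpha> = eps p + eps q"
    using assms(2) by (auto simp: pos_roots_def)
  obtain r s where rs: "r < s" "s \<le> n" "\<beta> = eps r - eps s \<or> \<beta> = eps r + eps s"
    using assms(3) by (auto simp: pos_roots_def)
  have e: "\<alpha> k + \<beta> k = eps a k + eps b k" for k
    using fun_cong[OF eq, of k] by simp
  have neq: "p \<noteq> q" "r \<noteq> s" "a \<noteq> b" using pq rs assms by auto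
  note inst = e[of p] e[of q] e[of r] e[of s] e[of a] e[of b] neq
  have "\<alpha> = eps p - eps q \<and> \<beta> = eps r + eps s \<and> (p = a \<or> p = b) \<and>
          (q = r \<and> {p, s} = {a, b} \<or> q = s \<and> {p, r} = {a, b})
      \<or> \<alpha> = eps p + eps q \<and> \<beta> = eps r - eps s \<and>
          (s = p \<and> {r, q} = {a, b} \<or> s = q \<and> {r, p} = {a, b})"
    using pq(3) rs(3)
  proof (elim disjE)
    assume *: "\<alpha> = eps p - eps q" "\<beta> = eps r - eps s"
    show ?thesis
      using inst unfolding * by (simp add: eps_apply split: if_splits; use pq(1) rs(1) in auto)
  next
    assume *: "\<alpha> = eps p - eps q" "\<beta> = eps r + eps s"
    show ?thesis
      using inst unfolding * by (simp add: eps_apply split: if_splits; use pq(1) rs(1) in auto)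
  next
    assume *: "\<alpha> = eps p + eps q" "\<beta> = eps r - eps s"
    show ?thesis
      using inst unfolding * by (simp add: eps_apply split: if_splits; use pq(1) rs(1) in auto)
  next
    assume *: "\<alpha> = eps p + eps q" "\<beta> = eps r + eps s"
    show ?thesis
      using inst unfolding * by (simp add: eps_apply split: if_splits; use pq(1) rs(1) in auto)
  qed
  then show thesis
    using that(1)[of q] that(2)[of q] that(1)[of s] that(2)[of s] pq(1,2) rs(1,2) assms(1)
    by (auto simp: doubleton_eq_iff add.commute)
qed

section \<open>The height function and the places of the basis vectors\<close>

locale D_quiver =
  fixes n :: nat and Q :: "nat rel" and \<xi> :: "nat \<Rightarrow> int" and w :: "nat list"
  assumes n4: "n \<ge> 4" and Q: "dynkin_quiver n Q" and \<xi>: "height_function Q \<xi>"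
    and w: "adapted_word n Q w"
begin

lemma arrow_iff: "(i, j) \<in> Q \<longleftrightarrow> adjacent n i j \<and> \<xi> j < \<xi> i"
proof
  assume "(i, j) \<in> Q"
  then show "adjacent n i j \<and> \<xi> j < \<xi> i"
    using dynkin_quiver_arrowD(1)[OF n4 Q] \<xi> by (auto simp: height_function_def)
next
  assume ij: "adjacent n i j \<and> \<xi> j < \<xi> i"
  then have "(i, j) \<in> Q \<or> (j, i) \<in> Q"
    using Q by (auto simp: dynkin_quiver_def)
  then show "(i, j) \<in> Q"
    using ij \<xi> by (auto simp: height_function_def)
qed

lemma adjacent_height: "\<xi> j = \<xi> i - 1 \<or> \<xi> j = \<xi> i + 1" if "adjacent n i j"
proof -
  have "(i, j) \<in> Q \<or> (j, i) \<in> Q"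
    using that Q by (auto simp: dynkin_quiver_def)
  then show ?thesis
    using \<xi> by (auto simp: height_function_def)
qed

text \<open>The Coxeter number, and half the period of the sequence \<open>X\<close> below.\<close>

definition h :: int where "h = 2 * (int n - 1)"

text \<open>For \<open>i \<le> n - 2\<close> the root \<open>\<eta>\<^sub>i\<close> will turn out to be \<open>X (hi i) - X (lo i)\<close>.\<close>

definition hi :: "nat \<Rightarrow> int" where "hi i = \<xi> i + int i"

definition lo :: "nat \<Rightarrow> int" where "lo i = \<xi> i - int i"

lemma hi_lo: "hi i - lo i = 2 * int i"
  by (simp add: hi_def lo_def)

text \<open>Between neighbours on the line \<open>1, \<dots>, n - 1\<close> the window from \<open>lo i\<close> to \<open>hi i\<close> grows by one step of length 2,
to the right or to the left according to the direction of the arrow.\<close>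

lemma line_step:
  assumes "1 \<le> i" "i + 1 < n"
  shows "\<xi> i < \<xi> (i + 1) \<and> \<xi> (i + 1) = \<xi> i + 1 \<and> hi (i + 1) = hi i + 2 \<and> lo (i + 1) = lo i \<or>
    \<xi> (i + 1) < \<xi> i \<and> \<xi> (i + 1) = \<xi> i - 1 \<and> hi (i + 1) = hi i \<and> lo (i + 1) = lo i - 2"
proof -
  have "adjacent n i (i + 1)"
    using assms n4 by (simp add: adjacent_iff)
  from adjacent_height[OF this] show ?thesis
    by (auto simp: hi_def lo_def)
qed

lemma end_step: "\<xi> n = \<xi> (n - 2) - 1 \<or> \<xi> n = \<xi> (n - 2) + 1"
    "\<xi> (n - 1) = \<xi> (n - 2) - 1 \<or> \<xi> (n - 1) = \<xi> (n - 2) + 1"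
proof -
  have "adjacent n (n - 2) n" "adjacent n (n - 2) (n - 1)"
    using n4 by (auto simp: adjacent_iff)
  then show "\<xi> n = \<xi> (n - 2) - 1 \<or> \<xi> n = \<xi> (n - 2) + 1"
    "\<xi> (n - 1) = \<xi> (n - 2) - 1 \<or> \<xi> (n - 1) = \<xi> (n - 2) + 1"
    using adjacent_height by blast+
qed

lemma window_mono: "hi i \<le> hi j \<and> lo j \<le> lo i \<and> even (hi j - hi i)" if "1 \<le> i" "i \<le> j" "j < n"
  using that(2,3)
proof (induction j rule: dec_induct)
  case (step j)
  then show ?case
    using line_step[of j] that(1) by auto
qed auto

text \<open>The index of the basis vector that the Coxeter element negates.  It depends on whether the two end vertices
\<open>n - 1\<close> and \<open>n\<close> point in the same direction.\<close>

definition z :: nat where "z = (if \<xi> (n - 1) = \<xi> n then n else n - 1)"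

text \<open>The indices of the basis vectors that form the signed cycle.\<close>

definition J :: "nat set" where "J = {1..n} - {z}"

text \<open>The position of the vector with index \<open>k\<close> in the sequence \<open>X\<close>.  The half-open window of the positions \<open>q\<close> with
\<open>lo k < q \<le> hi k\<close> has one position more than that of \<open>k - 1\<close>, and this new position is given to \<open>k\<close>.  The last index in \<open>J\<close> is placed by the
direction of the branch; if the two end vertices point in different directions it is always put on the left, and
the sign \<open>s\<close> below is chosen accordingly.\<close>

definition place :: "nat \<Rightarrow> int" where
  "place k = (if k \<le> n - 2 then if k = 1 \<or> \<xi> (k - 1) < \<xi> k then hi k else lo (k - 1)
          else if z = n \<and> \<xi> (n - 2) < \<xi> (n - 1) then hi (n - 2) + 2 else lo (n - 2))"

text \<open>The smallest place.\<close>

definition base :: int where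
  "base = (if z = n \<and> \<xi> (n - 2) < \<xi> (n - 1) then lo (n - 2) + 2 else lo (n - 2))"

text \<open>The windows are nested, and the place of \<open>c\<close> enters with the window of \<open>c\<close>.\<close>

lemma place_le_iff:
  assumes c: "c \<in> J" and i: "1 \<le> i" "i \<le> n - 2"
  shows "c \<le> i \<longleftrightarrow> lo i < place c \<and> place c \<le> hi i"
proof (cases "c \<le> n - 2")
  case True
  have "c \<ge> 1" using c by (simp add: J_def)
  have "i < n" using i n4 by simp
  show ?thesis
  proof (cases "c = 1 \<or> \<xi> (c - 1) < \<xi> c")
    case right: True
    then have place: "place c = hi c"
      using True by (simp add: place_def)
    show ?thesis
    proof (cases "c \<le> i")
      case True
      then show ?thesis
        using window_mono[of c i] hi_lo[of c] \<open>i < n\<close> \<open>c \<ge> 1\<close> place by auto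
    next
      case False
      then have "hi c = hi (c - 1) + 2" "hi i \<le> hi (c - 1)"
        using line_step[of "c - 1"] window_mono[of i "c - 1"] right True i by auto
      then show ?thesis
        using False place by simp
    qed
  next
    case left: False
    then have place: "place c = lo (c - 1)" and c2: "c \<ge> 2"
      using True \<open>c \<ge> 1\<close> by (auto simp: place_def)
    have lo: "lo (c - 1) = lo c + 2" "hi c = hi (c - 1)"
      using line_step[of "c - 1"] left True c2 by auto
    show ?thesis
    proof (cases "c \<le> i")
      case True
      then show ?thesis
        using window_mono[of c i] hi_lo[of "c - 1"] \<open>i < n\<close> c2 place lo by auto
    next
      case False
      then have "lo (c - 1) \<le> lo i"
        using window_mono[of i "c - 1"] True i by auto
      then show ?thesis
        using False place by simp
    qed
  qed
next
  case False
  then have "place c > hi (n - 2) \<or> place c \<le> lo (n - 2)"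
    by (simp add: place_def)
  moreover have "hi i \<le> hi (n - 2)" "lo (n - 2) \<le> lo i"
    using window_mono[of i "n - 2"] i n4 by auto
  ultimately show ?thesis
    using False i by auto
qed

lemma z_cases: "z = n \<or> z = n - 1"
  by (simp add: z_def)

lemma hi_end: "hi (n - 2) = lo (n - 2) + h - 2"
  using hi_lo[of "n - 2"] n4 by (simp add: h_def of_nat_diff)

lemma base_bounds:
  assumes "1 \<le> i" "i \<le> n - 2"
  shows "base - 2 \<le> lo i" "hi i \<le> base + h - 2"
  using window_mono[of i "n - 2"] assms n4 hi_end by (auto simp: base_def)

lemma place_parity: "even (place c - lo (n - 2))" if "c \<in> J"
proof (cases "c \<le> n - 2")
  case True
  have e: "even (hi c - lo c)" "even (hi (c - 1) - lo (c - 1))" "even (hi (n - 2) - lo (n - 2))"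
    by (simp_all add: hi_lo)
  have "even (hi (n - 2) - hi c)"
    using window_mono[of c "n - 2"] True that n4 by (auto simp: J_def)
  moreover have "c \<noteq> 1 \<Longrightarrow> even (hi (n - 2) - hi (c - 1))"
    using window_mono[of "c - 1" "n - 2"] True that n4 by (auto simp: J_def)
  ultimately show ?thesis
    using e True by (auto simp: place_def)
next
  case False
  then show ?thesis
    using hi_end by (auto simp: place_def h_def)
qed

lemma place_inj: "c = d" if "c \<in> J" "d \<in> J" "place c = place d"
proof (rule ccontr)
  have *: False if "c \<in> J" "d \<in> J" "place c = place d" "c < d" for c d
  proof (cases "c \<le> n - 2")
    case True
    then show False
      using place_le_iff[of c c] place_le_iff[of d c] that by (auto simp: J_def)
  next
    case False
    then show False
      using that z_cases by (auto simp: J_def)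
  qed
  assume "c \<noteq> d"
  then show False
    using *[of c d] *[of d c] that by (cases c d rule: linorder_cases) auto
qed

lemma place_bounds: "base \<le> place c" "place c \<le> base + h - 2" if "c \<in> J"
proof -
  have "base \<le> place c \<and> place c \<le> base + h - 2"
  proof (cases "c \<le> n - 2")
    case True
    have "lo (n - 2) < place c" "place c \<le> hi (n - 2)"
      using place_le_iff[OF that, of "n - 2"] True n4 by auto
    moreover have "lo (n - 2) + 2 \<le> place c"
      using place_parity[OF that] \<open>lo (n - 2) < place c\<close> by presburger
    ultimately show ?thesis
      using hi_end by (auto simp: base_def)
  next
    case False
    then show ?thesis
      using hi_end n4 by (auto simp: base_def place_def h_def)
  qed
  then show "base \<le> place c" "place c \<le> base + h - 2" by auto
qed

text \<open>There are \<open>n - 1\<close> positions of the right parity in the range and \<open>n - 1\<close> distinct places among them.\<close>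

lemma place_surj:
  assumes "base \<le> q" "q \<le> base + h - 2" "even (q - lo (n - 2))"
  obtains c where "c \<in> J" "place c = q"
proof -
  define W where "W = (\<lambda>t. base + 2 * int t) ` {..<n - 1}"
  have card: "card W = n - 1"
    unfolding W_def by (subst card_image) (auto simp: inj_on_def)
  have W: "q \<in> W" if q: "base \<le> q" "q \<le> base + h - 2" "even (q - lo (n - 2))" for q
  proof -
    have "even (q - base)"
      using q(3) by (auto simp: base_def)
    then obtain u where "q - base = 2 * u" by (rule evenE)
    then show ?thesis
      unfolding W_def using q by (intro image_eqI[of _ _ "nat u"]) (auto simp: h_def)
  qed
  have "place ` J \<subseteq> W"
    using W place_bounds place_parity by blast
  moreover have "card (place ` J) = n - 1"
  proof -
    have "inj_on place J"
      by (rule inj_onI) (rule place_inj)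
    moreover have "z \<in> {1..n}"
      using z_cases n4 by auto
    ultimately show ?thesis
      by (simp add: card_image J_def)
  qed
  ultimately have "place ` J = W"
    using card by (intro card_subset_eq) (auto simp: W_def)
  then show thesis
    using W[OF assms] that by blast
qed

text \<open>The windows are intervals, and the two outer places lie in a window that does not contain the middle one unless
the middle index is smaller than one of the outer indices.\<close>

lemma place_valley: "d < c \<or> d < e" if "c \<in> J" "d \<in> J" "e \<in> J" "place c < place d" "place d < place e"
proof (rule ccontr)
  assume "\<not> (d < c \<or> d < e)"
  then have ce: "c < d" "e < d"
    using that by (auto simp: nat_less_le)
  define i where "i = min (d - 1) (n - 2)"
  have i: "1 \<le> i" "i \<le> n - 2" "i < d"
    using ce that n4 by (auto simp: i_def J_def)
  have "c \<le> i" "e \<le> i"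
    using ce that z_cases by (auto simp: i_def J_def)
  then show False
    using place_le_iff[OF that(1) i(1,2)] place_le_iff[OF that(2) i(1,2)] place_le_iff[OF that(3) i(1,2)] that i(3) by auto
qed

section \<open>The Coxeter element as a signed cycle\<close>

text \<open>The antiperiodic sequence with value 1 at 0 that vanishes between the multiples of \<open>h\<close>.  With it the entries
of \<open>X\<close> have a closed form, so that identities for \<open>X\<close> need no distinction of where the index lies.\<close>

definition \<chi> :: "int \<Rightarrow> int" where
  "\<chi> x = (if 2 * h dvd x then 1 else if 2 * h dvd x + h then - 1 else 0)"

lemma h_pos: "h \<ge> 6"
  using n4 by (simp add: h_def)

lemma \<chi>_shift: "\<chi> (x + h) = - \<chi> x"
proof -
  have "x + h + h = x + 2 * h" by simp
  then have "2 * h dvd x + h + h \<longleftrightarrow> 2 * h dvd x"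
    by (metis dvd_add_left_iff dvd_refl)
  moreover have "\<not> (2 * h dvd x \<and> 2 * h dvd x + h)"
  proof
    assume "2 * h dvd x \<and> 2 * h dvd x + h"
    then have "2 * h dvd h"
      using dvd_add_right_iff by blast
    then show False
      using h_pos zdvd_imp_le[of "2 * h" h] by auto
  qed
  ultimately show ?thesis
    by (auto simp: \<chi>_def)
qed

lemma \<chi>_small: "\<chi> x = (if x = 0 then 1 else 0)" if "- h < x" "x < h"
proof -
  have "\<not> 2 * h dvd x + h"
    using zdvd_not_zless[of "x + h" "2 * h"] that by auto
  moreover have "2 * h dvd x \<longleftrightarrow> x = 0"
  proof
    assume *: "2 * h dvd x"
    show "x = 0"
    proof (rule ccontr)
      assume "x \<noteq> 0"
      then have "\<bar>2 * h\<bar> \<le> \<bar>x\<bar>"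
        using * dvd_imp_le_int by blast
      then show False using that by auto
    qed
  qed auto
  ultimately show ?thesis by (simp add: \<chi>_def)
qed

text \<open>The sign that allows the last place to lie on the left in all mixed orientations: reflecting \<open>eps n\<close> exchanges
the end vertices \<open>n - 1\<close> and \<open>n\<close>.\<close>

definition s :: "nat \<Rightarrow> int" where "s k = (if k = n \<and> \<xi> (n - 1) < \<xi> n then - 1 else 1)"

definition y :: "nat \<Rightarrow> vec" where "y a = (\<lambda>k. s a * eps a k)"

definition X :: "int \<Rightarrow> vec" where "X q = (\<lambda>k. if k \<in> J then s k * \<chi> (q - place k) else 0)"

lemma X_shift: "X (q + h) = - X q"
proof
  fix k
  show "X (q + h) k = (- X q) k"
    using \<chi>_shift[of "q - place k"] by (simp add: X_def algebra_simps)
qed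

lemma X_shift': "X (q - h) = - X q"
  using X_shift[of "q - h"] by simp

lemma X_P: "X (place c) = y c" if "c \<in> J"
proof
  fix k
  show "X (place c) k = y c k"
  proof (cases "k \<in> J")
    case True
    then have "\<chi> (place c - place k) = (if c = k then 1 else 0)"
      using place_bounds[OF that] place_bounds[OF True] place_inj[OF that True] by (subst \<chi>_small) auto
    then show ?thesis
      using True by (simp add: X_def y_def eps_def)
  qed (use that in \<open>auto simp: X_def y_def eps_def\<close>)
qed

abbreviation \<tau> :: "vec \<Rightarrow> vec" where "\<tau> \<equiv> coxeter n w"

text \<open>The recursion of \<open>coxeter_eq\<close> spelt out vertex by vertex, together with the coordinates of
\<open>x - u\<close> in terms of the coefficients.\<close>

lemma \<tau>_eqI:
  assumes "c 0 = 0" "\<And>k. k > n \<Longrightarrow> x k = u k" "x 0 = u 0"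
    and "\<And>k. Suc k \<le> n - 2 \<Longrightarrow> x (Suc k) - u (Suc k) = c (Suc k) - c k"
    and "x (n - 1) - u (n - 1) = c (n - 1) - c (n - 2) + c n" "x n - u n = c n - c (n - 1)"
    and line: "\<And>i. 1 \<le> i \<Longrightarrow> i < n - 2 \<Longrightarrow> c i = x i - x (i + 1) +
      (if \<xi> (i + 1) < \<xi> i then c (i + 1) else 0) + (if i > 1 \<and> \<xi> (i - 1) < \<xi> i then c (i - 1) else 0)"
    and branch: "c (n - 2) = x (n - 2) - x (n - 1) + (if \<xi> (n - 1) < \<xi> (n - 2) then c (n - 1) else 0)
      + (if \<xi> n < \<xi> (n - 2) then c n else 0) + (if \<xi> (n - 3) < \<xi> (n - 2) then c (n - 3) else 0)"
    and ends: "c (n - 1) = x (n - 1) - x n + (if \<xi> (n - 2) < \<xi> (n - 1) then c (n - 2) else 0)"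
      "c n = x (n - 1) + x n + (if \<xi> (n - 2) < \<xi> n then c (n - 2) else 0)"
  shows "\<tau> x = u"
proof -
  have fin: "finite {j. (i, j) \<in> Q}" for i
    by (rule finite_subset[of _ "I0 n"]) (use dynkin_quiver_arrowD[OF n4 Q] in \<open>auto simp: I0_def\<close>)
  have "c i = inner n x (simple_root n i) + (\<Sum>j | (i, j) \<in> Q. c j)" if i: "i \<in> I0 n" for i
  proof -
    consider "1 \<le> i" "i < n - 2" | "i = n - 2" | "i = n - 1" | "i = n"
      using i by (force simp: I0_def)
    then show ?thesis
    proof cases
      case 1
      have "(i, j) \<in> Q \<longleftrightarrow> j = i + 1 \<and> \<xi> (i + 1) < \<xi> i \<or> j = i - 1 \<and> i > 1 \<and> \<xi> (i - 1) < \<xi> i" for j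
      proof -
        have "i + 1 < n" "i < n" "i \<noteq> n" "i \<noteq> n - 2" "1 \<le> j \<and> i = j + 1 \<longleftrightarrow> j = i - 1 \<and> i > 1"
          using 1 n4 by auto
        then show ?thesis
          using 1 unfolding arrow_iff adjacent_iff[OF n4] by metis
      qed
      then have "{j. (i, j) \<in> Q} = (if \<xi> (i + 1) < \<xi> i then {i + 1} else {}) \<union>
          (if i > 1 \<and> \<xi> (i - 1) < \<xi> i then {i - 1} else {})"
        by auto
      then have "(\<Sum>j | (i, j) \<in> Q. c j) = (if \<xi> (i + 1) < \<xi> i then c (i + 1) else 0) +
          (if i > 1 \<and> \<xi> (i - 1) < \<xi> i then c (i - 1) else 0)"
        by simp
      then show ?thesis
      proof -
        have "i \<noteq> n" using 1 by simp
        then show ?thesis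
          using line[OF 1] 1 \<open>(\<Sum>j | (i, j) \<in> Q. c j) = _\<close> by (simp add: inner_simple_root[OF n4 i])
      qed
    next
      case 2
      have "n - 2 + 1 = n - 1" "n - 1 \<noteq> n - 3" "n \<noteq> n - 3" "n - 1 \<noteq> n" "n - 2 \<noteq> n" using n4 by auto
      have "(i, j) \<in> Q \<longleftrightarrow> j = n - 1 \<and> \<xi> (n - 1) < \<xi> (n - 2) \<or> j = n \<and> \<xi> n < \<xi> (n - 2)
          \<or> j = n - 3 \<and> \<xi> (n - 3) < \<xi> (n - 2)" for j
      proof -
        have "1 \<le> j \<and> n - 2 = j + 1 \<longleftrightarrow> j = n - 3" "n - 2 + 1 = n - 1" "n - 1 < n" "1 \<le> n - 2" "n - 2 < n" "n - 2 \<noteq> n"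
          using n4 by auto
        then show ?thesis
          unfolding arrow_iff adjacent_iff[OF n4] 2 by metis
      qed
      then have "{j. (i, j) \<in> Q} = (if \<xi> (n - 1) < \<xi> (n - 2) then {n - 1} else {}) \<union>
          (if \<xi> n < \<xi> (n - 2) then {n} else {}) \<union> (if \<xi> (n - 3) < \<xi> (n - 2) then {n - 3} else {})"
        by auto
      then have "(\<Sum>j | (i, j) \<in> Q. c j) = (if \<xi> (n - 1) < \<xi> (n - 2) then c (n - 1) else 0)
          + (if \<xi> n < \<xi> (n - 2) then c n else 0) + (if \<xi> (n - 3) < \<xi> (n - 2) then c (n - 3) else 0)"
        using \<open>n - 1 \<noteq> n - 3\<close> \<open>n \<noteq> n - 3\<close> \<open>n - 1 \<noteq> n\<close> by simp
      then show ?thesis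
        using branch 2 inner_simple_root[OF n4 i] \<open>n - 2 + 1 = n - 1\<close> \<open>n - 2 \<noteq> n\<close> by simp
    next
      case 3
      have "n - 1 \<noteq> n" "n - 1 + 1 = n" using n4 by auto
      have "(i, j) \<in> Q \<longleftrightarrow> j = n - 2 \<and> \<xi> (n - 2) < \<xi> (n - 1)" for j
      proof -
        have "1 \<le> j \<and> n - 1 = j + 1 \<longleftrightarrow> j = n - 2" "n - 1 + 1 = n" "n - 1 < n" "n - 1 \<noteq> n - 2" "n - 1 \<noteq> n" "n - 2 \<noteq> n"
          using n4 by auto
        then show ?thesis
          unfolding arrow_iff adjacent_iff[OF n4] 3 by (metis less_irrefl add_lessD1 less_add_one)
      qed
      then have "{j. (i, j) \<in> Q} = (if \<xi> (n - 2) < \<xi> (n - 1) then {n - 2} else {})"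
        by auto
      then show ?thesis
        using ends(1) 3 inner_simple_root[OF n4 i] \<open>n - 1 \<noteq> n\<close> \<open>n - 1 + 1 = n\<close> by simp
    next
      case 4
      have "(i, j) \<in> Q \<longleftrightarrow> j = n - 2 \<and> \<xi> (n - 2) < \<xi> n" for j
      proof -
        have "1 \<le> j \<and> n = j + 1 \<longleftrightarrow> j = n - 1" "n - 1 + 1 = n" "n - 1 < n" "n - 1 \<noteq> n - 2" "n - 1 \<noteq> n" "n - 2 \<noteq> n"
          using n4 by auto
        then show ?thesis
          unfolding arrow_iff adjacent_iff[OF n4] 4 by (metis less_irrefl add_lessD1 less_add_one)
      qed
      then have "{j. (i, j) \<in> Q} = (if \<xi> (n - 2) < \<xi> n then {n - 2} else {})"
        by auto
      then show ?thesis
        using ends(2) 4 inner_simple_root[OF n4 i] by simp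
    qed
  qed
  from coxeter_eq[OF n4 Q w this]
  have "\<tau> x = x - (\<Sum>i\<in>I0 n. (\<lambda>k. c i * simple_root n i k))"
    by blast
  also have "(\<Sum>i\<in>I0 n. (\<lambda>k. c i * simple_root n i k)) = x - u"
    by (rule simple_root_combinationI[OF n4, symmetric]) (simp_all only: minus_apply assms(1-6) diff_self)
  finally show ?thesis by simp
qed

lemma end_signs: "\<xi> (n - 2) < \<xi> (n - 1) \<longleftrightarrow> \<not> \<xi> (n - 1) < \<xi> (n - 2)" "\<xi> (n - 2) < \<xi> n \<longleftrightarrow> \<not> \<xi> n < \<xi> (n - 2)"
    "\<xi> (n - 1) = \<xi> n \<longleftrightarrow> (\<xi> (n - 1) < \<xi> (n - 2) \<longleftrightarrow> \<xi> n < \<xi> (n - 2))"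
  using end_step by linarith+

lemma X_low: "X q k = \<chi> (q - place k)" if "1 \<le> k" "k \<le> n - 2"
  using that z_cases n4 by (auto simp: X_def J_def s_def)

lemma X_zero: "X q k = 0" if "k = 0 \<or> k > n"
  using that by (auto simp: X_def J_def)

text \<open>Here the two shapes of the branch look alike: a last place on the right at \<open>hi (n - 2) + 2 = lo (n - 2) + h\<close> is
the same as one at \<open>lo (n - 2)\<close> with the opposite sign.\<close>

lemma X_ends:
  "X q (n - 1) = (if \<xi> (n - 1) = \<xi> n then if \<xi> (n - 2) < \<xi> n then - \<chi> (q - lo (n - 2)) else \<chi> (q - lo (n - 2)) else 0)"
  "X q n = (if \<xi> (n - 1) = \<xi> n then 0 else if \<xi> (n - 2) < \<xi> n then - \<chi> (q - lo (n - 2)) else \<chi> (q - lo (n - 2)))"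
proof -
  have J: "n - 1 \<in> J \<longleftrightarrow> \<xi> (n - 1) = \<xi> n" "n \<in> J \<longleftrightarrow> \<xi> (n - 1) \<noteq> \<xi> n"
    using n4 by (auto simp: J_def z_def)
  have ne: "\<not> n - 1 \<le> n - 2" "\<not> n \<le> n - 2" "n - 1 \<noteq> n" using n4 by auto
  have "q - (hi (n - 2) + 2) = q - lo (n - 2) - h"
    using hi_end by simp
  then have \<chi>: "\<chi> (q - (hi (n - 2) + 2)) = - \<chi> (q - lo (n - 2))"
    using \<chi>_shift[of "q - lo (n - 2) - h"] by (metis diff_add_cancel minus_minus)
  show "X q (n - 1) = (if \<xi> (n - 1) = \<xi> n then if \<xi> (n - 2) < \<xi> n then - \<chi> (q - lo (n - 2)) else \<chi> (q - lo (n - 2)) else 0)"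
    using J(1) ne \<chi> by (auto simp: X_def s_def place_def z_def)
  show "X q n = (if \<xi> (n - 1) = \<xi> n then 0 else if \<xi> (n - 2) < \<xi> n then - \<chi> (q - lo (n - 2)) else \<chi> (q - lo (n - 2)))"
    using J(2) ne end_step by (auto simp: X_def s_def place_def z_def)
qed

text \<open>The coefficients of \<open>X q - X (q - 2)\<close> at the simple roots are differences of \<open>\<chi>\<close> at the two ends of the windows:
passing from \<open>k\<close> to \<open>k + 1\<close> moves one end of the window past the place of \<open>k + 1\<close>, so the coefficient changes by the
coordinate of \<open>X q - X (q - 2)\<close> at \<open>k + 1\<close>.\<close>

lemma \<tau>_X: "\<tau> (X q) = X (q - 2)"
proof -
  define p where "p = q - 2"
  define B where "B = lo (n - 2)"
  \<comment> \<open>At an end vertex the coefficient of the whole branch is split according to the direction of its arrow.\<close>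
  define c where "c i = (if i = n \<or> i = n - 1 then if \<xi> i < \<xi> (n - 2) then \<chi> (q - B) else \<chi> (p - B)
      else \<chi> (p - lo i) - \<chi> (p - hi i))" for i
  have c_end: "c n = (if \<xi> n < \<xi> (n - 2) then \<chi> (q - B) else \<chi> (p - B))"
    "c (n - 1) = (if \<xi> (n - 1) < \<xi> (n - 2) then \<chi> (q - B) else \<chi> (p - B))"
    by (simp_all add: c_def)
  have c_low: "c i = \<chi> (p - lo i) - \<chi> (p - hi i)" if "i \<le> n - 2" for i
    using that n4 by (auto simp: c_def)
  have "p - hi (n - 2) = q - B - h"
    using hi_end by (simp add: p_def B_def)
  then have \<chi>_hi: "\<chi> (p - hi (n - 2)) = - \<chi> (q - B)"
    using \<chi>_shift[of "q - B - h"] by simp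
  have c_branch: "c (n - 2) = \<chi> (p - B) + \<chi> (q - B)"
    using \<chi>_hi by (simp add: c_low B_def)
  have c_diff: "X q (Suc k) - X p (Suc k) = c (Suc k) - c k" if k: "Suc k \<le> n - 2" for k
  proof (cases "k = 0")
    case True
    have "q - hi (Suc 0) = p - lo (Suc 0)"
      using hi_lo[of "Suc 0"] by (simp add: p_def)
    moreover have "place (Suc 0) = hi (Suc 0)" "c 0 = 0"
      using k n4 by (auto simp: place_def True c_low hi_def lo_def)
    ultimately show ?thesis
      using k by (simp add: True X_low c_low)
  next
    case False
    then have "1 \<le> k" "k + 1 < n" using k by auto
    from line_step[OF this] show ?thesis
    proof
      assume "\<xi> k < \<xi> (k + 1) \<and> \<xi> (k + 1) = \<xi> k + 1 \<and> hi (k + 1) = hi k + 2 \<and> lo (k + 1) = lo k"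
      moreover from this have "place (Suc k) = hi (k + 1)"
        using k by (simp add: place_def)
      ultimately show ?thesis
        using k by (simp add: X_low c_low p_def algebra_simps)
    next
      assume "\<xi> (k + 1) < \<xi> k \<and> \<xi> (k + 1) = \<xi> k - 1 \<and> hi (k + 1) = hi k \<and> lo (k + 1) = lo k - 2"
      moreover from this have "place (Suc k) = lo k"
        using k False by (simp add: place_def)
      ultimately show ?thesis
        using k by (simp add: X_low c_low p_def algebra_simps)
    qed
  qed
  have left: "X q i + (if i > 1 \<and> \<xi> (i - 1) < \<xi> i then c (i - 1) else 0) = \<chi> (p - lo i)"
    if i: "1 \<le> i" "i \<le> n - 2" for i
  proof (cases "i = 1")
    case True
    then have "q - place i = p - lo i"
      using hi_lo[of i] i by (simp add: place_def p_def)
    then show ?thesis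
      using i True by (simp add: X_low)
  next
    case False
    then have "1 \<le> i - 1" "i - 1 + 1 < n" "i - 1 + 1 = i" using i by auto
    from line_step[OF this(1,2)] show ?thesis
      unfolding \<open>i - 1 + 1 = i\<close>
    proof
      assume "\<xi> (i - 1) < \<xi> i \<and> \<xi> i = \<xi> (i - 1) + 1 \<and> hi i = hi (i - 1) + 2 \<and> lo i = lo (i - 1)"
      moreover from this have "place i = hi i"
        using i by (simp add: place_def)
      ultimately show ?thesis
        using i False by (simp add: X_low c_low p_def algebra_simps)
    next
      assume "\<xi> i < \<xi> (i - 1) \<and> \<xi> i = \<xi> (i - 1) - 1 \<and> hi i = hi (i - 1) \<and> lo i = lo (i - 1) - 2"
      moreover from this have "place i = lo (i - 1)"
        using i False by (simp add: place_def)
      ultimately show ?thesis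
        using i by (simp add: X_low p_def algebra_simps)
    qed
  qed
  have right: "- X q (i + 1) + (if \<xi> (i + 1) < \<xi> i then c (i + 1) else 0) = - \<chi> (p - hi i)"
    if i: "1 \<le> i" "i < n - 2" for i
  proof -
    have "1 \<le> i" "i + 1 < n" "i + 1 \<le> n - 2" using i by auto
    from line_step[OF this(1,2)] show ?thesis
    proof
      assume *: "\<xi> i < \<xi> (i + 1) \<and> \<xi> (i + 1) = \<xi> i + 1 \<and> hi (i + 1) = hi i + 2 \<and> lo (i + 1) = lo i"
      moreover from this have "place (i + 1) = hi (i + 1)"
        using i by (simp add: place_def)
      ultimately have "q - place (i + 1) = p - hi i" by (simp add: p_def)
      then show ?thesis
        using i * X_low[of "i + 1" q] by simp
    next
      assume *: "\<xi> (i + 1) < \<xi> i \<and> \<xi> (i + 1) = \<xi> i - 1 \<and> hi (i + 1) = hi i \<and> lo (i + 1) = lo i - 2"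
      moreover from this have "place (i + 1) = lo i"
        using i by (simp add: place_def)
      moreover have "\<chi> (p - (lo i - 2)) = \<chi> (q - lo i)"
        by (rule arg_cong[of _ _ \<chi>]) (simp add: p_def)
      ultimately show ?thesis
        using i X_low[of "i + 1" q] c_low[of "i + 1"] by simp
    qed
  qed
  have c0: "c 0 = 0"
    using c_low[of 0] by (simp add: hi_def lo_def)
  have "\<tau> (X q) = X p"
  proof (rule \<tau>_eqI[of c])
    fix i assume i: "1 \<le> i" "i < n - 2"
    show "c i = X q i - X q (i + 1) +
      (if \<xi> (i + 1) < \<xi> i then c (i + 1) else 0) + (if i > 1 \<and> \<xi> (i - 1) < \<xi> i then c (i - 1) else 0)"
      using left[of i] right[OF i] i c_low[of i] by linarith
  next
    show "c (n - 2) = X q (n - 2) - X q (n - 1) + (if \<xi> (n - 1) < \<xi> (n - 2) then c (n - 1) else 0)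
      + (if \<xi> n < \<xi> (n - 2) then c n else 0) + (if \<xi> (n - 3) < \<xi> (n - 2) then c (n - 3) else 0)"
    proof -
      have "X q (n - 2) + (if \<xi> (n - 3) < \<xi> (n - 2) then c (n - 3) else 0) = \<chi> (p - B)"
      proof -
        have "1 \<le> n - 2" "1 < n - 2" "n - 2 - 1 = n - 3" using n4 by auto
        then show ?thesis
          using left[of "n - 2"] unfolding \<open>n - 2 - 1 = n - 3\<close> B_def by simp
      qed
      moreover have "- X q (n - 1) + (if \<xi> (n - 1) < \<xi> (n - 2) then c (n - 1) else 0)
          + (if \<xi> n < \<xi> (n - 2) then c n else 0) = \<chi> (q - B)"
        unfolding X_ends c_end B_def[symmetric] end_signs by simp
      ultimately show ?thesis
        using c_branch by linarith
    qed
  next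
    show "X q (n - 1) - X p (n - 1) = c (n - 1) - c (n - 2) + c n"
      unfolding X_ends c_end c_branch B_def[symmetric] end_signs by simp
    show "X q n - X p n = c n - c (n - 1)"
      unfolding X_ends c_end c_branch B_def[symmetric] end_signs by simp
    show "c (n - 1) = X q (n - 1) - X q n + (if \<xi> (n - 2) < \<xi> (n - 1) then c (n - 2) else 0)"
      unfolding X_ends c_end c_branch B_def[symmetric] end_signs by simp
    show "c n = X q (n - 1) + X q n + (if \<xi> (n - 2) < \<xi> n then c (n - 2) else 0)"
      unfolding X_ends c_end c_branch B_def[symmetric] end_signs by simp
  qed (use c_diff c0 in \<open>auto simp: X_zero\<close>)
  then show ?thesis by (simp add: p_def)
qed

text \<open>Here \<open>2 eps z\<close> is the difference or the sum of the two simple roots at the end vertices.\<close>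

lemma \<tau>_eps_z: "\<tau> (eps z) = - eps z"
proof -
  have ne: "n - 1 \<noteq> n" "n - 2 \<noteq> n" "n - 2 \<noteq> n - 1" "n - 3 \<noteq> n" "n - 3 \<noteq> n - 1" "n \<noteq> 0" "n - 1 \<noteq> 0"
    using n4 by auto
  define c where "c i = (if i = n then 1 else if i = n - 1 then if z = n then - 1 else 1 else 0 :: int)" for i
  have c: "c n = 1" "c (n - 1) = (if z = n then - 1 else 1)" "\<And>i. i \<noteq> n \<Longrightarrow> i \<noteq> n - 1 \<Longrightarrow> c i = 0"
    using ne by (simp_all add: c_def)
  have e: "eps z n = (if z = n then 1 else 0)" "eps z (n - 1) = (if z = n then 0 else 1)"
    "\<And>i. i \<noteq> n \<Longrightarrow> i \<noteq> n - 1 \<Longrightarrow> eps z i = 0"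
    using z_cases ne by (elim disjE; simp add: eps_apply)+
  have low: "c i = 0" "eps z i = 0" if "i \<le> n - 2" for i
  proof -
    have "i \<noteq> n" "i \<noteq> n - 1" using that n4 by auto
    then show "c i = 0" "eps z i = 0" by (rule c(3), rule e(3))
  qed
  show ?thesis
  proof (rule \<tau>_eqI[of c])
    fix i assume i: "1 \<le> i" "i < n - 2"
    then have "i \<le> n - 2" "i + 1 \<le> n - 2" "i - 1 \<le> n - 2" by auto
    from low[OF this(1)] low[OF this(2)] low[OF this(3)]
    show "c i = eps z i - eps z (i + 1) +
      (if \<xi> (i + 1) < \<xi> i then c (i + 1) else 0) + (if i > 1 \<and> \<xi> (i - 1) < \<xi> i then c (i - 1) else 0)"
      by simp
  next
    fix k assume "Suc k \<le> n - 2"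
    then have "k \<le> n - 2" by simp
    from low[OF this] low[OF \<open>Suc k \<le> n - 2\<close>]
    show "eps z (Suc k) - (- eps z) (Suc k) = c (Suc k) - c k"
      by simp
  next
    fix k assume "k > n"
    then have "k \<noteq> z" using z_cases by auto
    then show "eps z k = (- eps z) k" by (simp add: eps_apply)
  next
    show "c 0 = 0" "eps z 0 = (- eps z) 0"
      using low[of 0] by simp_all
    have z: "z = n \<longleftrightarrow> \<xi> (n - 1) = \<xi> n" using ne(1) by (simp add: z_def)
    have l: "c (n - 2) = 0" "eps z (n - 2) = 0" "c (n - 3) = 0"
      using low[of "n - 2"] low[of "n - 3"] by simp_all
    show "eps z (n - 1) - (- eps z) (n - 1) = c (n - 1) - c (n - 2) + c n"
      "eps z n - (- eps z) n = c n - c (n - 1)"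
      "c (n - 1) = eps z (n - 1) - eps z n + (if \<xi> (n - 2) < \<xi> (n - 1) then c (n - 2) else 0)"
      "c n = eps z (n - 1) + eps z n + (if \<xi> (n - 2) < \<xi> n then c (n - 2) else 0)"
      by (simp_all add: l e(1,2) c(1,2) del: One_nat_def)
    show "c (n - 2) = eps z (n - 2) - eps z (n - 1) + (if \<xi> (n - 1) < \<xi> (n - 2) then c (n - 1) else 0)
      + (if \<xi> n < \<xi> (n - 2) then c n else 0) + (if \<xi> (n - 3) < \<xi> (n - 2) then c (n - 3) else 0)"
      unfolding l e(1,2) c(1,2) z end_signs by simp
  qed
qed

section \<open>Paths in the Dynkin quiver\<close>

lemma adjacent_ends: "adjacent n (n - 2) n" "adjacent n n (n - 2)" "adjacent n (n - 2) (n - 1)" "adjacent n (n - 1) (n - 2)"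
  using n4 by (auto simp: adjacent_iff)

(* The index n - 1 stays as it is, also when simplified. *)
declare One_nat_def [simp del]

text \<open>The end vertices \<open>n - 1\<close> and \<open>n\<close> lie at the same distance from the vertex 1.\<close>

definition depth :: "nat \<Rightarrow> int" where "depth i = int (min i (n - 1))"

text \<open>The distance of two vertices in the Dynkin diagram.\<close>

definition dist :: "nat \<Rightarrow> nat \<Rightarrow> int" where
  "dist i j = (if i \<noteq> j \<and> depth i = depth j then 2 else \<bar>depth i - depth j\<bar>)"

lemma depth_simps: "i < n \<Longrightarrow> depth i = int i" "depth n = int n - 1"
  using n4 by (auto simp: depth_def)

lemma int_minus: "int (n - 1) = int n - 1" "int (n - 2) = int n - 2"
  using n4 by auto

lemma dist_line: "dist i j = \<bar>int i - int j\<bar>" if "i < n" "j < n"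
  using that by (auto simp: dist_def depth_simps)

lemma dist_ends: "dist n n = 0" "dist n (n - 1) = 2" "dist (n - 1) n = 2"
  using n4 by (auto simp: dist_def depth_simps int_minus)

lemma dist_end: "dist n j = int n - 1 - int j" "dist j n = int n - 1 - int j" if "j \<le> n - 2"
proof -
  have "j < n" "int j < int n - 1" using that n4 by auto
  then show "dist n j = int n - 1 - int j" "dist j n = int n - 1 - int j"
    by (auto simp: dist_def depth_simps)
qed

lemma dist_eq_0: "dist i j = 0 \<longleftrightarrow> i = j"
  by (auto simp: dist_def)

text \<open>The height changes by 1 along every edge.\<close>

lemma height_lipschitz: "\<xi> j - \<xi> i \<le> dist j i" if "i \<in> I0 n" "j \<in> I0 n"
proof -
  have line: "\<xi> j - \<xi> i \<le> \<bar>int j - int i\<bar>" if "1 \<le> i" "i < n" "1 \<le> j" "j < n" for i j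
  proof (cases "i \<le> j")
    case True
    then show ?thesis
      using window_mono[of i j] that by (simp add: hi_def lo_def)
  next
    case False
    then show ?thesis
      using window_mono[of j i] that by (simp add: hi_def lo_def)
  qed
  have "i = j \<or> i < n \<and> j < n \<and> i \<noteq> j \<or> i = n \<and> j = n - 1 \<or> j = n \<and> i = n - 1
      \<or> i = n \<and> j \<le> n - 2 \<or> j = n \<and> i \<le> n - 2"
    using that unfolding I0_def atLeastAtMost_iff by arith
  then consider "i = j" | "i < n" "j < n" "i \<noteq> j" | "i = n" "j = n - 1" | "j = n" "i = n - 1"
    | "i = n" "j \<le> n - 2" | "j = n" "i \<le> n - 2"
    by blast
  then show ?thesis
  proof cases
    case 2
    then show ?thesis
      using line[of i j] that by (simp add: dist_line I0_def)
  next
    case 3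
    then show ?thesis using end_step by (auto simp: dist_ends)
  next
    case 4
    then show ?thesis using end_step by (auto simp: dist_ends)
  next
    case 5
    then have "1 \<le> n - 2" "n - 2 < n" "1 \<le> j" "j < n" using that n4 by (auto simp: I0_def)
    moreover have "\<bar>int j - int (n - 2)\<bar> = int n - 2 - int j"
      using 5 n4 by auto
    ultimately show ?thesis
      using line[of "n - 2" j] end_step(1) 5 by (auto simp: dist_end)
  next
    case 6
    then have "1 \<le> n - 2" "n - 2 < n" "1 \<le> i" "i < n" using that n4 by (auto simp: I0_def)
    moreover have "\<bar>int (n - 2) - int i\<bar> = int n - 2 - int i"
      using 6 n4 by auto
    ultimately show ?thesis
      using line[of i "n - 2"] end_step(1) 6 by (auto simp: dist_end)
  qed (simp add: dist_def)
qed

lemma neighbour_towards: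
  assumes "i \<in> I0 n" "j \<in> I0 n" "i \<noteq> j"
  obtains k where "k \<in> I0 n" "adjacent n i k" "dist k j = dist i j - 1"
proof -
  have "i = n \<or> i = n - 1 \<and> j = n \<or> i < n - 2 \<and> j = n \<or> i = n - 2 \<and> j = n \<or> i < j \<and> j < n \<or> j < i \<and> i < n"
    using assms unfolding I0_def atLeastAtMost_iff by arith
  then consider "i = n" | "i = n - 1" "j = n" | "i < n - 2" "j = n" | "i = n - 2" "j = n" | "i < j" "j < n" | "j < i" "i < n"
    by blast
  then show thesis
  proof cases
    case 1
    have "n - 2 \<in> I0 n" "adjacent n i (n - 2)"
      using 1 assms n4 by (auto simp: I0_def adjacent_iff)
    moreover have "dist (n - 2) j = dist i j - 1"
      proof (cases "j = n - 1")
      case True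
      then show ?thesis using 1 n4 by (simp add: dist_ends dist_line int_minus)
    next
      case False
      then have "j \<le> n - 2" "j < n" "n - 2 < n" "int j \<le> int n - 2" using 1 assms n4 by (auto simp: I0_def)
      then show ?thesis using 1 by (auto simp: dist_end dist_line int_minus)
    qed
    ultimately show thesis using that by blast
  next
    case 2
    have "n - 2 \<in> I0 n" "adjacent n i (n - 2)"
      using 2 n4 adjacent_ends by (auto simp: I0_def)
    moreover have "dist (n - 2) j = dist i j - 1"
      using 2 by (simp add: dist_ends dist_end int_minus)
    ultimately show thesis using that by blast
  next
    case 3
    have "i + 1 \<in> I0 n" "adjacent n i (i + 1)"
      using 3 assms n4 by (auto simp: I0_def adjacent_iff)
    moreover have "dist (i + 1) j = dist i j - 1"
      proof -
      have "i \<le> n - 2" "i + 1 \<le> n - 2" using 3 by auto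
      then show ?thesis using 3(2) by (simp add: dist_end)
    qed
    ultimately show thesis using that by blast
  next
    case 4
    have "n \<in> I0 n" "adjacent n i (n)"
      using 4 assms n4 by (auto simp: I0_def adjacent_iff)
    moreover have "dist (n) j = dist i j - 1"
      using 4 by (simp add: dist_ends dist_end int_minus)
    ultimately show thesis using that by blast
  next
    case 5
    have "i + 1 \<in> I0 n" "adjacent n i (i + 1)"
      using 5 assms n4 by (auto simp: I0_def adjacent_iff)
    moreover have "dist (i + 1) j = dist i j - 1"
      proof -
      have "i < n" "i + 1 < n" using 5 by auto
      then show ?thesis using 5 by (simp add: dist_line)
    qed
    ultimately show thesis using that by blast
  next
    case 6
    have "i - 1 \<in> I0 n" "adjacent n i (i - 1)"
      using 6 assms n4 by (auto simp: I0_def adjacent_iff)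
    moreover have "dist (i - 1) j = dist i j - 1"
      proof -
      have "j < n" "i - 1 < n" "int (i - 1) = int i - 1" using 6 by auto
      then show ?thesis using 6 by (simp add: dist_line)
    qed
    ultimately show thesis using that by blast
  qed
qed

lemma adjacent_depth: "\<bar>depth j - depth k\<bar> = 1" if "adjacent n j k"
proof -
  have "n - 2 < n" "int (n - 2) = int n - 2" using n4 by auto
  then show ?thesis
    using that unfolding adjacent_iff[OF n4] by (auto simp: depth_simps)
qed

lemma dist_step: "dist j i \<le> dist k i + 1" if "adjacent n j k"
  using adjacent_depth[OF that] by (auto simp: dist_def)

text \<open>Every arrow lowers the height by 1, so a path lowers it by its length, which is at least the distance; by
\<open>height_lipschitz\<close> it cannot be lowered by more.  Conversely, if the height falls as fast as
possible, then a step towards the target must be along an arrow.\<close>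

lemma reach_iff: "(j, i) \<in> Q\<^sup>* \<longleftrightarrow> \<xi> j - \<xi> i = dist j i" if ij: "i \<in> I0 n" "j \<in> I0 n"
proof
  assume "(j, i) \<in> Q\<^sup>*"
  then show "\<xi> j - \<xi> i = dist j i"
    using ij(2)
  proof (induction rule: converse_rtrancl_induct)
    case (step j k)
    have k: "k \<in> I0 n" and jk: "adjacent n j k" "\<xi> j = \<xi> k + 1"
      using dynkin_quiver_arrowD[OF n4 Q step(1)] \<xi> step(1) by (auto simp: height_function_def)
    then show ?case
      using height_lipschitz[OF ij(1) step.prems] step.IH[OF k] jk(2) dist_step[OF jk(1), of i] by linarith
  qed (simp add: dist_def)
next
  assume "\<xi> j - \<xi> i = dist j i"
  then show "(j, i) \<in> Q\<^sup>*"
    using ij(2)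
  proof (induction "nat (dist j i)" arbitrary: j rule: less_induct)
    case less
    show ?case
    proof (cases "j = i")
      case False
      obtain k where k: "k \<in> I0 n" "adjacent n j k" "dist k i = dist j i - 1"
        using neighbour_towards[OF less.prems(2) ij(1) False] by blast
      have "\<xi> k - \<xi> i = dist k i"
        using height_lipschitz[OF ij(1) k(1)] adjacent_height[OF k(2)] k(3) less.prems(1) by linarith
      moreover have "(j, k) \<in> Q"
        using calculation k less.prems(1) by (simp add: arrow_iff)
      moreover have "dist j i > 0"
        by (simp add: dist_def False)
      ultimately show ?thesis
        using less.hyps[of k] k by (auto intro: converse_rtrancl_into_rtrancl)
    qed auto
  qed
qed

section \<open>The roots \<open>\<eta>\<^sub>i\<close>\<close>

text \<open>Both this and the next lemma say that the indicator of a constant stretch of \<open>hi\<close> or \<open>lo\<close> jumps exactly at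
the index whose place is the end of the window.  They compute the coordinates of \<open>\<eta>\<^sub>i\<close>, whose support is
made up of such stretches.\<close>

lemma place_right: "(if hi k = hi i then 1 else 0) - (if k > 1 \<and> hi (k - 1) = hi i then 1 else 0) = (if hi i = place k then 1 else (0::int))"
  if k: "1 \<le> k" "k \<le> i" "i \<le> n - 2"
proof (cases "k = 1")
  case True
  then show ?thesis using k by (auto simp: place_def)
next
  case False
  then have k1: "1 \<le> k - 1" "k - 1 + 1 < n" "k - 1 + 1 = k" "k > 1" "i < n" using k n4 by auto
  have mono: "hi k \<le> hi i" "hi (k - 1) \<le> hi i"
    using window_mono[of k i] window_mono[of "k - 1" i] k k1 by auto
  have "hi (k - 1) - lo (k - 1) > 0" using k1 by (simp add: hi_lo)
  moreover have place: "place k = (if \<xi> (k - 1) < \<xi> k then hi k else lo (k - 1))"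
    using k False by (simp add: place_def)
  ultimately show ?thesis
    using line_step[OF k1(1,2)] mono k1(4) unfolding k1(3) by auto
qed

lemma place_left: "(if lo (k - 1) = lo i then 1 else 0) - (if lo k = lo i then 1 else 0) = (if lo i = place k then 1 else (0::int))"
  if k: "1 \<le> i" "i < k" "k \<le> n - 2"
proof -
  have k1: "1 \<le> k - 1" "k - 1 + 1 < n" "k - 1 + 1 = k" "i \<le> k - 1" "k - 1 < n" "k \<noteq> 1" using k n4 by auto
  have mono: "lo (k - 1) \<le> lo i" "hi i \<le> hi (k - 1)"
    using window_mono[of i "k - 1"] k k1 by auto
  have "hi i - lo i > 0" using k by (simp add: hi_lo)
  moreover have place: "place k = (if \<xi> (k - 1) < \<xi> k then hi k else lo (k - 1))"
    using k k1 by (simp add: place_def)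
  ultimately show ?thesis
    using line_step[OF k1(1,2)] mono unfolding k1(3) by auto
qed

lemma \<chi>_window: "\<chi> (hi i - place k) = (if hi i = place k then 1 else 0)" "\<chi> (lo i - place k) = (if lo i = place k then 1 else 0)"
  if "1 \<le> i" "i \<le> n - 2" "1 \<le> k" "k \<le> n - 2"
proof -
  have "k \<in> J" using that z_cases n4 by (auto simp: J_def)
  then have "lo (n - 2) < place k" "place k \<le> hi (n - 2)"
    using place_le_iff[of k "n - 2"] that by auto
  moreover have "hi i \<le> hi (n - 2)" "lo (n - 2) \<le> lo i" "lo i \<le> hi i"
    using window_mono[of i "n - 2"] that n4 hi_lo[of i] by auto
  ultimately show "\<chi> (hi i - place k) = (if hi i = place k then 1 else 0)" "\<chi> (lo i - place k) = (if lo i = place k then 1 else 0)"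
    using hi_end by (subst \<chi>_small; simp)+
qed

lemma \<chi>_window_end: "\<chi> (hi i - lo (n - 2)) = 0" "\<chi> (lo i - lo (n - 2)) = (if lo i = lo (n - 2) then 1 else 0)"
  if "1 \<le> i" "i \<le> n - 2"
proof -
  have "hi i \<le> hi (n - 2)" "lo (n - 2) \<le> lo i" "lo i < hi i"
    using window_mono[of i "n - 2"] that n4 hi_lo[of i] by auto
  then show "\<chi> (hi i - lo (n - 2)) = 0" "\<chi> (lo i - lo (n - 2)) = (if lo i = lo (n - 2) then 1 else 0)"
    using hi_end by (subst \<chi>_small; simp)+
qed

lemma \<eta>_eqI:
  assumes "\<And>k. k = 0 \<or> k > n \<Longrightarrow> u k = 0"
    and "c = (\<lambda>j. if j \<in> I0 n \<and> (j, i) \<in> Q\<^sup>* then 1 else 0)"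
    and "\<And>k. 1 \<le> k \<Longrightarrow> k \<le> n - 2 \<Longrightarrow> u k = c k - (if k > 1 then c (k - 1) else 0)"
    and "u (n - 1) = c (n - 1) - c (n - 2) + c n" "u n = c n - c (n - 1)"
  shows "\<eta> n Q i = u"
proof -
  have "\<eta> n Q i = (\<Sum>j\<in>I0 n. (\<lambda>k. c j * simple_root n j k))"
  proof -
    have "(\<Sum>j\<in>I0 n. (\<lambda>k. c j * simple_root n j k)) =
        (\<Sum>j\<in>I0 n. if (j, i) \<in> Q\<^sup>* then simple_root n j else 0)"
      by (rule sum.cong) (auto simp: assms(2))
    also have "\<dots> = \<eta> n Q i"
      unfolding \<eta>_def by (rule sum.inter_filter[symmetric]) (simp add: I0_def)
    finally show ?thesis by simp
  qed
  also have "\<dots> = u"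
  proof (rule simple_root_combinationI[OF n4, symmetric])
    show "c 0 = 0" by (simp add: assms(2) I0_def)
    then show "u (Suc k) = c (Suc k) - c k" if "Suc k \<le> n - 2" for k
      using assms(3)[of "Suc k"] that by auto
  qed (use assms(1,4,5) in auto)
  finally show ?thesis .
qed

lemma reach_low: "(j, i) \<in> Q\<^sup>* \<longleftrightarrow> (if j \<le> i then hi j = hi i else lo j = lo i)"
  if "1 \<le> i" "i < n" "1 \<le> j" "j < n"
  using that by (simp add: reach_iff dist_line I0_def) (auto simp: hi_def lo_def)

lemma reach_from_end: "(j, i) \<in> Q\<^sup>* \<longleftrightarrow> \<xi> (n - 2) < \<xi> j \<and> lo i = lo (n - 2)"
  if i: "1 \<le> i" "i \<le> n - 2" and j: "j = n \<or> j = n - 1"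
proof -
  have "dist j i = int n - 1 - int i"
    using j
  proof
    assume "j = n - 1"
    then show ?thesis using i n4 by (simp add: dist_line int_minus)
  qed (simp add: dist_end i)
  moreover have "\<xi> (n - 2) - \<xi> i \<le> int n - 2 - int i"
    using window_mono[of i "n - 2"] i n4 by (auto simp: lo_def)
  moreover have "j \<in> I0 n" "i \<in> I0 n" using i j n4 by (auto simp: I0_def)
  moreover have "\<xi> j = \<xi> (n - 2) - 1 \<or> \<xi> j = \<xi> (n - 2) + 1"
    using end_step j by auto
  ultimately show ?thesis
    using n4 by (auto simp: reach_iff lo_def)
qed

lemma reach_to_end: "(j, i) \<in> Q\<^sup>* \<longleftrightarrow> \<xi> i < \<xi> (n - 2) \<and> hi j = hi (n - 2)"
  if j: "1 \<le> j" "j \<le> n - 2" and i: "i = n \<or> i = n - 1"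
proof -
  have "dist j i = int n - 1 - int j"
    using i
  proof
    assume "i = n - 1"
    then show ?thesis using j n4 by (simp add: dist_line int_minus)
  qed (simp add: dist_end j)
  moreover have "\<xi> j - \<xi> (n - 2) \<le> int n - 2 - int j"
    using window_mono[of j "n - 2"] j n4 by (auto simp: hi_def)
  moreover have "j \<in> I0 n" "i \<in> I0 n" using i j n4 by (auto simp: I0_def)
  moreover have "\<xi> i = \<xi> (n - 2) - 1 \<or> \<xi> i = \<xi> (n - 2) + 1"
    using end_step i by auto
  ultimately show ?thesis
    using n4 by (auto simp: reach_iff hi_def)
qed

lemma reach_end_end:
  "(n, n - 1) \<in> Q\<^sup>* \<longleftrightarrow> \<xi> (n - 2) < \<xi> n \<and> \<xi> (n - 1) < \<xi> (n - 2)"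
  "(n - 1, n) \<in> Q\<^sup>* \<longleftrightarrow> \<xi> (n - 2) < \<xi> (n - 1) \<and> \<xi> n < \<xi> (n - 2)"
proof -
  have "n \<in> I0 n" "n - 1 \<in> I0 n" using n4 by (auto simp: I0_def)
  then show "(n, n - 1) \<in> Q\<^sup>* \<longleftrightarrow> \<xi> (n - 2) < \<xi> n \<and> \<xi> (n - 1) < \<xi> (n - 2)"
    "(n - 1, n) \<in> Q\<^sup>* \<longleftrightarrow> \<xi> (n - 2) < \<xi> (n - 1) \<and> \<xi> n < \<xi> (n - 2)"
    using end_step by (auto simp: reach_iff dist_ends)
qed

text \<open>To the left of \<open>i\<close> the vertices with a path to \<open>i\<close> are those with the same \<open>hi\<close>, to the right those with the same
\<open>lo\<close>; an end vertex has a path to \<open>i\<close> if its arrow points to \<open>n - 2\<close> and the second stretch extends that far.\<close>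

lemma \<eta>_low: "\<eta> n Q i = X (hi i) - X (lo i)" if i: "1 \<le> i" "i \<le> n - 2"
proof (rule \<eta>_eqI[OF _ refl])
  let ?c = "\<lambda>j. if j \<in> I0 n \<and> (j, i) \<in> Q\<^sup>* then 1 else (0::int)"
  fix k assume k: "1 \<le> k" "k \<le> n - 2"
  have lt: "k < n" "k - 1 < n" "k \<in> I0 n" "k > 1 \<Longrightarrow> 1 \<le> k - 1 \<and> k - 1 \<in> I0 n" "i < n" using k i n4 by (auto simp: I0_def)
  have ck: "?c k = (if (if k \<le> i then hi k = hi i else lo k = lo i) then 1 else 0)"
    using reach_low[of i k] i k lt by auto
  have ck': "?c (k - 1) = (if (if k - 1 \<le> i then hi (k - 1) = hi i else lo (k - 1) = lo i) then 1 else 0)" if "k > 1"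
    using reach_low[of i "k - 1"] i k lt that by auto
  have u: "(X (hi i) - X (lo i)) k = (if hi i = place k then 1 else 0) - (if lo i = place k then 1 else 0)"
    using i k by (simp add: X_low \<chi>_window)
  have kJ: "k \<in> J" using k z_cases n4 by (auto simp: J_def)
  show "(X (hi i) - X (lo i)) k = ?c k - (if k > 1 then ?c (k - 1) else 0)"
  proof (cases "k \<le> i")
    case True
    have lo: "(lo i = place k) = False"
      using place_le_iff[OF kJ i] True by auto
    have "(if k > 1 then ?c (k - 1) else 0) = (if k > 1 \<and> hi (k - 1) = hi i then 1 else 0)"
    proof (cases "k > 1")
      case True
      have "(k - 1 \<le> i) = True" using \<open>k \<le> i\<close> by simp
      with True show ?thesis unfolding ck'[OF True] by simp
    qed simp
    moreover have "?c k = (if hi k = hi i then 1 else 0)"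
      unfolding ck using True by simp
    ultimately show ?thesis
      using place_right[OF k(1) True i(2)] unfolding u lo by simp
  next
    case False
    then have "1 < k" "k - 1 \<le> i \<longleftrightarrow> k - 1 = i" using i by auto
    have hi: "(hi i = place k) = False"
      using place_le_iff[OF kJ i] False hi_lo[of i] i by auto
    have "(if k - 1 \<le> i then hi (k - 1) = hi i else lo (k - 1) = lo i) \<longleftrightarrow> lo (k - 1) = lo i"
      using \<open>k - 1 \<le> i \<longleftrightarrow> k - 1 = i\<close> by auto
    then have "(if k > 1 then ?c (k - 1) else 0) = (if lo (k - 1) = lo i then 1 else 0)"
      unfolding ck'[OF \<open>1 < k\<close>] using \<open>1 < k\<close> by simp
    moreover have "?c k = (if lo k = lo i then 1 else 0)"
      unfolding ck using False by simp
    moreover have "i < k" using False by simp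
    ultimately show ?thesis
      using place_left[OF i(1) \<open>i < k\<close> k(2)] unfolding u hi by simp
  qed
next
  let ?c = "\<lambda>j. if j \<in> I0 n \<and> (j, i) \<in> Q\<^sup>* then 1 else (0::int)"
  have I: "n \<in> I0 n" "n - 1 \<in> I0 n" "n - 2 \<in> I0 n" using n4 by (auto simp: I0_def)
  have "(n - 2, i) \<in> Q\<^sup>* \<longleftrightarrow> lo i = lo (n - 2)"
  proof -
    have "1 \<le> n - 2" "n - 2 < n" "i < n" using n4 i by auto
    then show ?thesis
      using reach_low[of i "n - 2"] i by (cases "i = n - 2") auto
  qed
  then have c: "?c (n - 2) = (if lo i = lo (n - 2) then 1 else 0)"
    "?c (n - 1) = (if \<xi> (n - 2) < \<xi> (n - 1) \<and> lo i = lo (n - 2) then 1 else 0)"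
    "?c n = (if \<xi> (n - 2) < \<xi> n \<and> lo i = lo (n - 2) then 1 else 0)"
    using reach_from_end[OF i, of n] reach_from_end[OF i, of "n - 1"] I by auto
  show "(X (hi i) - X (lo i)) (n - 1) = ?c (n - 1) - ?c (n - 2) + ?c n"
    unfolding c minus_apply X_ends \<chi>_window_end[OF i] end_signs by simp
  show "(X (hi i) - X (lo i)) n = ?c n - ?c (n - 1)"
    unfolding c minus_apply X_ends \<chi>_window_end[OF i] end_signs by simp
qed (simp add: X_zero)

text \<open>The sign of \<open>eps z\<close> in \<open>\<eta>\<^sub>i\<close> for an end vertex \<open>i\<close>.\<close>

definition \<theta> :: "nat \<Rightarrow> int" where "\<theta> i = (if i = n - 1 \<and> z = n then - 1 else 1)"

lemma \<eta>_end: "\<eta> n Q i = (\<lambda>k. \<theta> i * eps z k) - X (\<xi> i - (int n - 1))" if i: "i = n \<or> i = n - 1"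
proof (rule \<eta>_eqI[OF _ refl])
  let ?c = "\<lambda>j. if j \<in> I0 n \<and> (j, i) \<in> Q\<^sup>* then 1 else (0::int)"
  let ?u = "(\<lambda>k. \<theta> i * eps z k) - X (\<xi> i - (int n - 1))"
  define q where "q = \<xi> i - (int n - 1)"
  have q: "q = (if \<xi> i < \<xi> (n - 2) then hi (n - 2) - h else lo (n - 2))"
    using i end_step n4 by (auto simp: q_def hi_def lo_def h_def)
  have I: "n \<in> I0 n" "n - 1 \<in> I0 n" "n - 2 \<in> I0 n" using n4 by (auto simp: I0_def)
  have low: "?c k = (if \<xi> i < \<xi> (n - 2) \<and> hi k = hi (n - 2) then 1 else 0)" if "1 \<le> k" "k \<le> n - 2" for k
    using reach_to_end[OF that i] that by (auto simp: I0_def)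
  {
    fix k assume k: "1 \<le> k" "k \<le> n - 2"
    have n2: "1 \<le> n - 2" using n4 by simp
    have kJ: "k \<in> J" "k \<noteq> z" using k z_cases n4 by (auto simp: J_def)
    have X: "X q k = - (if \<xi> i < \<xi> (n - 2) \<and> hi (n - 2) = place k then 1 else 0)"
    proof (cases "\<xi> i < \<xi> (n - 2)")
      case True
      then have "X q k = - X (hi (n - 2)) k"
        using X_shift'[of "hi (n - 2)"] by (simp add: q)
      then show ?thesis
        using True \<chi>_window(1)[OF n2 order.refl k] k by (simp add: X_low)
    next
      case False
      have "lo (n - 2) \<noteq> place k"
        using place_le_iff[OF kJ(1) n2 order.refl] k by auto
      then show ?thesis
        using False \<chi>_window(2)[OF n2 order.refl k] k by (simp add: X_low q)
    qed
    have e: "eps z k = 0" using kJ by (simp add: eps_apply)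
    have c': "(if k > 1 then ?c (k - 1) else 0) = (if \<xi> i < \<xi> (n - 2) \<and> k > 1 \<and> hi (k - 1) = hi (n - 2) then 1 else 0)"
    proof (cases "k > 1")
      case True
      have "1 \<le> k - 1" "k - 1 \<le> n - 2" using True k by auto
      from low[OF this] True show ?thesis by simp
    qed simp
    show "?u k = ?c k - (if k > 1 then ?c (k - 1) else 0)"
      unfolding low[OF k] c' minus_apply q_def[symmetric] X e
      using place_right[OF k order.refl] by (cases "\<xi> i < \<xi> (n - 2)") simp_all
  }
  have n2: "1 \<le> n - 2" using n4 by simp
  have c2: "?c (n - 2) = (if \<xi> i < \<xi> (n - 2) then 1 else 0)"
    unfolding low[OF n2 order.refl] by simp
  have c: "?c (n - 1) = (if i = n - 1 \<or> \<xi> (n - 2) < \<xi> (n - 1) \<and> \<xi> n < \<xi> (n - 2) then 1 else 0)"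
    "?c n = (if i = n \<or> \<xi> (n - 2) < \<xi> n \<and> \<xi> (n - 1) < \<xi> (n - 2) then 1 else 0)"
    using i reach_end_end I by auto
  have gq: "\<chi> (q - lo (n - 2)) = (if \<xi> i < \<xi> (n - 2) then 0 else 1)"
    using hi_end h_pos by (subst \<chi>_small) (auto simp: q)
  have ne: "(n - 1 = n) = False" using n4 by simp
  have e: "eps z n = (if \<xi> (n - 1) = \<xi> n then 1 else 0)" "eps z (n - 1) = (if \<xi> (n - 1) = \<xi> n then 0 else 1)"
    "\<theta> i = (if i = n - 1 \<and> \<xi> (n - 1) = \<xi> n then - 1 else 1)"
    using ne by (auto simp: eps_apply z_def \<theta>_def)
  show "?u (n - 1) = ?c (n - 1) - ?c (n - 2) + ?c n"
    unfolding c c2 minus_apply q_def[symmetric] X_ends gq e end_signs using i ne by auto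
  show "?u n = ?c n - ?c (n - 1)"
    unfolding c c2 minus_apply q_def[symmetric] X_ends gq e end_signs using i ne by auto
next
  fix k assume "k = 0 \<or> n < k"
  moreover from this have "k \<noteq> z" using z_cases n4 by auto
  ultimately show "((\<lambda>k. \<theta> i * eps z k) - X (\<xi> i - (int n - 1))) k = 0"
    by (simp add: X_zero eps_apply)
qed

section \<open>The label of a vertex\<close>

lemma s_cases: "s a = 1 \<or> s a = - 1" "a \<noteq> n \<Longrightarrow> s a = 1" "s z = 1"
  by (auto simp: s_def z_def)

lemma y_z: "y z = eps z"
  by (simp add: y_def s_cases(3))

lemma y_apply: "y a k = (if k = a then s a else 0)"
  by (simp add: y_def eps_apply)

text \<open>Changing the sign of \<open>eps n\<close> permutes the positive roots.\<close>

lemma pos_roots_y: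
  "v \<in> pos_roots n \<longleftrightarrow> (\<exists>a b. 1 \<le> a \<and> a < b \<and> b \<le> n \<and> (v = y a - y b \<or> v = y a + y b))"
proof -
  have "y a = eps a \<and> (y b = eps b \<or> y b = - eps b)" if "a < b" "b \<le> n" for a b
    using that s_cases(1)[of b] s_cases(2)[of a] by (auto simp: y_def fun_eq_iff)
  then have "v = y a - y b \<or> v = y a + y b \<longleftrightarrow> v = eps a - eps b \<or> v = eps a + eps b" if "a < b" "b \<le> n" for a b
    using that by (metis (no_types, lifting) diff_minus_eq_add uminus_add_conv_diff add.commute)
  then have "(\<exists>a b. 1 \<le> a \<and> a < b \<and> b \<le> n \<and> (v = y a - y b \<or> v = y a + y b)) \<longleftrightarrow>
     (\<exists>a b. 1 \<le> a \<and> a < b \<and> b \<le> n \<and> (v = eps a - eps b \<or> v = eps a + eps b))"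
    by metis
  then show ?thesis
    by (auto simp: pos_roots_def)
qed

lemma pos_root_leading:
  assumes "v \<in> pos_roots n"
  obtains a where "a < n" "v a = 1" "\<And>k. k < a \<Longrightarrow> v k = 0"
proof -
  obtain a b where "1 \<le> a" "a < b" "b \<le> n" "v = eps a - eps b \<or> v = eps a + eps b"
    using assms by (auto simp: pos_roots_def)
  then show thesis
    using that[of a] by (auto simp: eps_apply)
qed

lemma not_pos_root: "v \<notin> pos_roots n" if "a < n" "v a = - 1" "\<And>k. k < a \<Longrightarrow> v k = 0"
proof
  assume "v \<in> pos_roots n"
  then obtain b where "b < n" "v b = 1" "\<And>k. k < b \<Longrightarrow> v k = 0"
    using pos_root_leading by blast
  then show False
    using that by (cases a b rule: linorder_cases) auto
qed

lemma minus_pos_root: "- v \<notin> pos_roots n" if v: "v \<in> pos_roots n"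
proof -
  obtain b where "b < n" "v b = 1" "\<And>k. k < b \<Longrightarrow> v k = 0"
    using pos_root_leading[OF v] by blast
  then show ?thesis
    by (intro not_pos_root[of b]) auto
qed

text \<open>The coordinates of \<open>y a - y b\<close> for \<open>a < b\<close>.  If \<open>z\<close> is not involved, the root is \<open>X T - X S\<close> with \<open>S < T < S + h\<close> for
a pair \<open>(S, T)\<close> that is unique up to adding multiples of \<open>2 h\<close> to both entries, and the choice made here is the
one inside the Auslander-Reiten quiver.
The one root in which \<open>z\<close> is the smaller index, for \<open>z = n - 1\<close> and \<open>b = n\<close>, lies half a period further on.\<close>

definition diff_coord :: "nat \<Rightarrow> nat \<Rightarrow> int \<times> int" where
  "diff_coord a b = (if b = z then (place a - h, place a) else if a = z then (place b, place b + h)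
     else if place b < place a then (place b, place a) else (place a - h, place b - h))"

definition sum_coord :: "nat \<Rightarrow> nat \<Rightarrow> int \<times> int" where
  "sum_coord a b = (if b = z then (place a - h, place a) else if a = z then (place b - h, place b)
     else (max (place a) (place b) - h, min (place a) (place b)))"

definition located :: "vec \<Rightarrow> int \<times> int \<Rightarrow> bool" where
  "located v C \<longleftrightarrow> (\<exists>a b. 1 \<le> a \<and> a < b \<and> b \<le> n \<and>
     (v = y a - y b \<and> C = diff_coord a b \<or> v = y a + y b \<and> C = sum_coord a b))"

lemma located_pos_root: "v \<in> pos_roots n" if "located v C"
  using that by (auto simp: located_def pos_roots_y)

text \<open>This is the candidate for the label of the vertex \<open>(i, \<xi> i - 2 k)\<close>, whether or not that is a vertex.\<close>

definition ar_label :: "nat \<Rightarrow> nat \<Rightarrow> vec" where "ar_label i k = (\<tau> ^^ k) (\<eta> n Q i)"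

lemma ar_label_low: "ar_label i k = X (hi i - 2 * int k) - X (lo i - 2 * int k)" if "1 \<le> i" "i \<le> n - 2"
proof (induction k)
  case 0
  show ?case using \<eta>_low[OF that] by (simp add: ar_label_def)
next
  case (Suc k)
  have "ar_label i (Suc k) = \<tau> (ar_label i k)" by (simp add: ar_label_def)
  also have "\<dots> = X (hi i - 2 * int k - 2) - X (lo i - 2 * int k - 2)"
    unfolding Suc coxeter_diff \<tau>_X ..
  moreover have "hi i - 2 * int k - 2 = hi i - 2 * int (Suc k)" "lo i - 2 * int k - 2 = lo i - 2 * int (Suc k)"
    by simp_all
  ultimately show ?case
    by (simp only:)
qed

lemma \<tau>_scale_eps_z: "\<tau> (\<lambda>k. c * eps z k) = (\<lambda>k. - c * eps z k)" if "c = 1 \<or> c = - 1"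
  using that
proof
  assume c: "c = 1"
  have "(\<lambda>k. c * eps z k) = eps z" "(\<lambda>k. - c * eps z k) = - eps z" by (auto simp: c)
  then show ?thesis using \<tau>_eps_z by simp
next
  assume c: "c = - 1"
  have "(\<lambda>k. c * eps z k) = - eps z" "(\<lambda>k. - c * eps z k) = eps z" by (auto simp: c)
  then show ?thesis using \<tau>_eps_z by (simp add: coxeter_minus)
qed

lemma ar_label_end: "ar_label i k = (\<lambda>m. (- 1) ^ k * \<theta> i * eps z m) - X (\<xi> i - (int n - 1) - 2 * int k)"
  if "i = n \<or> i = n - 1"
proof (induction k)
  case 0
  show ?case using \<eta>_end[OF that] by (simp add: ar_label_def)
next
  case (Suc k)
  have "ar_label i (Suc k) = \<tau> (ar_label i k)" by (simp add: ar_label_def)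
  moreover have "(- 1) ^ k * \<theta> i = 1 \<or> (- 1) ^ k * \<theta> i = - 1"
    using minus_one_power_iff[of k, where 'a = int] by (auto simp: \<theta>_def)
  ultimately have "ar_label i (Suc k) = (\<lambda>m. - ((- 1) ^ k * \<theta> i) * eps z m) - X (\<xi> i - (int n - 1) - 2 * int k - 2)"
    unfolding Suc coxeter_diff \<tau>_X by (simp only: \<tau>_scale_eps_z)
  moreover have "\<xi> i - (int n - 1) - 2 * int k - 2 = \<xi> i - (int n - 1) - 2 * int (Suc k)"
    "- ((- 1) ^ k * \<theta> i) = (- 1) ^ Suc k * \<theta> i"
    by simp_all
  ultimately show ?case
    by (simp only:)
qed

lemma located_diff: "located (y c - y d) (if place d < place c then (place d, place c) else (place c - h, place d - h))"
  if "c \<in> J" "d \<in> J" "c < d"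
  unfolding located_def using that by (intro exI[of _ c] exI[of _ d]) (auto simp: J_def diff_coord_def)

lemma located_sum: "located (y c + y d) (max (place c) (place d) - h, min (place c) (place d))"
  if "c \<in> J" "d \<in> J" "c \<noteq> d"
proof -
  have *: "located (y c + y d) (max (place c) (place d) - h, min (place c) (place d))" if "c \<in> J" "d \<in> J" "c < d" for c d
    unfolding located_def using that by (intro exI[of _ c] exI[of _ d]) (auto simp: J_def sum_coord_def)
  show ?thesis
    using *[OF that(1,2)] *[OF that(2,1)] that(3) by (auto simp: nat_neq_iff add.commute max.commute min.commute)
qed

lemma X_below: "X q = - y c" if "c \<in> J" "place c = q + h"
  using X_P[OF that(1)] X_shift[of q] unfolding that(2) by (metis minus_minus)

text \<open>The three cases are those in which both, one or none of the positions \<open>S < T\<close> lie in the range of places; the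
remaining ones are moved there by adding \<open>h\<close>.  If only one of them is moved, the root is a sum and there
is nothing to show for positivity.  Otherwise the order of the two indices has to be found: it follows from comparing
the positions with the window of \<open>i\<close>, or from the valley with the index 1 as its bottom.\<close>

lemma ar_label_low_located:
  assumes i: "1 \<le> i" "i \<le> n - 2" and k: "k < n - 1"
  shows "located (ar_label i k) (lo i - 2 * int k, hi i - 2 * int k)"
proof -
  define S T where "S = lo i - 2 * int k" and "T = hi i - 2 * int k"
  have ar_label: "ar_label i k = X T - X S"
    using ar_label_low[OF i] by (simp add: S_def T_def)
  have b: "base - 2 \<le> lo i" "hi i \<le> base + h - 2"
    using base_bounds[OF i] by auto
  have kh: "2 * int k \<le> h - 2" using k by (simp add: h_def of_nat_diff)
  have par: "even (S - lo (n - 2))" "even (T - lo (n - 2))"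
  proof -
    have "i < n" "n - 2 < n" using i n4 by auto
    then have "even (hi (n - 2) - hi i)"
      using window_mono[of i "n - 2"] i by auto
    moreover have "even (hi (n - 2) - lo (n - 2))" "even (hi i - lo i)" by (simp_all add: hi_lo)
    ultimately show "even (S - lo (n - 2))" "even (T - lo (n - 2))"
      by (auto simp: S_def T_def)
  qed
  have hpar: "even h" by (simp add: h_def)
  have TS: "T - S = 2 * int i" "2 * int i < h" "0 < 2 * int i"
    using i n4 by (auto simp: S_def T_def hi_lo h_def)
  have J1: "1 \<in> J" using z_cases n4 by (auto simp: J_def)
  have P1: "lo i < place 1" "place 1 \<le> hi i"
    using place_le_iff[OF J1 i] i by auto
  have "located (X T - X S) (S, T)"
  proof -
    consider "base \<le> S" | "S < base" "base \<le> T" | "T < base" by linarith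
    then show ?thesis
    proof cases
      case 1
      obtain d where d: "d \<in> J" "place d = S"
        using place_surj[of S] 1 par b TS by (auto simp: S_def T_def)
      obtain c where c: "c \<in> J" "place c = T"
        using place_surj[of T] 1 par b TS by (auto simp: S_def T_def)
      have "d > i"
        using place_le_iff[OF d(1) i] d(2) by (auto simp: S_def)
      have "c < d"
      proof (cases "T > lo i")
        case True
        then have "c \<le> i"
          using place_le_iff[OF c(1) i] c(2) by (auto simp: T_def)
        then show ?thesis using \<open>d > i\<close> by simp
      next
        case False
        then show ?thesis
          using place_valley[OF d(1) c(1) J1] c d P1 TS J_def by (force simp: J_def)
      qed
      moreover have "S < T" using TS by simp
      ultimately show ?thesis
        using located_diff[OF c(1) d(1)] X_P[OF c(1)] X_P[OF d(1)] c(2) d(2) by simp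
    next
      case 2
      have "even (S - base)" using par by (auto simp: base_def)
      then have "S \<le> base - 2" using 2 by presburger
      then have "base \<le> S + h" "S + h \<le> base + h - 2"
        using b kh by (auto simp: S_def)
      then obtain d where d: "d \<in> J" "place d = S + h"
        using place_surj[of "S + h"] par hpar by auto
      obtain c where c: "c \<in> J" "place c = T"
        using place_surj[of T] 2 par b by (auto simp: T_def)
      have "X S = - y d"
        using X_below[OF d] .
      moreover have "T < S + h" using TS by linarith
      moreover from this have "c \<noteq> d" using c d by auto
      ultimately show ?thesis
        using located_sum[OF c(1) d(1)] X_P[OF c(1)] c(2) d(2) by auto
    next
      case 3
      have "even (T - base)" using par by (auto simp: base_def)
      then have "T \<le> base - 2" using 3 by presburger
      then have "base \<le> S + h" "S + h \<le> base + h - 2" "base \<le> T + h" "T + h \<le> base + h - 2" "hi i < T + h"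
        using b kh 3 TS by (auto simp: S_def T_def)
      then obtain c d where d: "d \<in> J" "place d = S + h" and c: "c \<in> J" "place c = T + h"
        using place_surj[of "S + h"] place_surj[of "T + h"] par hpar by (metis (no_types, lifting) add_diff_eq diff_add_eq even_add)
      have "c > i"
        using place_le_iff[OF c(1) i] c(2) \<open>hi i < T + h\<close> by auto
      have "d < c"
      proof (cases "S + h \<le> hi i")
        case True
        then have "d \<le> i"
          using place_le_iff[OF d(1) i] d(2) b TS kh by (auto simp: S_def)
        then show ?thesis using \<open>c > i\<close> by simp
      next
        case False
        then show ?thesis
          using place_valley[OF J1 d(1) c(1)] c d P1 TS by (force simp: J_def)
      qed
      moreover have "X S = - y d" "X T = - y c"
        using X_below[OF d] X_below[OF c] .
      moreover have "S < T" using TS by simp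
      ultimately show ?thesis
        using located_diff[OF d(1) c(1)] c(2) d(2) by simp
    qed
  qed
  then show ?thesis unfolding ar_label by (simp add: S_def T_def)
qed

definition e\<^sub>z :: "int \<Rightarrow> vec" where "e\<^sub>z \<sigma> = (\<lambda>m. \<sigma> * eps z m)"

lemma e\<^sub>z_simps: "e\<^sub>z 1 = y z" "e\<^sub>z (- 1) = - y z"
  by (auto simp: e\<^sub>z_def y_z)

lemma located_end: "located (y c + e\<^sub>z \<sigma>) (place c - h, place c)"
  if c: "c \<in> J" and \<sigma>: "\<sigma> = 1 \<or> \<sigma> = - 1" and pos: "c < z \<or> \<sigma> = 1"
proof (cases "c < z")
  case True
  then show ?thesis
    unfolding located_def using c \<sigma> z_cases
    by (intro exI[of _ c] exI[of _ z]) (auto simp: e\<^sub>z_simps diff_coord_def sum_coord_def J_def)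
next
  case False
  then have "c = n" "z = n - 1" "\<sigma> = 1"
    using c z_cases pos by (auto simp: J_def)
  then show ?thesis
    unfolding located_def using n4
    by (intro exI[of _ z] exI[of _ n]) (auto simp: e\<^sub>z_simps sum_coord_def add.commute)
qed

lemma located_low_end: "located (y z - y n) (place n, place n + h)" if "z = n - 1"
  unfolding located_def using n4 that by (intro exI[of _ z] exI[of _ n]) (auto simp: diff_coord_def)

text \<open>The first coordinate of the vertex \<open>(i, \<xi> i - 2 k)\<close> for an end vertex \<open>i\<close>.\<close>

definition end_pos :: "nat \<Rightarrow> nat \<Rightarrow> int" where "end_pos i k = \<xi> i - (int n - 1) - 2 * int k"

definition end_sign :: "nat \<Rightarrow> nat \<Rightarrow> int" where "end_sign i k = (- 1) ^ k * \<theta> i"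

lemma end_sign_cases: "end_sign i k = 1 \<or> end_sign i k = - 1"
  using minus_one_power_iff[of k, where 'a = int] by (auto simp: \<theta>_def end_sign_def)

lemma ar_label_end': "ar_label i k = e\<^sub>z (end_sign i k) - X (end_pos i k)" if "i = n \<or> i = n - 1"
  using ar_label_end[OF that] by (simp add: end_sign_def end_pos_def e\<^sub>z_def)

lemma end_pos_parity: "even (end_pos i k - lo (n - 2))" "end_pos i k \<le> lo (n - 2)"
    "end_pos i k = lo (n - 2) \<Longrightarrow> k = 0 \<and> \<xi> (n - 2) < \<xi> i" if "i = n \<or> i = n - 1"
  using that end_step n4 by (auto simp: end_pos_def lo_def)

lemma base_cases: "base = lo (n - 2) + 2 \<and> z = n \<and> \<xi> (n - 2) < \<xi> (n - 1) \<and> \<xi> (n - 2) < \<xi> n \<or>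
    base = lo (n - 2) \<and> \<not> (z = n \<and> \<xi> (n - 2) < \<xi> (n - 1))"
  by (auto simp: base_def z_def)

lemma place_n: "place n = lo (n - 2)" if "z = n - 1"
proof -
  have "z \<noteq> n" "\<not> n \<le> n - 2" using that n4 by auto
  then show ?thesis by (simp add: place_def)
qed

text \<open>The position is itself a place only for the first label of an end vertex that is a source, when the other end vertex is
a sink.\<close>

lemma ar_label_end_above:
  assumes i: "i = n \<or> i = n - 1" and S: "end_pos i k = lo (n - 2)" "base = lo (n - 2)"
  shows "z = n - 1 \<and> ar_label i k = y z - y n"
proof -
  have "k = 0" "\<xi> (n - 2) < \<xi> i"
    using end_pos_parity(3)[OF i S(1)] by auto
  then have z: "z = n - 1"
    using S(2) i base_cases by (auto simp: z_def)
  then have "n \<in> J" "n - 1 \<noteq> n" using n4 by (auto simp: J_def)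
  then have "X (lo (n - 2)) = y n"
    using X_P[of n] place_n[OF z] by simp
  moreover have "end_sign i k = 1"
    using z \<open>k = 0\<close> \<open>n - 1 \<noteq> n\<close> by (simp add: end_sign_def \<theta>_def)
  ultimately show ?thesis
    using ar_label_end'[OF i, of k] z S(1) by (simp only: e\<^sub>z_simps)
qed

lemma ar_label_end_mid:
  assumes i: "i = n \<or> i = n - 1" and S: "base - h \<le> end_pos i k" "end_pos i k \<le> base - 2"
  obtains c where "c \<in> J" "place c = end_pos i k + h" "ar_label i k = y c + e\<^sub>z (end_sign i k)"
proof -
  have "even h" by (simp add: h_def)
  then obtain c where c: "c \<in> J" "place c = end_pos i k + h"
    using place_surj[of "end_pos i k + h"] S end_pos_parity(1)[OF i, of k] by auto
  then show thesis
    using that[OF c] X_below[OF c] ar_label_end'[OF i, of k] by (simp add: add.commute)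
qed

lemma not_pos_end: "e\<^sub>z \<sigma> - y c \<notin> pos_roots n" if "c < z"
proof (rule not_pos_root[of c])
  show "c < n" using that z_cases by auto
  then show "(e\<^sub>z \<sigma> - y c) c = - 1"
    using that s_cases(2)[of c] by (simp add: e\<^sub>z_def eps_apply y_apply)
qed (use that in \<open>simp add: e\<^sub>z_def eps_apply y_apply\<close>)

lemma J_less_z: "c < z" if "c \<in> J" "place c \<noteq> lo (n - 2) \<or> z = n"
  using that z_cases place_n by (cases "c = n") (auto simp: J_def)

text \<open>This ends the row of an end vertex.  If the two end vertices point in different directions, the number of labels
before it depends on the parity of \<open>n\<close>, since \<open>eps z\<close> changes sign at every step; the bound on their position
given here does not.\<close>

lemma ar_label_end_neg:
  assumes i: "i = n \<or> i = n - 1" and S: "base - h - 2 = end_pos i k \<and> z = n \<or> end_pos i k = lo (n - 2) - h - 2"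
  shows "ar_label i k \<notin> pos_roots n"
proof -
  have "even h" by (simp add: h_def)
  have "base \<le> end_pos i k + 2 * h" "end_pos i k + 2 * h \<le> base + h - 2"
    using S h_pos base_cases by auto
  then obtain c where c: "c \<in> J" "place c = end_pos i k + 2 * h"
    using place_surj[of "end_pos i k + 2 * h"] end_pos_parity(1)[OF i, of k] by auto
  have "X (end_pos i k) = y c"
    using X_P[OF c(1)] X_shift[of "end_pos i k"] X_shift[of "end_pos i k + h"] c(2) by (simp add: add.assoc)
  moreover have "c < z"
    using J_less_z[OF c(1)] c(2) S h_pos by auto
  ultimately show ?thesis
    using not_pos_end[of c] ar_label_end'[OF i] by simp
qed

lemma ar_label_end_located:
  assumes i: "i = n \<or> i = n - 1" and S: "lo (n - 2) - h \<le> end_pos i k" and pos: "ar_label i k \<in> pos_roots n"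
  shows "located (ar_label i k) (end_pos i k, end_pos i k + h)"
proof -
  consider "end_pos i k = lo (n - 2)" "base = lo (n - 2)" | "base - h \<le> end_pos i k" "end_pos i k \<le> base - 2"
    | "base - h - 2 = end_pos i k" "z = n"
  proof -
    have "even h" by (simp add: h_def)
    then have "end_pos i k = lo (n - 2) \<or> end_pos i k \<le> lo (n - 2) - 2"
      "end_pos i k = lo (n - 2) - h \<or> end_pos i k \<ge> lo (n - 2) - h + 2"
      using S end_pos_parity(1,2)[OF i, of k] by presburger+
    then show ?thesis
      using base_cases that h_pos by (elim disjE conjE) auto
  qed
  then show ?thesis
  proof cases
    case 1
    then show ?thesis
      using ar_label_end_above[OF i 1] located_low_end place_n by auto
  next
    case 2
    obtain c where c: "c \<in> J" "place c = end_pos i k + h" "ar_label i k = y c + e\<^sub>z (end_sign i k)"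
      using ar_label_end_mid[OF i 2] by blast
    have "c < z \<or> end_sign i k = 1"
    proof (rule ccontr)
      assume *: "\<not> (c < z \<or> end_sign i k = 1)"
      then have "c = n" "z = n - 1" "end_sign i k = - 1"
        using c(1) z_cases end_sign_cases by (auto simp: J_def)
      then have "ar_label i k \<notin> pos_roots n"
        using n4 by (intro not_pos_root[of "n - 1"]) (auto simp: c(3) e\<^sub>z_def eps_apply y_apply)
      then show False using pos by simp
    qed
    then show ?thesis
      using located_end[OF c(1) end_sign_cases] c(2,3) by simp
  next
    case 3
    then show ?thesis
      using ar_label_end_neg[OF i, of k] pos by simp
  qed
qed

lemma ar_label_end_pos:
  assumes i: "i = n \<or> i = n - 1" and S: "lo (n - 2) - h + 2 \<le> end_pos i k"
  shows "ar_label i k \<in> pos_roots n"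
proof -
  consider "end_pos i k = lo (n - 2)" "base = lo (n - 2)" | "base - h \<le> end_pos i k" "end_pos i k \<le> base - 2"
  proof -
    have "end_pos i k = lo (n - 2) \<or> end_pos i k \<le> lo (n - 2) - 2"
      using end_pos_parity(1,2)[OF i, of k] by presburger
    then show ?thesis
      using base_cases that S h_pos by (elim disjE conjE) auto
  qed
  then show ?thesis
  proof cases
    case 1
    then show ?thesis
      using ar_label_end_above[OF i 1] located_low_end located_pos_root by metis
  next
    case 2
    obtain c where c: "c \<in> J" "place c = end_pos i k + h" "ar_label i k = y c + e\<^sub>z (end_sign i k)"
      using ar_label_end_mid[OF i 2] by blast
    then have "c < z"
      using J_less_z[OF c(1)] S by auto
    then show ?thesis
      unfolding c(3) by (intro located_pos_root[OF located_end[OF c(1) end_sign_cases]]) simp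
  qed
qed

section \<open>The vertices and the paths of the Auslander-Reiten quiver\<close>

text \<open>Membership in the quiver, since \<open>AR_max\<close> ends the initial run of positive values.\<close>

definition positive_upto :: "nat \<Rightarrow> nat \<Rightarrow> bool" where "positive_upto i k \<longleftrightarrow> (\<forall>j\<le>k. ar_label i j \<in> pos_roots n)"

text \<open>After \<open>n - 1 = h / 2\<close> steps the label is the negative of the first.\<close>

lemma positive_upto_low: "positive_upto i k \<longleftrightarrow> k < n - 1" if i: "1 \<le> i" "i \<le> n - 2"
proof
  assume positive_upto: "positive_upto i k"
  show "k < n - 1"
  proof (rule ccontr)
    assume "\<not> k < n - 1"
    then have "ar_label i (n - 1) \<in> pos_roots n" "ar_label i 0 \<in> pos_roots n"
      using positive_upto by (auto simp: positive_upto_def)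
    moreover have "2 * int (n - 1) = h" using n4 by (simp add: h_def int_minus)
    then have "ar_label i (n - 1) = - ar_label i 0"
      using ar_label_low[OF i, of "n - 1"] ar_label_low[OF i, of 0] X_shift'[of "hi i"] X_shift'[of "lo i"] by simp
    ultimately show False
      using minus_pos_root by metis
  qed
next
  assume "k < n - 1"
  then show "positive_upto i k"
    unfolding positive_upto_def using located_pos_root[OF ar_label_low_located[OF i]] by auto
qed

lemma end_pos_step: "end_pos i (k + j) = end_pos i k - 2 * int j"
  by (simp add: end_pos_def)

text \<open>The first two statements determine the row of an end vertex up to one label.
The third covers that label.\<close>

lemma positive_upto_end:
  assumes i: "i = n \<or> i = n - 1"
  shows "positive_upto i k \<Longrightarrow> lo (n - 2) - h \<le> end_pos i k"
    and "lo (n - 2) - h + 2 \<le> end_pos i k \<Longrightarrow> positive_upto i k"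
    and "lo (n - 2) - h \<le> end_pos i k \<Longrightarrow> ar_label i k \<in> pos_roots n \<Longrightarrow> positive_upto i k"
proof -
  have mono: "end_pos i k \<le> end_pos i j" if "j \<le> k" for j k
    using that by (simp add: end_pos_def)
  show "lo (n - 2) - h \<le> end_pos i k" if positive_upto: "positive_upto i k"
  proof (rule ccontr)
    assume *: "\<not> lo (n - 2) - h \<le> end_pos i k"
    \<comment> \<open>The row passes every position of the right parity, so \<open>K\<close> is the step at which the label of \<open>ar_label_end_neg\<close> appears.\<close>
    define K where "K = nat ((end_pos i 0 - (lo (n - 2) - h - 2)) div 2)"
    have "even h" by (simp add: h_def)
    have "end_pos i 0 \<ge> lo (n - 2) - 2"
      using i end_step n4 by (auto simp: end_pos_def lo_def)
    then have K: "2 * int K = end_pos i 0 - (lo (n - 2) - h - 2)"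
      using end_pos_parity(1)[OF i, of 0] \<open>even h\<close> h_pos unfolding K_def by (subst nat_0_le) auto
    then have "end_pos i K = lo (n - 2) - h - 2"
      using end_pos_step[of i 0 K] by simp
    then have "ar_label i K \<notin> pos_roots n"
      using ar_label_end_neg[OF i] by blast
    moreover have "K \<le> k"
    proof -
      have "end_pos i k \<le> lo (n - 2) - h - 2"
        using * end_pos_parity(1)[OF i, of k] \<open>even h\<close> by presburger
      then show ?thesis
        using K end_pos_step[of i 0 k] by simp
    qed
    ultimately show False
      using positive_upto by (auto simp: positive_upto_def)
  qed
  show 2: "positive_upto i k" if "lo (n - 2) - h + 2 \<le> end_pos i k" for k
    unfolding positive_upto_def using ar_label_end_pos[OF i] mono that by (meson order_trans)
  show "positive_upto i k" if S: "lo (n - 2) - h \<le> end_pos i k" "ar_label i k \<in> pos_roots n"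
  proof (cases k)
    case 0
    then show ?thesis using S by (simp add: positive_upto_def)
  next
    case (Suc l)
    then have "positive_upto i l"
      using S(1) by (intro 2) (simp add: end_pos_def)
    then show ?thesis
      using S Suc by (auto simp: positive_upto_def le_Suc_eq)
  qed
qed

lemma I0_cases: "1 \<le> i \<and> i \<le> n - 2 \<or> i = n \<or> i = n - 1" if "i \<in> I0 n"
  using that by (auto simp: I0_def)

lemma positive_upto_0: "positive_upto i 0" if "i \<in> I0 n"
  using I0_cases[OF that]
proof
  assume "i = n \<or> i = n - 1"
  moreover from this have "lo (n - 2) - h + 2 \<le> end_pos i 0"
    using end_step n4 by (auto simp: end_pos_def lo_def h_def)
  ultimately show ?thesis using positive_upto_end(2) by blast
qed (use n4 in \<open>simp add: positive_upto_low\<close>)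

lemma le_AR_max_iff: "k \<le> AR_max n Q w i \<longleftrightarrow> positive_upto i k" if i: "i \<in> I0 n"
proof -
  have max: "AR_max n Q w i = (GREATEST m. positive_upto i m)"
    by (simp add: AR_max_def positive_upto_def ar_label_def)
  obtain b where b: "\<And>k. positive_upto i k \<Longrightarrow> k \<le> b"
    using I0_cases[OF i]
  proof
    assume "1 \<le> i \<and> i \<le> n - 2"
    then show thesis
      using that[of n] positive_upto_low[of i] by fastforce
  next
    assume ends: "i = n \<or> i = n - 1"
    show thesis
    proof (rule that[of "nat (end_pos i 0 - lo (n - 2) + h)"])
      fix k assume "positive_upto i k"
      then have "int k \<le> end_pos i 0 - lo (n - 2) + h"
        using positive_upto_end(1)[OF ends] end_pos_step[of i 0 k] by force
      then show "k \<le> nat (end_pos i 0 - lo (n - 2) + h)"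
        by linarith
    qed
  qed
  have down: "positive_upto i k" if "positive_upto i m" "k \<le> m" for k m
    using that by (auto simp: positive_upto_def)
  have positive_upto_max: "positive_upto i (AR_max n Q w i)"
    unfolding max by (rule GreatestI_nat[where P = "positive_upto i" and b = b, OF positive_upto_0[OF i] b])
  show ?thesis
  proof
    show "positive_upto i k" if "k \<le> AR_max n Q w i"
      using down[OF positive_upto_max that] .
    show "k \<le> AR_max n Q w i" if "positive_upto i k"
      unfolding max by (rule Greatest_le_nat[where P = "positive_upto i" and b = b, OF that b])
  qed
qed

abbreviation V :: "(nat \<times> int) set" where "V \<equiv> AR_vertices n Q \<xi> w"

lemma V_iff: "(i, p) \<in> V \<longleftrightarrow> i \<in> I0 n \<and> (\<exists>k. p = \<xi> i - 2 * int k \<and> positive_upto i k)"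
  by (auto simp: AR_vertices_def le_AR_max_iff)

lemma AR_labels_iff: "((i, p), v) \<in> AR_labels n Q \<xi> w \<longleftrightarrow>
    i \<in> I0 n \<and> (\<exists>k. p = \<xi> i - 2 * int k \<and> v = ar_label i k \<and> positive_upto i k)"
  by (auto simp: AR_labels_def le_AR_max_iff ar_label_def)

text \<open>The lower ends of the rows of neighbouring vertices differ by at most 1, so a step upwards can leave the quiver only at its
upper end.\<close>

lemma V_step:
  assumes V: "(i, p) \<in> V" and adj: "adjacent n i j" and p: "p + 1 \<le> \<xi> j"
  shows "(j, p + 1) \<in> V"
proof -
  obtain k where i: "i \<in> I0 n" and k: "p = \<xi> i - 2 * int k" "positive_upto i k"
    using V by (auto simp: V_iff)
  have j: "j \<in> I0 n"
    using adj n4 by (auto simp: adjacent_iff I0_def)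
  define l where "l = (if \<xi> j = \<xi> i + 1 then k else k - 1)"
  have l: "p + 1 = \<xi> j - 2 * int l" "l \<le> k"
    using adjacent_height[OF adj] k(1) p by (auto simp: l_def)
  have "positive_upto j l"
  proof (cases "j \<le> n - 2")
    case jlow: True
    show ?thesis
    proof (cases "i \<le> n - 2")
      case True
      then show ?thesis
        using positive_upto_low i j jlow l k by (auto simp: I0_def)
    next
      case False
      then have ends: "i = n \<or> i = n - 1" using i by (auto simp: I0_def)
      then have "j = n - 2"
        using adj jlow n4 by (auto simp: adjacent_iff)
      moreover have "int l < int n - 1"
        using positive_upto_end(1)[OF ends k(2)] k(1) l(1) n4 \<open>j = n - 2\<close> by (simp add: end_pos_def lo_def h_def int_minus)
      ultimately show ?thesis
        using positive_upto_low[of "n - 2"] n4 by auto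
    qed
  next
    case False
    then have ends: "j = n \<or> j = n - 1" using j by (auto simp: I0_def)
    then have "i = n - 2"
      using adj n4 by (auto simp: adjacent_iff)
    then have "int k < int n - 1"
      using positive_upto_low[of "n - 2" k] k(2) n4 by auto
    then have "lo (n - 2) - h + 2 \<le> end_pos j l"
      using l(1) k(1) \<open>i = n - 2\<close> n4 by (simp add: end_pos_def lo_def h_def int_minus)
    then show ?thesis
      using positive_upto_end(2)[OF ends] by blast
  qed
  then show ?thesis
    using l j by (auto simp: V_iff)
qed

lemma dist_commute: "dist i j = dist j i"
  by (auto simp: dist_def)

lemma adjacent_commute: "adjacent n i j \<longleftrightarrow> adjacent n j i"
  by (auto simp: adjacent_def)

lemma dist_neighbour: "\<exists>k. k \<in> I0 n \<and> adjacent n i k \<and> dist k i = 1" if "i \<in> I0 n"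
proof -
  \<comment> \<open>Any vertex other than \<open>i\<close> serves as a direction for the step.\<close>
  define j where "j = (if i = 1 then 2 else 1 :: nat)"
  have "j \<in> I0 n" "i \<noteq> j" using n4 by (auto simp: j_def I0_def)
  from neighbour_towards[OF that this] obtain k where k: "k \<in> I0 n" "adjacent n i k" by blast
  have "dist k i \<le> dist i i + 1"
    using dist_step[of k i i] k(2) adjacent_commute by blast
  moreover have "k \<noteq> i"
    using k(2) n4 by (auto simp: adjacent_iff)
  then have "dist k i \<noteq> 0" "dist k i \<ge> 0" by (auto simp: dist_eq_0) (auto simp: dist_def)
  ultimately have "dist k i = 1" by (simp add: dist_def)
  then show ?thesis using k by blast
qed

text \<open>Step to a neighbour that is closer to the target.  The target lies in the quiver, so the height of the
neighbour is not exceeded and \<open>V_step\<close> applies.\<close>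

lemma path_exists:
  assumes "(i, p) \<in> V" "(j, q) \<in> V" "dist i j \<le> q - p"
  shows "((i, p), (j, q)) \<in> (AR_arrows n Q \<xi> w)\<^sup>*"
  using assms
proof (induction "nat (q - p)" arbitrary: i p rule: less_induct)
  case less
  have ij: "i \<in> I0 n" "j \<in> I0 n" and q: "q \<le> \<xi> j"
    using less.prems by (auto simp: V_iff)
  show ?case
  proof (cases "i = j \<and> p = q")
    case False
    have "dist i j \<ge> 0" by (auto simp: dist_def)
    have "\<exists>k. k \<in> I0 n \<and> adjacent n i k \<and> dist k j \<le> q - p - 1"
    proof (cases "i = j")
      case True
      then have "even (q - p)"
        using less.prems by (auto simp: V_iff)
      moreover have "q - p \<noteq> 0" "q - p \<ge> 0"
        using False True less.prems(3) \<open>dist i j \<ge> 0\<close> by auto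
      ultimately have "q - p \<ge> 2" by presburger
      then show ?thesis
        using dist_neighbour[OF ij(1)] True by force
    next
      case ne: False
      obtain k where "k \<in> I0 n" "adjacent n i k" "dist k j = dist i j - 1"
        using neighbour_towards[OF ij ne] by blast
      then show ?thesis
        using less.prems(3) by auto
    qed
    then obtain k where k: "k \<in> I0 n" "adjacent n i k" "dist k j \<le> q - p - 1" by blast
    have "dist k j \<ge> 0" by (auto simp: dist_def)
    have "\<xi> j - \<xi> k \<le> dist k j"
      using height_lipschitz[OF k(1) ij(2)] by (simp add: dist_commute)
    then have "(k, p + 1) \<in> V"
      using V_step[OF less.prems(1) k(2)] k(3) q by simp
    moreover from this have "((i, p), (k, p + 1)) \<in> AR_arrows n Q \<xi> w"
      using less.prems(1) k(2) by (auto simp: AR_arrows_def)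
    moreover have "((k, p + 1), (j, q)) \<in> (AR_arrows n Q \<xi> w)\<^sup>*"
      using less.hyps[of "p + 1" k] less.prems(2) calculation(1) k(3) \<open>dist k j \<ge> 0\<close> by simp
    ultimately show ?thesis
      by (meson converse_rtrancl_into_rtrancl)
  qed auto
qed

section \<open>Coordinates of the positive roots\<close>

definition vertex_coord :: "nat \<times> int \<Rightarrow> int \<times> int" where "vertex_coord = (\<lambda>(i, p). (p - depth i, p + depth i))"

text \<open>Every label sits at the coordinates that the formulas assign to its root.\<close>

lemma label_located: "located v (vertex_coord u)" if uv: "(u, v) \<in> AR_labels n Q \<xi> w"
proof -
  obtain i p where u: "u = (i, p)" by (cases u)
  obtain k where k: "i \<in> I0 n" "p = \<xi> i - 2 * int k" "v = ar_label i k" "positive_upto i k"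
    using uv unfolding u AR_labels_iff by blast
  from I0_cases[OF k(1)] show ?thesis
  proof
    assume i: "1 \<le> i \<and> i \<le> n - 2"
    then have "i < n" using n4 by arith
    then have "vertex_coord u = (lo i - 2 * int k, hi i - 2 * int k)"
      by (simp add: u vertex_coord_def k(2) depth_simps lo_def hi_def)
    then show ?thesis
      using ar_label_low_located i positive_upto_low k by simp
  next
    assume i: "i = n \<or> i = n - 1"
    then have "depth i = int n - 1"
      using n4 by (auto simp: depth_def)
    then have "vertex_coord u = (end_pos i k, end_pos i k + h)"
      by (simp add: u vertex_coord_def k(2) end_pos_def h_def)
    moreover have "ar_label i k \<in> pos_roots n"
      using k(4) by (simp add: positive_upto_def)
    ultimately show ?thesis
      using ar_label_end_located[OF i positive_upto_end(1)[OF i k(4)]] k(3) by simp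
  qed
qed

lemma X_period: "X (q + 2 * h * t) = X q"
proof -
  have step: "X (q + 2 * h) = X q" for q
    using X_shift[of q] X_shift[of "q + h"] by (simp add: add.assoc)
  have nat: "X (q + 2 * h * int m) = X q" for q m
  proof (induction m)
    case (Suc m)
    then show ?case
      using step[of "q + 2 * h * int m"] by (simp add: algebra_simps)
  qed simp
  show ?thesis
    using nat[of q "nat t"] nat[of "q + 2 * h * t" "nat (- t)"] by (cases "t \<ge> 0") auto
qed

text \<open>Follow the row of the vertex \<open>i\<close> through a full period of \<open>h\<close> steps; it contains \<open>v\<close>.  If \<open>v\<close> came in the second half,
then \<open>- v\<close> would come in the first half, where all labels are positive.\<close>

lemma low_label:
  assumes v: "v = X T - X S" "v \<in> pos_roots n" and ST: "S < T" "T < S + h"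
    "even (S - lo (n - 2))" "even (T - lo (n - 2))"
  shows "\<exists>u. (u, v) \<in> AR_labels n Q \<xi> w"
proof -
  define i where "i = nat ((T - S) div 2)"
  have "even (T - S)" using ST by presburger
  then have i2: "2 * int i = T - S"
    using ST(1) by (simp add: i_def)
  then have i: "1 \<le> i" "i \<le> n - 2"
    using ST by (auto simp: h_def)
  have par: "even (hi i - lo (n - 2))"
  proof -
    have "even (hi (n - 2) - hi i)" "even (hi (n - 2) - lo (n - 2))"
      using window_mono[of i "n - 2"] i n4 by (auto simp: hi_lo)
    then show ?thesis by presburger
  qed
  define d where "d = (hi i - T) div 2"
  have "even (hi i - T)" using par ST(4) by presburger
  then have d: "hi i - T = 2 * d" by (simp add: d_def)
  \<comment> \<open>A shift by \<open>2 h\<close> in \<open>X\<close> amounts to \<open>h\<close> steps along the row.\<close>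
  define m where "m = nat (d mod h)"
  have m: "int m = d mod h" "int m < h" using h_pos by (auto simp: m_def)
  have "d = h * (d div h) + int m" using m(1) by simp
  then have "hi i - 2 * int m = T + 2 * h * (d div h)"
    using d by (simp add: algebra_simps)
  moreover from this have "lo i - 2 * int m = S + 2 * h * (d div h)"
    using i2 hi_lo[of i] by linarith
  ultimately have m_lab: "ar_label i m = v"
    using ar_label_low[OF i] v(1) by (simp only: X_period)
  have "m < n - 1"
  proof (rule ccontr)
    assume *: "\<not> m < n - 1"
    define l where "l = m - (n - 1)"
    have l: "l < n - 1" "m = l + (n - 1)"
      using * m(2) by (auto simp: l_def h_def)
    have "2 * int (n - 1) = h" using n4 by (simp add: h_def int_minus)
    then have "hi i - 2 * int l - h = hi i - 2 * int m" "lo i - 2 * int l - h = lo i - 2 * int m"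
      using l(2) by (auto simp del: of_nat_diff)
    then have "X (hi i - 2 * int m) = - X (hi i - 2 * int l)" "X (lo i - 2 * int m) = - X (lo i - 2 * int l)"
      using X_shift' by metis+
    then have "ar_label i m = - ar_label i l"
      unfolding ar_label_low[OF i] by simp
    moreover have "ar_label i l \<in> pos_roots n"
      using ar_label_low_located[OF i l(1)] located_pos_root by blast
    ultimately show False
      using m_lab v(2) minus_pos_root by metis
  qed
  then show ?thesis
  proof -
    have "positive_upto i m" using positive_upto_low[OF i] \<open>m < n - 1\<close> by simp
    moreover have "i \<in> I0 n" using i by (simp add: I0_def)
    ultimately have "((i, \<xi> i - 2 * int m), v) \<in> AR_labels n Q \<xi> w"
      unfolding AR_labels_iff m_lab[symmetric] by blast
    then show ?thesis by blast
  qed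
qed

text \<open>At each position the two end vertices carry the two signs of \<open>eps z\<close>, so one of them has the right sign.\<close>

lemma end_label:
  assumes c: "c \<in> J" and \<sigma>: "\<sigma> = 1 \<or> \<sigma> = - 1" and pos: "c < z \<or> \<sigma> = 1"
  shows "\<exists>u. (u, y c + e\<^sub>z \<sigma>) \<in> AR_labels n Q \<xi> w"
proof -
  define S where "S = place c - h"
  have "even h" by (simp add: h_def)
  then have S: "base - h \<le> S" "S \<le> base - 2" "even (S - lo (n - 2))"
    using place_bounds[OF c] place_parity[OF c] by (auto simp: S_def)
  have *: ?thesis if i: "i = n \<or> i = n - 1" and k: "end_pos i k = S" "end_sign i k = \<sigma>" for i k
  proof -
    obtain d where d: "d \<in> J" "place d = S + h" "ar_label i k = y d + e\<^sub>z (end_sign i k)"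
      using ar_label_end_mid[OF i, of k] S k(1) by auto
    have "d = c"
      using place_inj[OF d(1) c] d(2) by (simp add: S_def)
    then have ar_label: "ar_label i k = y c + e\<^sub>z \<sigma>"
      using d(3) k(2) by simp
    moreover have "lo (n - 2) - h \<le> end_pos i k"
      using S(1) k(1) base_cases by auto
    moreover have "ar_label i k \<in> pos_roots n"
      using located_pos_root[OF located_end[OF c \<sigma> pos]] ar_label by simp
    ultimately have "positive_upto i k"
      using positive_upto_end(3)[OF i] by blast
    moreover have "i \<in> I0 n" using i n4 by (auto simp: I0_def)
    ultimately show ?thesis
      using ar_label by (intro exI[of _ "(i, \<xi> i - 2 * int k)"]) (auto simp: AR_labels_iff)
  qed
  define k where "k i = nat ((end_pos i 0 - S) div 2)" for i
  have k: "end_pos i (k i) = S" if i: "i = n \<or> i = n - 1" for i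
  proof -
    have "even (end_pos i 0 - S)"
      using end_pos_parity(1)[OF i, of 0] S(3) by presburger
    moreover have "S \<le> end_pos i 0"
      using S(2) i base_cases end_step n4 by (auto simp: end_pos_def lo_def)
    ultimately have "2 * int (k i) = end_pos i 0 - S"
      by (simp add: k_def)
    then show ?thesis
      using end_pos_step[of i 0 "k i"] by simp
  qed
  \<comment> \<open>Either the two rows start at the same height with opposite signs, or with the same sign one step apart.\<close>
  have "end_sign n (k n) = - end_sign (n - 1) (k (n - 1))"
  proof (cases "\<xi> (n - 1) = \<xi> n")
    case True
    then have "k n = k (n - 1)" by (simp add: k_def end_pos_def)
    then show ?thesis
      using True n4 by (simp add: end_sign_def \<theta>_def z_def)
  next
    case False
    then have "\<xi> n = \<xi> (n - 1) + 2 \<or> \<xi> n = \<xi> (n - 1) - 2"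
      using end_step by auto
    then have "k n = k (n - 1) + 1 \<or> k (n - 1) = k n + 1"
      using k[of n] k[of "n - 1"] by (auto simp: end_pos_def)
    moreover have "\<theta> n = 1" "\<theta> (n - 1) = 1"
      using False n4 by (auto simp: \<theta>_def z_def)
    ultimately show ?thesis
      by (elim disjE) (simp_all only: end_sign_def power_add power_one_right mult_minus_right mult_1_right minus_minus)
  qed
  then have "end_sign n (k n) = \<sigma> \<or> end_sign (n - 1) (k (n - 1)) = \<sigma>"
    using \<sigma> end_sign_cases[of n "k n"] by auto
  then show ?thesis
    using *[OF _ k] by auto
qed

lemma low_end_label: "\<exists>u. (u, y z - y n) \<in> AR_labels n Q \<xi> w" if "z = n - 1"
proof -
  have base: "base = lo (n - 2)" using base_cases that n4 by auto
  define i where "i = (if \<xi> (n - 2) < \<xi> n then n else n - 1)"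
  have i: "i = n \<or> i = n - 1" "i \<in> I0 n" using n4 by (auto simp: i_def I0_def)
  have "\<xi> i = \<xi> (n - 2) + 1"
    using that end_step n4 by (auto simp: i_def z_def)
  then have "end_pos i 0 = lo (n - 2)"
    using n4 by (simp add: end_pos_def lo_def int_minus)
  then have "ar_label i 0 = y z - y n"
    using ar_label_end_above[OF i(1) _ base] by blast
  then show ?thesis
    using positive_upto_0[OF i(2)] i(2) by (intro exI[of _ "(i, \<xi> i)"]) (auto simp: AR_labels_iff intro!: exI[of _ 0])
qed

lemma label_exists: "\<exists>u. (u, v) \<in> AR_labels n Q \<xi> w" if v: "v \<in> pos_roots n"
proof -
  obtain a b where ab: "1 \<le> a" "a < b" "b \<le> n" "v = y a - y b \<or> v = y a + y b"
    using v by (auto simp: pos_roots_y)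
  consider "b = z" | "a = z" | "a \<in> J" "b \<in> J"
    using ab by (auto simp: J_def)
  then show ?thesis
  proof cases
    case 1
    then have "a \<in> J" "a < z" using ab by (auto simp: J_def)
    then show ?thesis
      using end_label[of a 1] end_label[of a "- 1"] ab 1 by (auto simp: e\<^sub>z_simps)
  next
    case 2
    then have z: "b = n" "z = n - 1" using ab z_cases by auto
    then have "n \<in> J" using n4 by (auto simp: J_def)
    then show ?thesis
      using end_label[of n 1] low_end_label ab z 2 by (auto simp: e\<^sub>z_simps add.commute)
  next
    case 3
    have even: "even (place a - lo (n - 2))" "even (place b - lo (n - 2))" "even h"
      using place_parity 3 by (auto simp: h_def)
    have bd: "base \<le> place a" "place a \<le> base + h - 2" "base \<le> place b" "place b \<le> base + h - 2"
      using place_bounds 3 by auto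
    have ne: "place a \<noteq> place b" using place_inj[of a b] 3 ab by auto
    have X: "X (place a) = y a" "X (place b) = y b" "X (place a - h) = - y a" "X (place b - h) = - y b"
      using X_P 3 by (auto simp: X_shift')
    show ?thesis
      using ab(4)
    proof
      assume v': "v = y a - y b"
      show ?thesis
      proof (cases "place b < place a")
        case True
        then show ?thesis
          using low_label[of v "place a" "place b"] v v' X even bd by auto
      next
        case False
        then show ?thesis
          using low_label[of v "place b - h" "place a - h"] v v' X even bd ne by auto
      qed
    next
      assume v': "v = y a + y b"
      show ?thesis
      proof (cases "place b < place a")
        case True
        then show ?thesis
          using low_label[of v "place b" "place a - h"] v v' X even bd by (auto simp: add.commute)
      next
        case False
        then show ?thesis
          using low_label[of v "place a" "place b - h"] v v' X even bd ne by auto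
      qed
    qed
  qed
qed

lemma located_unique: "C = D" if C: "located v C" and D: "located v D"
proof -
  obtain a b where ab: "a < b" "v = y a - y b \<and> C = diff_coord a b \<or> v = y a + y b \<and> C = sum_coord a b"
    using C by (auto simp: located_def)
  obtain c d where cd: "c < d" "v = y c - y d \<and> D = diff_coord c d \<or> v = y c + y d \<and> D = sum_coord c d"
    using D by (auto simp: located_def)
  have s0: "s k \<noteq> 0" for k using s_cases(1)[of k] by auto
  have "{k. (y a - y b) k \<noteq> 0} = {a, b}" "{k. (y a + y b) k \<noteq> 0} = {a, b}" if "a < b" for a b
    using that s0 by (auto simp: y_apply)
  then have supp: "{k. v k \<noteq> 0} = {a, b}" "{k. v k \<noteq> 0} = {c, d}"
    using ab cd by metis+
  then have "a = c" "b = d"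
    using ab(1) cd(1) by (auto simp: doubleton_eq_iff)
  moreover have "y a - y b \<noteq> y a + y b"
  proof
    assume "y a - y b = y a + y b"
    from fun_cong[OF this, of b] show False
      using ab(1) s_cases(1)[of b] by (auto simp: y_apply)
  qed
  ultimately show ?thesis
    using ab(2) cd(2) by auto
qed

definition below :: "int \<times> int \<Rightarrow> int \<times> int \<Rightarrow> bool" where
  "below C D \<longleftrightarrow> fst C \<le> fst D \<and> snd C \<le> snd D \<and> C \<noteq> D"

lemma located_exists: "\<exists>C. located v C" if "v \<in> pos_roots n"
  using label_exists[OF that] label_located by blast

lemma arrow_coord: "below (vertex_coord u) (vertex_coord v)" if uv: "(u, v) \<in> AR_arrows n Q \<xi> w"
proof -
  obtain i p j where *: "u = (i, p)" "v = (j, p + 1)" "adjacent n i j"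
    using uv by (auto simp: AR_arrows_def)
  then show ?thesis
    using adjacent_depth[OF *(3)] by (auto simp: below_def vertex_coord_def)
qed

lemma path_coord: "u = v \<or> below (vertex_coord u) (vertex_coord v)" if "(u, v) \<in> (AR_arrows n Q \<xi> w)\<^sup>*"
  using that
proof (induction rule: rtrancl_induct)
  case (step v x)
  have "below D F" if "below D E" "below E F" for D E F
    using that by (auto simp: below_def prod_eq_iff)
  then show ?case
    using step.IH arrow_coord[OF step(2)] by blast
qed simp

lemma height_parity: "even (\<xi> i - \<xi> j - (depth i - depth j))" if "i \<in> I0 n" "j \<in> I0 n"
proof -
  have "even (\<xi> i - depth i - (\<xi> 1 - depth 1))" if "i \<in> I0 n" for i
  proof -
    have line: "even (\<xi> i - depth i - (\<xi> 1 - depth 1))" if "1 \<le> i" "i < n" for i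
      using window_mono[of 1 i] that n4 by (simp add: depth_simps hi_def)
    show ?thesis
    proof (cases "i = n")
      case True
      have "depth n = depth (n - 2) + 1" using n4 by (simp add: depth_simps int_minus)
      then show ?thesis
        using line[of "n - 2"] end_step(1) n4 True by auto
    qed (use line[of i] that in \<open>auto simp: I0_def\<close>)
  qed
  from this[OF that(1)] this[OF that(2)] show ?thesis by presburger
qed

text \<open>Along an arrow both coordinates weakly increase and their sum increases strictly.  Conversely, comparable
coordinates mean that the difference of the heights is at least the distance; for the two end vertices,
which have distance 2 but equal depth, parity gives the missing unit.\<close>

lemma prec_iff:
  assumes "located \<alpha> C" "located \<beta> D"
  shows "AR_prec n Q \<xi> w \<alpha> \<beta> \<longleftrightarrow> below D C"
proof
  assume "AR_prec n Q \<xi> w \<alpha> \<beta>"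
  then obtain u v where uv: "\<alpha> \<noteq> \<beta>" "(u, \<beta>) \<in> AR_labels n Q \<xi> w" "(v, \<alpha>) \<in> AR_labels n Q \<xi> w"
    "(u, v) \<in> (AR_arrows n Q \<xi> w)\<^sup>*"
    by (auto simp: AR_prec_def)
  have "vertex_coord u = D" "vertex_coord v = C"
    using label_located[OF uv(2)] label_located[OF uv(3)] located_unique assms by blast+
  moreover have "u \<noteq> v"
    using uv by (cases u) (auto simp: AR_labels_iff)
  ultimately show "below D C"
    using path_coord[OF uv(4)] by auto
next
  assume below: "below D C"
  obtain u v where u: "(u, \<beta>) \<in> AR_labels n Q \<xi> w" and v: "(v, \<alpha>) \<in> AR_labels n Q \<xi> w"
    using label_exists located_pos_root assms by metis
  have vertex_coord: "vertex_coord u = D" "vertex_coord v = C"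
    using label_located[OF u] label_located[OF v] located_unique assms by blast+
  obtain i p j q where ip: "u = (i, p)" "v = (j, q)" by (cases u, cases v)
  have V: "(i, p) \<in> V" "(j, q) \<in> V"
    using u v unfolding ip AR_labels_iff V_iff by auto
  then have ij: "i \<in> I0 n" "j \<in> I0 n" by (auto simp: V_iff)
  have le: "\<bar>depth i - depth j\<bar> \<le> q - p" "depth i = depth j \<longrightarrow> p \<noteq> q"
    using below unfolding vertex_coord[symmetric] ip by (auto simp: below_def vertex_coord_def)
  have "even (q - p - (depth i - depth j))"
    using V height_parity[OF ij] by (auto simp: V_iff)
  then have "depth i = depth j \<longrightarrow> even (q - p)" by auto
  then have "depth i = depth j \<longrightarrow> q - p \<ge> 2"
    using le by presburger
  then have "dist i j \<le> q - p"
    using le(1) by (simp add: dist_def)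
  then have "(u, v) \<in> (AR_arrows n Q \<xi> w)\<^sup>*"
    using path_exists[OF V] ip by simp
  moreover have "\<alpha> \<noteq> \<beta>"
    using located_unique[OF assms(1), of D] assms(2) below by (auto simp: below_def)
  ultimately show "AR_prec n Q \<xi> w \<alpha> \<beta>"
    using u v unfolding AR_prec_def by blast
qed

definition coord :: "vec \<Rightarrow> int \<times> int" where "coord v = (THE C. located v C)"

lemma coord_eq: "coord v = C" if "located v C"
  unfolding coord_def using located_unique[OF that] that by blast

lemma coord_diff: "coord (y a - y b) = diff_coord a b" if "1 \<le> a" "a < b" "b \<le> n"
  using that by (intro coord_eq) (auto simp: located_def)

lemma coord_sum: "coord (y a + y b) = sum_coord a b" if "1 \<le> a" "a < b" "b \<le> n"
  using that by (intro coord_eq) (auto simp: located_def)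

lemma prec_coord: "AR_prec n Q \<xi> w \<alpha> \<beta> \<longleftrightarrow> below (coord \<beta>) (coord \<alpha>)"
  if "\<alpha> \<in> pos_roots n" "\<beta> \<in> pos_roots n"
  using located_exists[OF that(1)] located_exists[OF that(2)] prec_iff coord_eq by metis

lemma below_trans: "below C D \<Longrightarrow> below D E \<Longrightarrow> below C E"
  by (auto simp: below_def prod_eq_iff)

section \<open>The shapes of a decomposition\<close>

text \<open>This involution permutes the positive roots, so decompositions in terms of \<open>eps\<close> carry over to \<open>y\<close>.\<close>

definition flip :: "vec \<Rightarrow> vec" where "flip v = (\<lambda>k. s k * v k)"

lemma flip_simps: "flip (u + v) = flip u + flip v" "flip (u - v) = flip u - flip v" "flip (y a) = eps a"
    "flip (eps a) = y a" "flip (flip v) = v"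
proof -
  have s: "s k * s k = 1" "s k * (s k * x) = x" for k x
    using s_cases(1)[of k] by auto
  show "flip (u + v) = flip u + flip v" "flip (u - v) = flip u - flip v" "flip (y a) = eps a"
    "flip (eps a) = y a" "flip (flip v) = v"
    by (auto simp: flip_def fun_eq_iff algebra_simps y_apply eps_apply s)
qed

lemma flip_pos_root: "flip v \<in> pos_roots n" if v: "v \<in> pos_roots n"
proof -
  obtain a b where ab: "1 \<le> a" "a < b" "b \<le> n" "v = y a - y b \<or> v = y a + y b"
    using v by (auto simp: pos_roots_y)
  then have "flip v = eps a - eps b \<or> flip v = eps a + eps b"
    by (auto simp: flip_simps)
  then show ?thesis
    using ab(1-3) unfolding pos_roots_def by blast
qed

lemma y_decompose_diff:
  assumes "a < b" "\<alpha> \<in> pos_roots n" "\<beta> \<in> pos_roots n" "\<alpha> + \<beta> = y a - y b"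
  obtains c where "a < c" "c < b"
    "\<alpha> = y a - y c \<and> \<beta> = y c - y b \<or> \<beta> = y a - y c \<and> \<alpha> = y c - y b"
proof -
  have "flip \<alpha> + flip \<beta> = eps a - eps b"
    using arg_cong[OF assms(4), of flip] by (simp only: flip_simps)
  then obtain c where c: "a < c" "c < b"
    "flip \<alpha> = eps a - eps c \<and> flip \<beta> = eps c - eps b \<or> flip \<beta> = eps a - eps c \<and> flip \<alpha> = eps c - eps b"
    using eps_decompose_diff[OF assms(1) flip_pos_root[OF assms(2)] flip_pos_root[OF assms(3)]] by metis
  then show thesis
    using that[OF c(1,2)] flip_simps by metis
qed

lemma y_decompose_sum:
  assumes "a < b" "\<alpha> \<in> pos_roots n" "\<beta> \<in> pos_roots n" "\<alpha> + \<beta> = y a + y b"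
  obtains c where "a < c" "c \<noteq> b" "c \<le> n"
    "\<alpha> = y a - y c \<and> \<beta> = y b + y c \<or> \<beta> = y a - y c \<and> \<alpha> = y b + y c"
  | c where "b < c" "c \<le> n"
    "\<alpha> = y a + y c \<and> \<beta> = y b - y c \<or> \<beta> = y a + y c \<and> \<alpha> = y b - y c"
proof -
  have eq: "flip \<alpha> + flip \<beta> = eps a + eps b"
    using arg_cong[OF assms(4), of flip] by (simp only: flip_simps)
  from eps_decompose_sum[OF assms(1) flip_pos_root[OF assms(2)] flip_pos_root[OF assms(3)] eq]
  show thesis
  proof cases
    case (1 c)
    then show thesis
      using that(1)[OF 1(1-3)] flip_simps by metis
  next
    case (2 c)
    then show thesis
      using that(2)[OF 2(1,2)] flip_simps by metis
  qed
qed

text \<open>The possible coordinates \<open>L\<close> and \<open>U\<close> of the two summands of a root at \<open>G = (p, q)\<close>, with the lower one first.  If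
\<open>q < p + h\<close>, the root is \<open>X q - X p\<close>.  The first, second, third and fifth line insert \<open>X u\<close>, with \<open>u\<close> taken modulo \<open>2 h\<close> and
the summands moved to the lower and the upper side of the root; the fourth line inserts \<open>eps z\<close>.  If \<open>q = p + h\<close>,
the root is \<open>\<plusminus> eps z - X p\<close>, and the two last lines insert \<open>X u\<close>.  The flag marks the fifth line.\<close>

definition splits :: "bool \<Rightarrow> int \<times> int \<Rightarrow> int \<times> int \<Rightarrow> int \<times> int \<Rightarrow> bool" where
  "splits crossing G L U \<longleftrightarrow> (\<exists>p q u. G = (p, q) \<and> p < q \<and> (
     q < p + h \<and> \<not> crossing \<and> p < u \<and> u < q \<and> L = (p, u) \<and> U = (u, q) \<or>
     q < p + h \<and> \<not> crossing \<and> q < u \<and> u < p + h \<and> L = (q - h, u - h) \<and> U = (p, u) \<or>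
     q < p + h \<and> \<not> crossing \<and> q < u \<and> u < p + h \<and> L = (u - h, q) \<and> U = (u, p + h) \<or>
     q < p + h \<and> \<not> crossing \<and> L = (q - h, q) \<and> U = (p, p + h) \<or>
     q < p + h \<and> crossing \<and> p < u \<and> u < q \<and> L = (q - h, u) \<and> U = (u, p + h) \<or>
     q = p + h \<and> \<not> crossing \<and> p < u \<and> u < q \<and> L = (u - h, u) \<and> U = (u, q) \<or>
     q = p + h \<and> \<not> crossing \<and> p < u \<and> u < q \<and> L = (p, u) \<and> U = (u, u + h)))"

lemma splits_intros:
  "p < u \<Longrightarrow> u < q \<Longrightarrow> q < p + h \<Longrightarrow> splits False (p, q) (p, u) (u, q)"
  "p < q \<Longrightarrow> q < u \<Longrightarrow> u < p + h \<Longrightarrow> splits False (p, q) (q - h, u - h) (p, u)"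
  "p < q \<Longrightarrow> q < u \<Longrightarrow> u < p + h \<Longrightarrow> splits False (p, q) (u - h, q) (u, p + h)"
  "p < q \<Longrightarrow> q < p + h \<Longrightarrow> splits False (p, q) (q - h, q) (p, p + h)"
  "p < u \<Longrightarrow> u < q \<Longrightarrow> q < p + h \<Longrightarrow> splits True (p, q) (q - h, u) (u, p + h)"
  "p < u \<Longrightarrow> u < p + h \<Longrightarrow> splits False (p, p + h) (u - h, u) (u, p + h)"
  "p < u \<Longrightarrow> u < p + h \<Longrightarrow> splits False (p, p + h) (p, u) (u, u + h)"
  using h_pos unfolding splits_def by force+

lemma splits_below: "below L G \<and> below G U" if "splits c G L U"
  using that h_pos unfolding splits_def below_def by auto

text \<open>Each of the other shapes has a coordinate in common with \<open>G\<close>, or with \<open>G\<close> moved by \<open>h\<close>, in such positions that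
an enclosed decomposition would have to be of the same shape, for which the intermediate position \<open>u\<close> would have to
increase for one summand and decrease for the other.  The shape without \<open>u\<close> is a single decomposition up to the sign of \<open>eps z\<close>, and the two do not enclose each other.\<close>

lemma splits_nested: "c" if "splits c G L U" "splits c' G L' U'" "below L L'" "below U' U"
  using that h_pos unfolding splits_def below_def by auto

definition splits_unordered :: "bool \<Rightarrow> int \<times> int \<Rightarrow> int \<times> int \<Rightarrow> int \<times> int \<Rightarrow> bool" where
  "splits_unordered crossing G C D \<longleftrightarrow> splits crossing G C D \<or> splits crossing G D C"

definition between :: "int \<Rightarrow> int \<Rightarrow> int \<Rightarrow> bool" where
  "between x m x' \<longleftrightarrow> x < m \<and> m < x' \<or> x' < m \<and> m < x"

text \<open>The coordinates of a difference and of a sum as functions of the places of the two vectors, the first of which has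
the smaller index in the case of a difference.\<close>

definition diff_box :: "int \<Rightarrow> int \<Rightarrow> int \<times> int" where
  "diff_box A B = (if B < A then (B, A) else (A - h, B - h))"

definition sum_box :: "int \<Rightarrow> int \<Rightarrow> int \<times> int" where
  "sum_box A B = (max A B - h, min A B)"

context
  fixes A B C :: int
  assumes ne: "A \<noteq> B" "A \<noteq> C" "B \<noteq> C" and lt: "\<bar>A - B\<bar> < h" "\<bar>A - C\<bar> < h" "\<bar>B - C\<bar> < h"
begin

lemma three_orders: "A < B \<and> B < C \<or> A < C \<and> C < B \<or> B < A \<and> A < C \<or> B < C \<and> C < A \<or> C < A \<and> A < B \<or> C < B \<and> B < A"
  using ne by linarith

text \<open>The excluded order of the places would put both summands on the same side of the root; the valley rules it out.\<close>

lemma splits_diff_box: "\<not> between A B C \<Longrightarrow> splits_unordered False (diff_box A B) (diff_box A C) (diff_box C B)"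
  using three_orders lt splits_intros(1)[of "A - h" "C - h" "B - h"] splits_intros(1)[of B C A]
    splits_intros(3)[of "A - h" "B - h" "C"] splits_intros(2)[of "A - h" "B - h" "C"]
    splits_intros(2)[of B A C] splits_intros(3)[of B A "C + h"] 
  unfolding splits_unordered_def diff_box_def between_def by (elim disjE conjE) simp_all

lemma splits_sum_box: "splits_unordered (between A B C) (sum_box A B) (diff_box A C) (sum_box B C)"
  using three_orders lt
    splits_intros(1)[of "B - h" C A] splits_intros(1)[of "A - h" "C - h" B]
    splits_intros(5)[of "B - h" "C - h" A] splits_intros(5)[of "A - h" C B]
    splits_intros(2)[of "B - h" A C] splits_intros(2)[of "A - h" B C]
    splits_intros(3)[of "B - h" A C] splits_intros(3)[of "A - h" B C]
  unfolding splits_unordered_def diff_box_def sum_box_def between_def by (elim disjE conjE) simp_all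

end

lemma splits_end:
  assumes ne: "A \<noteq> B" and lt: "\<bar>A - B\<bar> < h"
  shows "splits_unordered False (sum_box A B) (A - h, A) (B - h, B)"
    and "splits_unordered False (A - h, A) (diff_box A B) (B - h, B)"
    and "B < A \<Longrightarrow> splits_unordered False (diff_box A B) (A - h, A) (B, B + h)"
    and "B < A \<Longrightarrow> splits_unordered False (A - h, A) (sum_box A B) (B, B + h)"
proof -
  show "splits_unordered False (sum_box A B) (A - h, A) (B - h, B)"
    using ne lt splits_intros(4)[of "B - h" A] splits_intros(4)[of "A - h" B]
    unfolding splits_unordered_def sum_box_def by (cases "A < B") simp_all
  show "splits_unordered False (A - h, A) (diff_box A B) (B - h, B)"
    using ne lt splits_intros(6)[of "A - h" B] splits_intros(7)[of "A - h" "B - h"]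
    unfolding splits_unordered_def diff_box_def by (cases "A < B") simp_all
  show "splits_unordered False (diff_box A B) (A - h, A) (B, B + h)" if "B < A"
    using that lt splits_intros(4)[of B A]
    unfolding splits_unordered_def diff_box_def by simp
  show "splits_unordered False (A - h, A) (sum_box A B) (B, B + h)" if "B < A"
    using that lt splits_intros(7)[of "A - h" B]
    unfolding splits_unordered_def sum_box_def by simp
qed

lemma place_n_lowest: "place n < place c" if "z = n - 1" "c \<in> J" "c \<noteq> n"
proof -
  have "n \<in> J" using that n4 by (auto simp: J_def)
  then have "place c \<noteq> place n" using place_inj[OF that(2)] that(3) by auto
  moreover have "base = place n" using base_cases place_n[OF that(1)] that(1) n4 by auto
  ultimately show ?thesis
    using place_bounds(1)[OF that(2)] by simp
qed

lemma place_distinct: "place a \<noteq> place b" "\<bar>place a - place b\<bar> < h" if "a \<in> J" "b \<in> J" "a \<noteq> b"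
  using place_inj[OF that(1,2)] that(3) place_bounds[OF that(1)] place_bounds[OF that(2)] by auto

lemma coord_values:
  assumes "1 \<le> a" "a < b" "b \<le> n"
  shows "a \<in> J \<Longrightarrow> b \<in> J \<Longrightarrow> coord (y a - y b) = diff_box (place a) (place b)"
    and "a \<in> J \<Longrightarrow> b \<in> J \<Longrightarrow> coord (y a + y b) = sum_box (place a) (place b)"
    and "a \<in> J \<Longrightarrow> b \<in> J \<Longrightarrow> coord (y b + y a) = sum_box (place b) (place a)"
    and "b = z \<Longrightarrow> coord (y a - y b) = (place a - h, place a) \<and> coord (y a + y b) = (place a - h, place a) \<and> coord (y b + y a) = (place a - h, place a)"
    and "a = z \<Longrightarrow> coord (y a - y b) = (place b, place b + h) \<and> coord (y a + y b) = (place b - h, place b) \<and> coord (y b + y a) = (place b - h, place b)"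
  using assms coord_diff[OF assms] coord_sum[OF assms]
  by (auto simp: add.commute diff_coord_def sum_coord_def diff_box_def sum_box_def J_def max.commute min.commute)

lemma in_J_or: "a \<in> J \<or> a = z" if "1 \<le> a" "a \<le> n"
  using that by (auto simp: J_def)

text \<open>If neither \<open>b\<close> nor \<open>c\<close> is \<open>z\<close>, the valley excludes the bad order of the places, as \<open>b\<close> is the largest of the three
indices.  The cases with \<open>z\<close> are matched with the shapes one by one.\<close>

lemma splits_diff:
  assumes "1 \<le> a" "a < c" "c < b" "b \<le> n"
  shows "splits_unordered False (coord (y a - y b)) (coord (y a - y c)) (coord (y c - y b))"
proof -
  have ord: "1 \<le> a" "1 \<le> c" "a < b" "c \<le> n" using assms by auto
  have aJ: "a \<in> J"
    using assms z_cases by (auto simp: J_def)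
  have cases: "b = z \<and> c \<in> J \<or> c = z \<and> b = n \<and> b \<in> J \<and> z = n - 1 \<or> b \<in> J \<and> c \<in> J"
    using assms ord z_cases in_J_or[of b] in_J_or[of c] by auto
  note vals = coord_values[OF assms(1) ord(3) assms(4)] coord_values[OF assms(1,2) ord(4)]
    coord_values[OF ord(2) assms(3,4)]
  from cases show ?thesis
  proof (elim disjE conjE)
    assume *: "b = z" "c \<in> J"
    have "place a \<noteq> place c" "\<bar>place a - place c\<bar> < h"
      using place_distinct[OF aJ *(2)] assms(2) by auto
    from splits_end(2)[OF this] show ?thesis
      using vals(4)[OF *(1)] vals(6)[OF aJ *(2)] vals(14)[OF *(1)] by simp
  next
    assume *: "c = z" "b = n" "b \<in> J" "z = n - 1"
    have "place a \<noteq> place b" "\<bar>place a - place b\<bar> < h" "place b < place a"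
      using place_distinct[OF aJ *(3)] place_n_lowest[OF *(4) aJ] ord(3) *(2) by auto
    from splits_end(3)[OF this] show ?thesis
      using vals(1)[OF aJ *(3)] vals(9)[OF *(1)] vals(15)[OF *(1)] by simp
  next
    assume *: "b \<in> J" "c \<in> J"
    have "\<not> between (place a) (place b) (place c)"
      using place_valley[OF aJ *] place_valley[OF *(2,1) aJ] assms by (auto simp: between_def)
    moreover have "place a \<noteq> place b" "place a \<noteq> place c" "place b \<noteq> place c" "\<bar>place a - place b\<bar> < h" "\<bar>place a - place c\<bar> < h" "\<bar>place b - place c\<bar> < h"
      using place_distinct[OF aJ *(1)] place_distinct[OF aJ *(2)] place_distinct[OF *] assms by auto
    ultimately show ?thesis
      using splits_diff_box vals(1)[OF aJ *(1)] vals(6)[OF aJ *(2)] vals(11)[OF *(2,1)] by simp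
  qed
qed

definition cross :: "nat \<Rightarrow> nat \<Rightarrow> nat \<Rightarrow> bool" where
  "cross a b c \<longleftrightarrow> {a, b, c} \<subseteq> J \<and> between (place a) (place b) (place c)"

lemma coord_y_sum:
  assumes "1 \<le> a" "a \<le> n" "1 \<le> b" "b \<le> n" "a \<noteq> b"
  shows "a \<in> J \<Longrightarrow> b \<in> J \<Longrightarrow> coord (y a + y b) = sum_box (place a) (place b)"
    and "a = z \<Longrightarrow> coord (y a + y b) = (place b - h, place b)"
    and "b = z \<Longrightarrow> coord (y a + y b) = (place a - h, place a)"
  using coord_values(2,4,5)[of a b] coord_values(3,4,5)[of b a] assms
  by (auto simp: nat_neq_iff)

lemma splits_sum_minus:
  assumes "1 \<le> a" "1 \<le> b" "b \<le> n" "a < c" "c \<le> n" "a \<noteq> b" "c \<noteq> b"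
  shows "splits_unordered (cross a b c) (coord (y a + y b)) (coord (y a - y c)) (coord (y b + y c))"
proof -
  have ord: "1 \<le> c" "a \<le> n" using assms by auto
  note ac = coord_values[OF assms(1,4,5)]
  note ab = coord_y_sum[OF assms(1) ord(2) assms(2,3,6)]
  note bc = coord_y_sum[OF assms(2,3) ord(1) assms(5) assms(7)[symmetric]]
  have nz: "k \<in> J \<Longrightarrow> k \<noteq> z" for k by (simp add: J_def)
  consider "a \<in> J" "b \<in> J" "c \<in> J" | "a = z" "b \<in> J" "c \<in> J" | "b = z" "a \<in> J" "c \<in> J" | "c = z" "a \<in> J" "b \<in> J"
    using assms in_J_or[of a] in_J_or[of b] in_J_or[of c] ord by auto
  then show ?thesis
  proof cases
    case 1
    then have "place a \<noteq> place b" "place a \<noteq> place c" "place b \<noteq> place c" "\<bar>place a - place b\<bar> < h" "\<bar>place a - place c\<bar> < h" "\<bar>place b - place c\<bar> < h"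
      using place_distinct[OF 1(1,2)] place_distinct[OF 1(1,3)] place_distinct[OF 1(2,3)] assms by auto
    from splits_sum_box[OF this] show ?thesis
      using 1 ab(1) ac(1) bc(1) by (simp add: cross_def)
  next
    case 2
    then have c: "c = n" "z = n - 1" using assms z_cases by auto
    then have "place b \<noteq> place c" "\<bar>place b - place c\<bar> < h" "place c < place b"
      using place_distinct[OF 2(2,3)] place_n_lowest[OF c(2) 2(2)] assms by auto
    from splits_end(4)[OF this] have "splits_unordered False (place b - h, place b) (place c, place c + h) (sum_box (place b) (place c))"
      by (auto simp: splits_unordered_def)
    moreover have "cross a b c = False" using 2 nz by (auto simp: cross_def)
    ultimately show ?thesis
      using 2 ab(2) ac(5) bc(1) by simp
  next
    case 3
    then have "place a \<noteq> place c" "\<bar>place a - place c\<bar> < h"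
      using place_distinct[OF 3(2,3)] assms by auto
    note splits_end(2)[OF this]
    moreover have "cross a b c = False" using 3 nz by (auto simp: cross_def)
    ultimately show ?thesis
      using 3 ab(3) ac(1) bc(2) by simp
  next
    case 4
    then have "place a \<noteq> place b" "\<bar>place a - place b\<bar> < h"
      using place_distinct[OF 4(2,3)] assms by auto
    note splits_end(1)[OF this]
    moreover have "cross a b c = False" using 4 nz by (auto simp: cross_def)
    ultimately show ?thesis
      using 4 ab(1) ac(4) bc(3) by simp
  qed
qed

text \<open>Exchanging \<open>a\<close> and \<open>b\<close> reduces this to \<open>splits_sum_minus\<close>.\<close>

lemma splits_sum_plus:
  assumes "1 \<le> a" "a < b" "b < c" "c \<le> n"
  shows "splits_unordered (cross b a c) (coord (y a + y b)) (coord (y a + y c)) (coord (y b - y c))"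
  using splits_sum_minus[of b a c] assms by (auto simp: splits_unordered_def add.commute)

section \<open>Non-minimal pairs are the crossing ones\<close>

lemma finite_pos_roots: "finite (pos_roots n)"
proof -
  have "pos_roots n \<subseteq> (\<lambda>(a, b). eps a - eps b) ` ({1..n} \<times> {1..n}) \<union> (\<lambda>(a, b). eps a + eps b) ` ({1..n} \<times> {1..n})"
    by (force simp: pos_roots_def)
  then show ?thesis
    by (rule finite_subset) auto
qed

abbreviation prec (infix "\<prec>" 50) where "prec \<equiv> AR_prec n Q \<xi> w"

lemma prec_trans: "\<alpha> \<prec> \<beta> \<Longrightarrow> \<beta> \<prec> \<gamma> \<Longrightarrow> \<alpha> \<prec> \<gamma>"
  if "\<alpha> \<in> pos_roots n" "\<beta> \<in> pos_roots n" "\<gamma> \<in> pos_roots n"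
  using prec_coord that below_trans by blast

lemma prec_irrefl: "\<not> \<alpha> \<prec> \<alpha>"
  by (simp add: AR_prec_def)

text \<open>Convexity of the order places \<open>\<gamma>\<close> between the members of every pair, so the conditions on
\<open>\<gamma>\<close> in the definition of minimality hold automatically.\<close>

lemma minimal_pair_iff:
  assumes \<gamma>: "\<gamma> \<in> pos_roots n" and p: "(\<alpha>, \<beta>) \<in> pairs n Q \<xi> w \<gamma>"
    and convex: "\<And>\<alpha> \<beta>. (\<alpha>, \<beta>) \<in> pairs n Q \<xi> w \<gamma> \<Longrightarrow> \<alpha> \<prec> \<gamma> \<and> \<gamma> \<prec> \<beta>"
  shows "(\<alpha>, \<beta>) \<in> minimal_pairs n Q \<xi> w \<gamma> \<longleftrightarrow>
    \<not> (\<exists>(\<alpha>', \<beta>')\<in>pairs n Q \<xi> w \<gamma>. \<alpha> \<prec> \<alpha>' \<and> \<beta>' \<prec> \<beta>)"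
proof
  assume "(\<alpha>, \<beta>) \<in> minimal_pairs n Q \<xi> w \<gamma>"
  then obtain L where L: "compatible_order n Q \<xi> w L" "minimal_wrt n Q \<xi> w L \<gamma> (\<alpha>, \<beta>)"
    by (auto simp: minimal_pairs_def)
  show "\<not> (\<exists>(\<alpha>', \<beta>')\<in>pairs n Q \<xi> w \<gamma>. \<alpha> \<prec> \<alpha>' \<and> \<beta>' \<prec> \<beta>)"
  proof
    assume "\<exists>(\<alpha>', \<beta>')\<in>pairs n Q \<xi> w \<gamma>. \<alpha> \<prec> \<alpha>' \<and> \<beta>' \<prec> \<beta>"
    then obtain \<alpha>' \<beta>' where p': "(\<alpha>', \<beta>') \<in> pairs n Q \<xi> w \<gamma>" "\<alpha> \<prec> \<alpha>'" "\<beta>' \<prec> \<beta>" by blast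
    have "(x, y) \<in> L" if "x \<in> pos_roots n" "y \<in> pos_roots n" "x \<prec> y" for x y
      using L(1) that by (auto simp: compatible_order_def)
    then have "(\<alpha>, \<alpha>') \<in> L \<and> (\<alpha>', \<gamma>) \<in> L \<and> (\<gamma>, \<beta>') \<in> L \<and> (\<beta>', \<beta>) \<in> L"
      using p p' convex[OF p'(1)] \<gamma> by (auto simp: pairs_def)
    then show False
      using L(2) p'(1) by (auto simp: minimal_wrt_def)
  qed
next
  assume *: "\<not> (\<exists>(\<alpha>', \<beta>')\<in>pairs n Q \<xi> w \<gamma>. \<alpha> \<prec> \<alpha>' \<and> \<beta>' \<prec> \<beta>)"
  have ab: "\<alpha> \<in> pos_roots n" "\<beta> \<in> pos_roots n" "\<alpha> \<prec> \<beta>"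
    using p by (auto simp: pairs_def)
  obtain L where L: "L \<subseteq> pos_roots n \<times> pos_roots n" "strict_linear_order_on (pos_roots n) L"
    "\<And>x y. x \<in> pos_roots n \<Longrightarrow> y \<in> pos_roots n \<Longrightarrow> x \<prec> y \<Longrightarrow> (x, y) \<in> L"
    "\<And>x y. (\<alpha>, x) \<in> L \<Longrightarrow> x \<prec> y \<Longrightarrow> (y, \<beta>) \<in> L \<Longrightarrow> \<alpha> \<prec> x \<and> y \<prec> \<beta>"
    by (rule linear_extension_tight[where r = "(\<prec>)", OF finite_pos_roots ab])
      (use prec_trans prec_irrefl in blast)+
  have "compatible_order n Q \<xi> w L"
    using L(1-3) by (auto simp: compatible_order_def)
  moreover have "minimal_wrt n Q \<xi> w L \<gamma> (\<alpha>, \<beta>)"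
    using * L(4) by (fastforce simp: minimal_wrt_def pairs_def)
  ultimately show "(\<alpha>, \<beta>) \<in> minimal_pairs n Q \<xi> w \<gamma>"
    using p by (auto simp: minimal_pairs_def)
qed

text \<open>The coordinates are given as unordered pairs, since which of the two summands is the lower one depends on the
orientation.\<close>

definition inside :: "int \<times> int \<Rightarrow> int \<times> int \<Rightarrow> int \<times> int \<Rightarrow> int \<times> int \<Rightarrow> bool" where
  "inside C D C' D' \<longleftrightarrow> (\<exists>L U L' U'. {C, D} = {L, U} \<and> {C', D'} = {L', U'} \<and>
     below L L' \<and> below L' U' \<and> below U' U)"

lemma inside_commute: "inside C D C' D' \<longleftrightarrow> inside D C D' C'"
  by (simp add: inside_def insert_commute)

lemma insideI: "below L L' \<Longrightarrow> below L' U' \<Longrightarrow> below U' U \<Longrightarrow> inside L U L' U'"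
  unfolding inside_def by blast

text \<open>Changing the sign of the vector at \<open>C\<close> turns the crossing decomposition into the one that it encloses.\<close>

lemma inside_cross:
  assumes "between A B C" "\<bar>A - C\<bar> < h"
  shows "inside (diff_box A C) (sum_box B C) (sum_box A C) (diff_box B C)"
proof (cases "A < B")
  case True
  then have *: "A < B" "B < C" "C - A < h" using assms by (auto simp: between_def)
  have "inside (A - h, C - h) (C - h, B) (B - h, C - h) (C - h, A)"
    by (rule insideI) (use * in \<open>auto simp: below_def\<close>)
  then have "inside (A - h, C - h) (C - h, B) (C - h, A) (B - h, C - h)"
    by (simp add: inside_def insert_commute)
  then show ?thesis
    using * by (simp add: diff_box_def sum_box_def)
next
  case False
  then have *: "C < B" "B < A" "A - C < h" using assms by (auto simp: between_def)
  have "inside (B - h, C) (C, A) (A - h, C) (C, B)"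
    by (rule insideI) (use * in \<open>auto simp: below_def\<close>)
  then have "inside (C, A) (B - h, C) (A - h, C) (C, B)"
    by (simp add: inside_def insert_commute)
  then show ?thesis
    using * by (simp add: diff_box_def sum_box_def)
qed

text \<open>The set \<open>D\<close> selects one of the two summands of each decomposition.  The summands are comparable by \<open>splits\<close>, so
each element of \<open>D\<close> comes from exactly one pair.  Crossing pairs are non-minimal by the last hypothesis, the others
are minimal by \<open>splits_nested\<close>.\<close>

lemma count_pairs:
  assumes \<gamma>: "\<gamma> \<in> pos_roots n" and fin: "finite D"
    and D: "\<And>\<delta>. \<delta> \<in> D \<Longrightarrow> \<delta> \<in> pos_roots n" "\<And>\<delta>. \<delta> \<in> D \<Longrightarrow> \<gamma> - \<delta> \<in> pos_roots n" "\<And>\<delta>. \<delta> \<in> D \<Longrightarrow> \<gamma> - \<delta> \<notin> D"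
    and splits: "\<And>\<delta>. \<delta> \<in> D \<Longrightarrow> splits_unordered (cr \<delta>) (coord \<gamma>) (coord \<delta>) (coord (\<gamma> - \<delta>))"
    and cover: "\<And>\<alpha> \<beta>. \<alpha> \<in> pos_roots n \<Longrightarrow> \<beta> \<in> pos_roots n \<Longrightarrow> \<alpha> + \<beta> = \<gamma> \<Longrightarrow> \<alpha> \<in> D \<or> \<beta> \<in> D"
    and inner: "\<And>\<delta>. \<delta> \<in> D \<Longrightarrow> cr \<delta> \<Longrightarrow> \<exists>\<epsilon>\<in>D. inside (coord \<delta>) (coord (\<gamma> - \<delta>)) (coord \<epsilon>) (coord (\<gamma> - \<epsilon>))"
  shows "finite (pairs n Q \<xi> w \<gamma>) \<and> card (pairs n Q \<xi> w \<gamma>) = card D \<and>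
    card (pairs n Q \<xi> w \<gamma> - minimal_pairs n Q \<xi> w \<gamma>) = card {\<delta> \<in> D. cr \<delta>}"
proof -
  let ?pairs = "pairs n Q \<xi> w \<gamma>"
  define half where "half p = (if fst p \<in> D then fst p else snd p)" for p :: "vec \<times> vec"
  have asym: "\<not> below U L" if "below L U" for L U
    using that by (auto simp: below_def prod_eq_iff)
  have orient: "L = D \<and> U = C" if "{C, D} = {L, U}" "below L U" "below D C" for C D L U
    using that(1,2) asym[OF that(3)] by (auto simp only: doubleton_eq_iff)
  have pairE: "\<alpha> \<in> pos_roots n" "\<beta> \<in> pos_roots n" "\<alpha> + \<beta> = \<gamma>" "below (coord \<beta>) (coord \<alpha>)"
    if "(\<alpha>, \<beta>) \<in> ?pairs" for \<alpha> \<beta>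
    using that prec_coord by (auto simp: pairs_def)
  have half: "half p \<in> D \<and> (p = (half p, \<gamma> - half p) \<or> p = (\<gamma> - half p, half p))" if "p \<in> ?pairs" for p
  proof -
    obtain \<alpha> \<beta> where p: "p = (\<alpha>, \<beta>)" by (cases p)
    note roots = pairE[OF that[unfolded p]]
    have "\<beta> = \<gamma> - \<alpha>" "\<alpha> = \<gamma> - \<beta>"
      using roots(3) by (auto simp: algebra_simps)
    then show ?thesis
      using cover[OF roots(1-3)] by (auto simp: p half_def)
  qed
  have pair_splits: "splits (cr (half (\<alpha>, \<beta>))) (coord \<gamma>) (coord \<beta>) (coord \<alpha>)" if p: "(\<alpha>, \<beta>) \<in> ?pairs" for \<alpha> \<beta>
  proof -
    have "splits_unordered (cr (half (\<alpha>, \<beta>))) (coord \<gamma>) (coord \<alpha>) (coord \<beta>)"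
      using half[OF p] splits[of "half (\<alpha>, \<beta>)"] by (auto simp: splits_unordered_def)
    moreover have "\<not> splits (cr (half (\<alpha>, \<beta>))) (coord \<gamma>) (coord \<alpha>) (coord \<beta>)"
      using splits_below below_trans asym pairE(4)[OF p] by blast
    ultimately show ?thesis by (auto simp: splits_unordered_def)
  qed
  have surj: "\<exists>p\<in>?pairs. half p = \<delta> \<and> {fst p, snd p} = {\<delta>, \<gamma> - \<delta>}" if \<delta>: "\<delta> \<in> D" for \<delta>
  proof -
    have "below (coord \<delta>) (coord (\<gamma> - \<delta>)) \<or> below (coord (\<gamma> - \<delta>)) (coord \<delta>)"
      using splits[OF \<delta>] splits_below below_trans unfolding splits_unordered_def by blast
    then have "(\<gamma> - \<delta>, \<delta>) \<in> ?pairs \<or> (\<delta>, \<gamma> - \<delta>) \<in> ?pairs"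
      using D(1,2)[OF \<delta>] prec_coord by (auto simp: pairs_def)
    then show ?thesis
    proof
      assume "(\<gamma> - \<delta>, \<delta>) \<in> ?pairs"
      then show ?thesis
        by (rule bexI[rotated]) (use D(3)[OF \<delta>] in \<open>auto simp: half_def\<close>)
    next
      assume "(\<delta>, \<gamma> - \<delta>) \<in> ?pairs"
      then show ?thesis
        by (rule bexI[rotated]) (use \<delta> in \<open>auto simp: half_def\<close>)
    qed
  qed
  have bij: "bij_betw half ?pairs D"
  proof (rule bij_betw_imageI)
    show "inj_on half ?pairs"
    proof (rule inj_onI)
      fix p q assume pq: "p \<in> ?pairs" "q \<in> ?pairs" "half p = half q"
      show "p = q"
      proof (rule ccontr)
        assume "p \<noteq> q"
        then obtain \<alpha> \<beta> where "(\<alpha>, \<beta>) \<in> ?pairs" "(\<beta>, \<alpha>) \<in> ?pairs"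
          using half[OF pq(1)] half[OF pq(2)] pq by metis
        then show False
          using pairE(4) asym by blast
      qed
    qed
    show "half ` ?pairs = D"
      using half surj by blast
  qed
  have card: "card ?pairs = card D"
    using bij_betw_same_card[OF bij] .
  have finite: "finite ?pairs"
    using bij_betw_finite[OF bij] fin by simp
  have nonmin: "p \<notin> minimal_pairs n Q \<xi> w \<gamma> \<longleftrightarrow> cr (half p)" if p: "p \<in> ?pairs" for p
  proof -
    obtain \<alpha> \<beta> where p_eq: "p = (\<alpha>, \<beta>)" by (cases p)
    note pab = p[unfolded p_eq]
    note roots = pairE[OF pab]
    have convex: "\<alpha> \<prec> \<gamma> \<and> \<gamma> \<prec> \<beta>" if "(\<alpha>, \<beta>) \<in> ?pairs" for \<alpha> \<beta>
      using splits_below[OF pair_splits[OF that]] pairE(1,2)[OF that] \<gamma> prec_coord by blast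
    have "p \<notin> minimal_pairs n Q \<xi> w \<gamma> \<longleftrightarrow> (\<exists>(\<alpha>', \<beta>')\<in>?pairs. \<alpha> \<prec> \<alpha>' \<and> \<beta>' \<prec> \<beta>)"
      unfolding p_eq using minimal_pair_iff[OF \<gamma> pab convex] by simp
    also have "\<dots> \<longleftrightarrow> cr (half p)"
    proof
      assume "\<exists>(\<alpha>', \<beta>')\<in>?pairs. \<alpha> \<prec> \<alpha>' \<and> \<beta>' \<prec> \<beta>"
      then obtain \<alpha>' \<beta>' where q: "(\<alpha>', \<beta>') \<in> ?pairs" "\<alpha> \<prec> \<alpha>'" "\<beta>' \<prec> \<beta>" by blast
      have "below (coord \<beta>) (coord \<beta>')" "below (coord \<alpha>') (coord \<alpha>)"
        using q roots(1,2) pairE(1,2)[OF q(1)] prec_coord by blast+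
      then show "cr (half p)"
        using splits_nested[OF pair_splits[OF pab] pair_splits[OF q(1)]] p_eq by simp
    next
      assume cr: "cr (half p)"
      obtain \<epsilon> where \<epsilon>: "\<epsilon> \<in> D" "inside (coord (half p)) (coord (\<gamma> - half p)) (coord \<epsilon>) (coord (\<gamma> - \<epsilon>))"
        using inner[OF _ cr] half[OF p] by blast
      obtain q where q: "q \<in> ?pairs" "{fst q, snd q} = {\<epsilon>, \<gamma> - \<epsilon>}"
        using surj[OF \<epsilon>(1)] by blast
      obtain \<alpha>' \<beta>' where q_eq: "q = (\<alpha>', \<beta>')" by (cases q)
      note qab = q(1)[unfolded q_eq]
      have "{coord \<alpha>, coord \<beta>} = {coord (half p), coord (\<gamma> - half p)}"
        using half[OF p] unfolding p_eq by auto
      moreover have "{coord \<alpha>', coord \<beta>'} = {coord \<epsilon>, coord (\<gamma> - \<epsilon>)}"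
        using q(2) unfolding q_eq by (auto simp: doubleton_eq_iff)
      ultimately obtain L U L' U' where LU: "{coord \<alpha>, coord \<beta>} = {L, U}" "{coord \<alpha>', coord \<beta>'} = {L', U'}"
        "below L L'" "below L' U'" "below U' U"
        using \<epsilon>(2) unfolding inside_def by metis
      have "below L U" using LU below_trans by blast
      then have "L = coord \<beta>" "U = coord \<alpha>" "L' = coord \<beta>'" "U' = coord \<alpha>'"
        using orient[OF LU(1) \<open>below L U\<close> roots(4)] orient[OF LU(2,4) pairE(4)[OF qab]] by auto
      then have "\<alpha> \<prec> \<alpha>'" "\<beta>' \<prec> \<beta>"
        using LU roots(1,2) pairE(1,2)[OF qab] prec_coord by blast+
      then show "\<exists>(\<alpha>', \<beta>')\<in>?pairs. \<alpha> \<prec> \<alpha>' \<and> \<beta>' \<prec> \<beta>"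
        using qab by blast
    qed
    finally show ?thesis .
  qed
  have "bij_betw half (?pairs - minimal_pairs n Q \<xi> w \<gamma>) {\<delta> \<in> D. cr \<delta>}"
  proof -
    have "half ` (?pairs - minimal_pairs n Q \<xi> w \<gamma>) = {\<delta> \<in> D. cr \<delta>}"
    proof
      show "half ` (?pairs - minimal_pairs n Q \<xi> w \<gamma>) \<subseteq> {\<delta> \<in> D. cr \<delta>}"
        using half nonmin by blast
      show "{\<delta> \<in> D. cr \<delta>} \<subseteq> half ` (?pairs - minimal_pairs n Q \<xi> w \<gamma>)"
        using surj nonmin by blast
    qed
    moreover have "inj_on half (?pairs - minimal_pairs n Q \<xi> w \<gamma>)"
      using bij by (auto simp: bij_betw_def intro: inj_on_subset)
    ultimately show ?thesis by (simp add: bij_betw_def)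
  qed
  then have "card (?pairs - minimal_pairs n Q \<xi> w \<gamma>) = card {\<delta> \<in> D. cr \<delta>}"
    by (rule bij_betw_same_card)
  then show ?thesis
    using card finite by blast
qed

section \<open>Counting\<close>

lemma y_inj: "y a = y b \<longleftrightarrow> a = b"
proof
  assume "y a = y b"
  from fun_cong[OF this, of a] show "a = b"
    using s_cases(1)[of a] by (auto simp: y_apply split: if_splits)
qed simp

lemma pos_root_diff: "y a - y b \<in> pos_roots n" if "1 \<le> a" "a < b" "b \<le> n"
  using that pos_roots_y by blast

lemma pos_root_sum: "y a + y b \<in> pos_roots n" if "1 \<le> a" "1 \<le> b" "a \<le> n" "b \<le> n" "a \<noteq> b"
  using that pos_roots_y[of "y a + y b"] by (metis add.commute linorder_neqE_nat)

lemma pairs_diff: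
  assumes ab: "1 \<le> a" "a < b" "b \<le> n"
  shows "finite (pairs n Q \<xi> w (y a - y b)) \<and> card (pairs n Q \<xi> w (y a - y b)) = b - a - 1 \<and>
    card (pairs n Q \<xi> w (y a - y b) - minimal_pairs n Q \<xi> w (y a - y b)) = 0"
proof -
  define D where "D = (\<lambda>c. y a - y c) ` {a<..<b}"
  have "inj_on (\<lambda>c. y a - y c) {a<..<b}"
    by (auto simp: inj_on_def y_inj)
  then have card: "card D = b - a - 1"
    by (simp add: D_def card_image)
  have eq: "y a - y b - (y a - y c) = y c - y b" for c by simp
  have D: "\<exists>c. a < c \<and> c < b \<and> \<delta> = y a - y c" if "\<delta> \<in> D" for \<delta>
    using that by (auto simp: D_def)
  have "finite (pairs n Q \<xi> w (y a - y b)) \<and> card (pairs n Q \<xi> w (y a - y b)) = card D \<and>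
    card (pairs n Q \<xi> w (y a - y b) - minimal_pairs n Q \<xi> w (y a - y b)) = card {\<delta> \<in> D. False}"
  proof (rule count_pairs)
    show "y a - y b \<in> pos_roots n" using pos_root_diff[OF ab] .
    show "finite D" by (simp add: D_def)
    show "\<delta> \<in> pos_roots n" if "\<delta> \<in> D" for \<delta>
      using D[OF that] pos_root_diff ab by auto
    show "y a - y b - \<delta> \<in> pos_roots n" if "\<delta> \<in> D" for \<delta>
      using D[OF that] pos_root_diff ab eq by auto
    show "splits_unordered False (coord (y a - y b)) (coord \<delta>) (coord (y a - y b - \<delta>))" if "\<delta> \<in> D" for \<delta>
      using D[OF that] splits_diff[OF ab(1) _ _ ab(3)] eq by auto
    show "y a - y b - \<delta> \<notin> D" if \<delta>: "\<delta> \<in> D" for \<delta>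
    proof
      assume *: "y a - y b - \<delta> \<in> D"
      obtain c d where c: "a < c" "a < d" "y c - y b = y a - y d"
        using D[OF \<delta>] D[OF *] eq by metis
      from fun_cong[OF c(3), of a] show False
        using c(1,2) ab s_cases(1)[of a] by (auto simp: y_apply)
    qed
    show "\<alpha> \<in> D \<or> \<beta> \<in> D" if "\<alpha> \<in> pos_roots n" "\<beta> \<in> pos_roots n" "\<alpha> + \<beta> = y a - y b" for \<alpha> \<beta>
      using y_decompose_diff[OF ab(2) that] by (metis D_def greaterThanLessThan_iff image_eqI)
  qed simp
  then show ?thesis
    using card by simp
qed

text \<open>\<open>D1\<close> and \<open>D2\<close> are the summands that contain \<open>y a\<close>.  For \<open>c > b\<close> both signs of \<open>y c\<close> occur, and if none of \<open>a\<close>, \<open>b\<close>, \<open>c\<close> is \<open>z\<close>,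
then by the valley one of \<open>a\<close> and \<open>b\<close> is placed between the other and \<open>c\<close>; this selects the sign for which the decomposition is crossing.  For
\<open>a < c < b\<close> only one sign occurs, and the valley forbids that it is the crossing one.\<close>

lemma pairs_sum:
  assumes ab: "1 \<le> a" "a < b" "b \<le> n"
  shows "finite (pairs n Q \<xi> w (y a + y b)) \<and> int (card (pairs n Q \<xi> w (y a + y b))) = 2 * int n - int a - int b - 1 \<and>
    card (pairs n Q \<xi> w (y a + y b) - minimal_pairs n Q \<xi> w (y a + y b)) = card {b..n - 2}"
proof -
  define D1 where "D1 = (\<lambda>c. y a - y c) ` ({a<..n} - {b})"
  define D2 where "D2 = (\<lambda>c. y a + y c) ` {b<..n}"
  define cr where "cr \<delta> \<longleftrightarrow> (\<exists>c. \<delta> = y a - y c \<and> cross a b c \<or> \<delta> = y a + y c \<and> cross b a c)" for \<delta>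
  have sa: "s c \<noteq> 0" for c using s_cases(1)[of c] by auto
  have diff_neq_sum: "y a - y c \<noteq> y a + y d" for c d
  proof
    assume "y a - y c = y a + y d"
    then have "- y c = y d" by (metis add_left_cancel diff_conv_add_uminus)
    from fun_cong[OF this, of c] fun_cong[OF this, of d] have "c = d" "s c = - s c"
      using sa[of c] sa[of d] by (auto simp: y_apply split: if_splits)
    then show False using sa[of c] by simp
  qed
  have cr1: "cr (y a - y c) \<longleftrightarrow> cross a b c" for c
    using diff_neq_sum by (auto simp: cr_def y_inj)
  have cr2: "cr (y a + y c) \<longleftrightarrow> cross b a c" for c
    using diff_neq_sum[symmetric] by (auto simp: cr_def y_inj)
  have "inj_on (\<lambda>c. y a - y c) ({a<..n} - {b})" "inj_on (\<lambda>c. y a + y c) {b<..n}"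
    by (auto simp: inj_on_def y_inj)
  then have "card D1 = n - a - 1" "card D2 = n - b"
    using ab by (auto simp: D1_def D2_def card_image)
  moreover have "D1 \<inter> D2 = {}"
    using diff_neq_sum by (auto simp: D1_def D2_def)
  moreover have fin: "finite D1" "finite D2" by (auto simp: D1_def D2_def)
  ultimately have card: "int (card (D1 \<union> D2)) = 2 * int n - int a - int b - 1"
    using ab by (simp add: card_Un_disjoint)
  have D: "(\<exists>c. a < c \<and> c \<noteq> b \<and> c \<le> n \<and> \<delta> = y a - y c \<and> y a + y b - \<delta> = y b + y c) \<or>
      (\<exists>c. b < c \<and> c \<le> n \<and> \<delta> = y a + y c \<and> y a + y b - \<delta> = y b - y c)" if "\<delta> \<in> D1 \<union> D2" for \<delta>
    using that by (auto simp: D1_def D2_def)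
  have valley: "b < c" if "cross a b c" "a < c" for c
    using that place_valley[of a b c] place_valley[of c b a] ab by (auto simp: cross_def between_def)
  have crD: "\<exists>c. (\<delta> = y a - y c \<and> y a + y b - \<delta> = y b + y c \<and> cross a b c \<or>
          \<delta> = y a + y c \<and> y a + y b - \<delta> = y b - y c \<and> cross b a c) \<and> b < c \<and> c \<le> n"
    if \<delta>: "\<delta> \<in> D1 \<union> D2" and cr: "cr \<delta>" for \<delta>
    using D[OF \<delta>]
  proof (elim disjE exE conjE)
    fix c assume c: "a < c" "c \<le> n" "\<delta> = y a - y c" "y a + y b - \<delta> = y b + y c"
    have "cross a b c" using cr cr1 c(3) by simp
    then show ?thesis using c(2,3,4) valley[OF _ c(1)] by blast
  next
    fix c assume c: "b < c" "c \<le> n" "\<delta> = y a + y c" "y a + y b - \<delta> = y b - y c"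
    have "cross b a c" using cr cr2 c(3) by simp
    then show ?thesis using c by blast
  qed
  have crossing: "cross a b c \<or> cross b a c" if "b < c" "c \<in> J" "a \<in> J" "b \<in> J" for c
  proof -
    have "\<not> (place a < place c \<and> place c < place b)" "\<not> (place b < place c \<and> place c < place a)"
      using place_valley[OF that(3,2,4)] place_valley[OF that(4,2,3)] that(1) ab by auto
    moreover have "place a \<noteq> place b" "place a \<noteq> place c" "place b \<noteq> place c"
      using place_distinct(1)[OF that(3,4)] place_distinct(1)[OF that(3,2)] place_distinct(1)[OF that(4,2)] that(1) ab by auto
    ultimately have "between (place a) (place b) (place c) \<or> between (place b) (place a) (place c)"
      unfolding between_def by linarith
    then show ?thesis using that by (auto simp: cross_def)
  qed
  have ncross: "\<not> (cross a b c \<and> cross b a c)" for c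
    by (auto simp: cross_def between_def)
  have "finite (pairs n Q \<xi> w (y a + y b)) \<and> card (pairs n Q \<xi> w (y a + y b)) = card (D1 \<union> D2) \<and>
    card (pairs n Q \<xi> w (y a + y b) - minimal_pairs n Q \<xi> w (y a + y b)) = card {\<delta> \<in> D1 \<union> D2. cr \<delta>}"
  proof (rule count_pairs)
    show "y a + y b \<in> pos_roots n" using pos_root_sum ab by simp
    show "finite (D1 \<union> D2)" using fin by simp
    show "\<delta> \<in> pos_roots n" if "\<delta> \<in> D1 \<union> D2" for \<delta>
      using D[OF that] pos_root_diff[of a] pos_root_sum[of a] ab by auto
    show "y a + y b - \<delta> \<in> pos_roots n" if "\<delta> \<in> D1 \<union> D2" for \<delta>
      using D[OF that]
    proof (elim disjE exE conjE)
      fix c assume c: "a < c" "c \<noteq> b" "c \<le> n" "y a + y b - \<delta> = y b + y c"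
      show ?thesis unfolding c(4) using pos_root_sum[of b c] c(1-3) ab by simp
    next
      fix c assume c: "b < c" "c \<le> n" "y a + y b - \<delta> = y b - y c"
      show ?thesis unfolding c(3) using pos_root_diff[of b c] c(1,2) ab by simp
    qed
    show "y a + y b - \<delta> \<notin> D1 \<union> D2" if "\<delta> \<in> D1 \<union> D2" for \<delta>
    proof
      assume *: "y a + y b - \<delta> \<in> D1 \<union> D2"
      have "(y a + y b - \<delta>) a = 0"
        using D[OF that]
      proof (elim disjE exE conjE)
        fix c assume c: "a < c" "y a + y b - \<delta> = y b + y c"
        show ?thesis unfolding c(2) using c(1) ab by (simp add: y_apply)
      next
        fix c assume c: "b < c" "y a + y b - \<delta> = y b - y c"
        show ?thesis unfolding c(2) using c(1) ab by (simp add: y_apply)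
      qed
      moreover have "(y a + y b - \<delta>) a \<noteq> 0"
        using D[OF *]
      proof (elim disjE exE conjE)
        fix c assume c: "a < c" "y a + y b - \<delta> = y a - y c"
        show ?thesis unfolding c(2) using c(1) ab sa[of a] by (simp add: y_apply)
      next
        fix c assume c: "b < c" "y a + y b - \<delta> = y a + y c"
        show ?thesis unfolding c(2) using c(1) ab sa[of a] by (simp add: y_apply)
      qed
      ultimately show False by simp
    qed
    show "splits_unordered (cr \<delta>) (coord (y a + y b)) (coord \<delta>) (coord (y a + y b - \<delta>))" if "\<delta> \<in> D1 \<union> D2" for \<delta>
      using D[OF that]
    proof (elim disjE exE conjE)
      fix c assume c: "a < c" "c \<noteq> b" "c \<le> n" "\<delta> = y a - y c" "y a + y b - \<delta> = y b + y c"
      then show ?thesis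
        using splits_sum_minus[of a b c] cr1 ab by simp
    next
      fix c assume c: "b < c" "c \<le> n" "\<delta> = y a + y c" "y a + y b - \<delta> = y b - y c"
      then show ?thesis
        using splits_sum_plus[of a b c] cr2[of c] ab by simp
    qed
    show "\<alpha> \<in> D1 \<union> D2 \<or> \<beta> \<in> D1 \<union> D2" if "\<alpha> \<in> pos_roots n" "\<beta> \<in> pos_roots n" "\<alpha> + \<beta> = y a + y b" for \<alpha> \<beta>
      using y_decompose_sum[OF ab(2) that]
    proof cases
      case (1 c)
      then have "y a - y c \<in> D1" by (auto simp: D1_def)
      with 1 show ?thesis by auto
    next
      case (2 c)
      then have "y a + y c \<in> D2" by (auto simp: D2_def)
      with 2 show ?thesis by auto
    qed
    show "\<exists>\<epsilon>\<in>D1 \<union> D2. inside (coord \<delta>) (coord (y a + y b - \<delta>)) (coord \<epsilon>) (coord (y a + y b - \<epsilon>))"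
      if \<delta>: "\<delta> \<in> D1 \<union> D2" and cr: "cr \<delta>" for \<delta>
    proof -
      obtain c where c: "\<delta> = y a - y c \<and> y a + y b - \<delta> = y b + y c \<and> cross a b c \<or>
          \<delta> = y a + y c \<and> y a + y b - \<delta> = y b - y c \<and> cross b a c" "b < c" "c \<le> n"
        using crD[OF \<delta> cr] by blast
      have J: "a \<in> J" "b \<in> J" "c \<in> J" using c(1) by (auto simp: cross_def)
      have lt: "\<bar>place a - place c\<bar> < h" "\<bar>place b - place c\<bar> < h"
        using place_distinct(2) J ab c(2) by auto
      have coords: "coord (y a - y c) = diff_box (place a) (place c)" "coord (y a + y c) = sum_box (place a) (place c)"
        "coord (y b - y c) = diff_box (place b) (place c)" "coord (y b + y c) = sum_box (place b) (place c)"
        using coord_values(1,2)[of a c] coord_values(1,2)[of b c] J ab c(2,3) by auto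
      have mem: "y a - y c \<in> D1 \<union> D2" "y a + y c \<in> D1 \<union> D2"
        using ab c(2,3) by (auto simp: D1_def D2_def)
      have eqs: "y a + y b - (y a + y c) = y b - y c" "y a + y b - (y a - y c) = y b + y c" by simp_all
      from c(1) show ?thesis
      proof (elim disjE conjE)
        assume *: "\<delta> = y a - y c" "y a + y b - \<delta> = y b + y c" "cross a b c"
        show ?thesis
          using inside_cross[of "place a" "place b" "place c"] *(3) lt mem(2)
          by (intro bexI[of _ "y a + y c"]) (simp_all add: * eqs coords cross_def)
      next
        assume *: "\<delta> = y a + y c" "y a + y b - \<delta> = y b - y c" "cross b a c"
        show ?thesis
          using inside_cross[of "place b" "place a" "place c"] *(3) lt mem(1) inside_commute
          by (intro bexI[of _ "y a - y c"]) (simp_all add: * eqs coords cross_def)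
      qed
    qed
  qed
  moreover have "card {\<delta> \<in> D1 \<union> D2. cr \<delta>} = card {b..n - 2}"
  proof (cases "a \<in> J \<and> b \<in> J")
    case True
    \<comment> \<open>The sign of \<open>y c\<close> for which the decomposition is crossing.\<close>
    define f where "f c = (if cross a b c then y a - y c else y a + y c)" for c
    have "bij_betw f {c \<in> J. b < c} {\<delta> \<in> D1 \<union> D2. cr \<delta>}"
    proof (rule bij_betw_imageI)
      show "inj_on f {c \<in> J. b < c}"
      proof (rule inj_onI)
        fix c d assume *: "c \<in> {c \<in> J. b < c}" "d \<in> {c \<in> J. b < c}" "f c = f d"
        then show "c = d"
          using *(3) diff_neq_sum[of c d] diff_neq_sum[of d c] by (auto simp: f_def y_inj split: if_splits)
      qed
      show "f ` {c \<in> J. b < c} = {\<delta> \<in> D1 \<union> D2. cr \<delta>}"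
      proof (intro equalityI subsetI)
        fix \<delta> assume "\<delta> \<in> f ` {c \<in> J. b < c}"
        then obtain c where c: "c \<in> J" "b < c" "\<delta> = f c" by auto
        then have "c \<le> n" "a < c" using ab by (auto simp: J_def)
        then show "\<delta> \<in> {\<delta> \<in> D1 \<union> D2. cr \<delta>}"
          using c crossing[of c] True cr1 cr2 ab by (auto simp: f_def D1_def D2_def)
      next
        fix \<delta> assume *: "\<delta> \<in> {\<delta> \<in> D1 \<union> D2. cr \<delta>}"
        then obtain c where c: "\<delta> = y a - y c \<and> cross a b c \<or> \<delta> = y a + y c \<and> cross b a c" "b < c"
          using crD[of \<delta>] by blast
        then have "f c = \<delta>" using ncross by (auto simp: f_def)
        moreover have "c \<in> J" using c by (auto simp: cross_def)
        ultimately show "\<delta> \<in> f ` {c \<in> J. b < c}" using c(2) by auto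
      qed
    qed
    then have "card {\<delta> \<in> D1 \<union> D2. cr \<delta>} = card {c \<in> J. b < c}"
      by (metis bij_betw_same_card)
    also have "\<dots> = card {b..n - 2}"
    proof (cases "b < z")
      case True
      then have "{c \<in> J. b < c} = {b<..n} - {z}" by (auto simp: J_def)
      moreover have "z \<in> {b<..n}" using True z_cases by auto
      ultimately have "card {c \<in> J. b < c} = n - b - 1" by simp
      moreover have "card {b..n - 2} = n - b - 1" using n4 by simp
      ultimately show ?thesis by simp
    next
      case False
      then have "b = n" using \<open>a \<in> J \<and> b \<in> J\<close> z_cases ab by (auto simp: J_def)
      then have "{c \<in> J. b < c} = {}" by (auto simp: J_def)
      moreover have "{b..n - 2} = {}" using \<open>b = n\<close> n4 by simp
      ultimately show ?thesis by (simp only: card.empty)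
    qed
    finally show ?thesis .
  next
    case False
    then have "b \<ge> n - 1"
      using ab z_cases in_J_or[of a] in_J_or[of b] by auto
    then have "{b..n - 2} = {}" using n4 by auto
    moreover have "{\<delta> \<in> D1 \<union> D2. cr \<delta>} = {}"
      using False by (auto simp: cr_def cross_def)
    ultimately show ?thesis by (simp only: card.empty)
  qed
  ultimately show ?thesis
    using card by simp
qed

lemma pairs_count:
  assumes \<gamma>: "\<gamma> \<in> pos_roots n"
  shows "finite (pairs n Q \<xi> w \<gamma>) \<and> int (card (pairs n Q \<xi> w \<gamma>)) = ht n \<gamma> - 1 \<and>
    card (pairs n Q \<xi> w \<gamma> - minimal_pairs n Q \<xi> w \<gamma>) = card (Supp_ge n 2 \<gamma>)"
proof -
  obtain a b where ab: "1 \<le> a" "a < b" "b \<le> n" and ys: "\<gamma> = y a - y b \<or> \<gamma> = y a + y b"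
    using \<gamma> by (auto simp: pos_roots_y)
  have ya: "y a = eps a" using ab s_cases(2)[of a] by (simp add: y_def fun_eq_iff)
  have yb: "y b = eps b \<or> b = n \<and> y b = - eps b"
    using s_cases(1)[of b] s_cases(2)[of b] by (auto simp: y_def fun_eq_iff)
  have nonempty: "{n..n - 2} = {}" using n4 by auto
  note vals = ht_diff[OF n4 ab] ht_sum[OF n4 ab] Supp_ge_2_diff[OF n4 ab] Supp_ge_2_sum[OF n4 ab]
  from ys yb show ?thesis
    using pairs_diff[OF ab] pairs_sum[OF ab] ab vals ya nonempty by (elim disjE) (auto simp: of_nat_diff)
qed

end

theorem corollary3p19:
  fixes n :: nat and Q :: "nat rel" and \<xi> :: "nat \<Rightarrow> int" and w :: "nat list" and \<gamma> :: vec
  assumes "n \<ge> 4"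
    and "dynkin_quiver n Q"
    and "height_function Q \<xi>"
    and "adapted_word n Q w"
    and "\<gamma> \<in> pos_roots n"
  shows "int (card (minimal_pairs n Q \<xi> w \<gamma>)) = int (card (Supp_ge n 1 \<gamma>)) - 1
    \<and> card (pairs n Q \<xi> w \<gamma> - minimal_pairs n Q \<xi> w \<gamma>) = card (Supp_ge n 2 \<gamma>)
    \<and> int (card (pairs n Q \<xi> w \<gamma>)) = ht n \<gamma> - 1"
proof -
  interpret D_quiver n Q \<xi> w
    using assms by unfold_locales
  have pairs_count: "finite (pairs n Q \<xi> w \<gamma>)" "int (card (pairs n Q \<xi> w \<gamma>)) = ht n \<gamma> - 1"
    "card (pairs n Q \<xi> w \<gamma> - minimal_pairs n Q \<xi> w \<gamma>) = card (Supp_ge n 2 \<gamma>)"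
    using pairs_count[OF assms(5)] by auto
  have "minimal_pairs n Q \<xi> w \<gamma> \<subseteq> pairs n Q \<xi> w \<gamma>"
    by (auto simp: minimal_pairs_def)
  then have "card (pairs n Q \<xi> w \<gamma>) =
      card (minimal_pairs n Q \<xi> w \<gamma>) + card (pairs n Q \<xi> w \<gamma> - minimal_pairs n Q \<xi> w \<gamma>)"
    using pairs_count(1) by (metis card_Diff_subset card_mono finite_subset le_add_diff_inverse)
  then show ?thesis
    using pairs_count(2,3) ht_eq_card_Supp[OF assms(1,5)] by simp
qed

end
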